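(* Let $\mu$ be an absolutely continuous infinitely divisible distribution on $\mathbb{R}_+$ (with zero drift $\gamma_0=0$) with Lévy measure $\nu$ satisfying $\nu((c,\infty))>0$ for all $c>0$, and let $p(x)$ be a density of $\mu$. Then we have the following. (i) Assume that $p\in\mathcal{L}_d$. Then $p\in\mathcal{S}_d$ if and only if $\nu_{(1)}\in\mathcal{S}_{loc}$. (ii) The following are equivalent: (a) $p\in\mathcal{S}_d$. (b) $\nu_{(1)}\in\mathcal{L}_{loc}$ and $p(x)\sim\nu((x,x+1])$. (c) $\nu_{(1)}\in\mathcal{L}_{loc}$ and there is $C\in(0,\infty)$ such that $p(x)\sim C\,\nu((x,x+1])$.
   Context: $\mathbb{R}_+=[0,\infty)$. For functions $f,h$ that are positive on some half line $[A,\infty)$, $f(x)\sim h(x)$ means $\lim_{x\to\infty}f(x)/h(x)=1$. A nonnegative measurable function $h$ on $\mathbb{R}$ belongs to the class $\mathbf{L}$ (long-tailed) if $h(x+a)\sim h(x)$ for every $a\in\mathbb{R}$. For probability densities $f,h$ on $\mathbb{R}$, $f\otimes h(x)=\int_{-\infty}^{\infty} f(x-u)h(u)\,du$ and $f^{2\otimes}=f\otimes f$; $\rho^{2*}=\rho*\rho$ is the convolution square of a distribution $\rho$. Densities of distributions on $\mathbb{R}_+$ are regarded as functions on $\mathbb{R}$ vanishing on $(-\infty,0)$. A probability density $h$ on $\mathbb{R}$ belongs to $\mathcal{L}_d$ if $h\in\mathbf{L}$; it belongs to $\mathcal{S}_d$ (subexponential density) if $h\in\mathcal{L}_d$ and $h^{2\otimes}(x)\sim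 2h(x)$. A distribution $\rho$ on $\mathbb{R}$ belongs to $\mathcal{L}_{loc}$ if for every $c>0$ the function $x\mapsto\rho((x,x+c])$ is in $\mathbf{L}$; it belongs to $\mathcal{S}_{loc}$ (locally subexponential) if for every $c>0$ the function $x\mapsto\rho((x,x+c])$ is in $\mathbf{L}$ and $\rho^{2*}((x,x+c])\sim 2\rho((x,x+c])$. An infinitely divisible distribution $\mu$ on $\mathbb{R}_+$ has characteristic function $\widehat\mu(z)=\int e^{izx}\mu(dx)=\exp\left(\int_0^\infty(e^{izx}-1)\nu(dx)+i\gamma_0z\right)$, where $\gamma_0\in\mathbb{R}_+$ is the drift and the Lévy measure $\nu$ is a measure on $\mathbb{R}_+$ with $\nu(\{0\})=0$ and $\int_0^\infty(1\wedge x)\nu(dx)<\infty$. The normalized Lévy measure is the probability distribution $\nu_{(1)}(dx):=1_{(1,\infty)}(x)\,\nu(dx)/\nu((1,\infty))$. *)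

theory Defs
  imports "HOL-Probability.Probability" "HOL-Library.Landau_Symbols"
begin

text \<open>
  Positivity on a half line is part of the relation: the library's \<^const>\<open>asymp_equiv\<close> alone
  would also relate functions that eventually vanish simultaneously.
\<close>

definition tail_equiv :: "(real \<Rightarrow> real) \<Rightarrow> (real \<Rightarrow> real) \<Rightarrow> bool" where
  "tail_equiv f h \<longleftrightarrow>
     (\<exists>A. \<forall>x\<ge>A. 0 < f x) \<and> (\<exists>A. \<forall>x\<ge>A. 0 < h x) \<and> f \<sim>[at_top] h"

definition long_tailed :: "(real \<Rightarrow> real) set" where
  "long_tailed = {h. h \<in> borel_measurable borel \<and> (\<forall>x. 0 \<le> h x) \<and>
     (\<forall>a. tail_equiv (\<lambda>x. h (x + a)) h)}"

definition prob_density :: "(real \<Rightarrow> real) \<Rightarrow> bool" where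
  "prob_density h \<longleftrightarrow> h \<in> borel_measurable borel \<and> (\<forall>x. 0 \<le> h x) \<and>
     (\<integral>\<^sup>+x. ennreal (h x) \<partial>lborel) = 1"

text \<open>
  For densities the integrand is nonnegative, so the Bochner integral below is the true value
  unless that value is infinite, in which case it is \<open>0\<close>. In either reading such points violate
  the relation to \<open>2 h\<close> if they occur arbitrarily far out, so \<open>subexp_densities\<close> is unaffected.
\<close>

definition density_conv :: "(real \<Rightarrow> real) \<Rightarrow> (real \<Rightarrow> real) \<Rightarrow> real \<Rightarrow> real" where
  "density_conv f h x = (LINT u|lborel. f (x - u) * h u)"

definition long_tailed_densities :: "(real \<Rightarrow> real) set" where
  "long_tailed_densities = {h. prob_density h \<and> h \<in> long_tailed}"

definition subexp_densities :: "(real \<Rightarrow> real) set" where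
  "subexp_densities = {h. h \<in> long_tailed_densities \<and>
     tail_equiv (density_conv h h) (\<lambda>x. 2 * h x)}"

definition loc_long_tailed :: "real measure set" where
  "loc_long_tailed = {\<rho>. real_distribution \<rho> \<and>
     (\<forall>c>0. (\<lambda>x. measure \<rho> {x<..x + c}) \<in> long_tailed)}"

definition loc_subexp :: "real measure set" where
  "loc_subexp = {\<rho>. real_distribution \<rho> \<and>
     (\<forall>c>0. (\<lambda>x. measure \<rho> {x<..x + c}) \<in> long_tailed \<and>
        tail_equiv (\<lambda>x. measure (\<rho> \<star> \<rho>) {x<..x + c}) (\<lambda>x. 2 * measure \<rho> {x<..x + c}))}"

primrec conv_power :: "real measure \<Rightarrow> nat \<Rightarrow> real measure" where
  "conv_power \<rho> 0 = return borel 0"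
| "conv_power \<rho> (Suc n) = (\<rho> \<star> conv_power \<rho> n)"

definition infinitely_divisible :: "real measure \<Rightarrow> bool" where
  "infinitely_divisible \<mu> \<longleftrightarrow> real_distribution \<mu> \<and>
     (\<forall>n\<ge>1. \<exists>\<rho>. real_distribution \<rho> \<and> conv_power \<rho> n = \<mu>)"

text \<open>
  Measures on the nonnegative half line are represented as Borel measures on the real line that
  do not charge the negative numbers.
\<close>

definition levy_measure :: "real measure \<Rightarrow> bool" where
  "levy_measure \<nu> \<longleftrightarrow> sets \<nu> = sets borel \<and> emeasure \<nu> {..<0} = 0 \<and> emeasure \<nu> {0} = 0 \<and>
     (\<integral>\<^sup>+x. ennreal (min 1 x) \<partial>\<nu>) < \<infinity>"

definition levy_khintchine_on_nonneg :: "real measure \<Rightarrow> real \<Rightarrow> real measure \<Rightarrow> bool" where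
  "levy_khintchine_on_nonneg \<mu> \<gamma>0 \<nu> \<longleftrightarrow>
     infinitely_divisible \<mu> \<and> emeasure \<mu> {..<0} = 0 \<and> 0 \<le> \<gamma>0 \<and> levy_measure \<nu> \<and>
     (\<forall>z. char \<mu> z = exp ((CLINT x|\<nu>. iexp (z * x) - 1) + \<i> * \<gamma>0 * z))"

definition normalized_levy :: "real measure \<Rightarrow> real measure" where
  "normalized_levy \<nu> = uniform_measure \<nu> {1<..}"

definition nonneg_density_of :: "(real \<Rightarrow> real) \<Rightarrow> real measure \<Rightarrow> bool" where
  "nonneg_density_of p \<mu> \<longleftrightarrow> p \<in> borel_measurable borel \<and> (\<forall>x. 0 \<le> p x) \<and> (\<forall>x<0. p x = 0) \<and>
     \<mu> = density lborel (\<lambda>x. ennreal (p x))"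

end

theory Submission
  imports Defs
begin

text \<open>
  Everything rests on one identity. Since the drift is zero, the measure \<open>x \<mu>(dx)\<close> is the convolution of
  \<open>\<mu>\<close> with \<open>u \<nu>(du)\<close> (\<open>size_bias_identity\<close>). It is exact for compound Poisson distributions, by
  exchangeability of the summands, and passes to the limit. In terms of window masses it says that the
  average of \<open>levy_window \<nu> c (x - v)\<close> over \<open>\<mu>(dv)\<close> is about \<open>c x p(x)\<close>. The factor \<open>x\<close> makes the problem
  one-sided: only small \<open>v\<close> and the middle range matter, because the range of \<open>v\<close> near \<open>x\<close> contributes
  without the factor \<open>x\<close>.

  From \<open>p\<close> to \<open>\<nu>\<close>. Let \<open>p\<close> be subexponential. Write \<open>\<mu>\<close> as the convolution of a distribution \<open>\<tau>\<close> made of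
  jumps of size at most \<open>\<epsilon>\<close> and of \<open>n\<close> equal compound Poisson factors, with \<open>n\<close> so large that each factor
  has an atom of mass above \<open>1/2\<close> at \<open>0\<close>. Such a factor can be removed from the identity without changing
  the asymptotics (\<open>deconvolve_heavy_atom\<close>), since the relative error contracts. What remains is an average
  over \<open>\<tau>\<close>, and \<open>\<tau>\<close> concentrates at \<open>0\<close> as \<open>\<epsilon>\<close> decreases. Hence \<open>\<nu>(x, x + c]\<close> is asymptotic to \<open>c p(x)\<close>
  (\<open>subexp_levy_density\<close>), from which the local properties of the normalized Levy measure follow.

  From proportionality to subexponentiality. If \<open>p\<close> is asymptotic to \<open>C \<nu>(x, x + 1]\<close>, replacing \<open>u \<nu>(du)\<close>
  by \<open>u p(u) du / C\<close> in the identity shows \<open>x p(x) \<sim> (1/C) \<integral> (x - v) p(x - v) p(v) dv\<close>, and by symmetry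
  the integral is \<open>x / 2\<close> times the convolution square of \<open>p\<close>. So \<open>(p \<otimes> p)(x) / p(x)\<close> tends to \<open>2 C\<close>
  (\<open>levy_density_conv_limit\<close>). The limit is at least \<open>2\<close> because of the two ends of the convolution
  integral. It cannot exceed \<open>2\<close>: integrate against a bounded submultiplicative weight
  \<open>exp (min (s x) T)\<close> that is tuned to give \<open>p\<close> a total mass slightly above \<open>1\<close>, which is possible as \<open>p\<close>
  has no exponential moments (\<open>conv_constant_le_one\<close>). Thus \<open>C = 1\<close> and \<open>p\<close> is subexponential.

  From \<open>\<nu>\<close> to \<open>p\<close>. Let \<open>p\<close> be long-tailed and the normalized Levy measure locally subexponential. In the
  identity a bound on the ratio of \<open>p\<close> to the window masses of \<open>\<nu>\<close> enters only through the middle range,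
  with a small factor (\<open>density_ratio_bootstrap\<close>). Hence the ratio is bounded, the middle range is
  negligible, and \<open>p\<close> is asymptotic to \<open>\<nu>(x, x + 1]\<close>; the previous part applies with \<open>C = 1\<close>.
\<close>

section \<open>Tail equivalence and long-tailed functions\<close>

lemma tail_equiv_iff_ratio:
  "tail_equiv f h \<longleftrightarrow>
     eventually (\<lambda>x. 0 < f x) at_top \<and> eventually (\<lambda>x. 0 < h x) at_top \<and>
     ((\<lambda>x. f x / h x) \<longlongrightarrow> 1) at_top"
proof -
  have "(f \<sim>[at_top] h) = ((\<lambda>x. f x / h x) \<longlongrightarrow> 1) at_top"
    if "eventually (\<lambda>x. 0 < f x) at_top"
    unfolding asymp_equiv_def
    by (rule filterlim_cong[OF refl refl]) (use that in \<open>auto elim!: eventually_mono\<close>)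
  then show ?thesis
    unfolding tail_equiv_def eventually_at_top_linorder by blast
qed

lemma tail_equivI_ratio:
  assumes pos: "eventually (\<lambda>x. 0 < h x) at_top"
    and close: "\<And>\<epsilon>. 0 < \<epsilon> \<Longrightarrow> eventually (\<lambda>x. \<bar>f x - h x\<bar> \<le> \<epsilon> * h x) at_top"
  shows "tail_equiv f h"
  unfolding tail_equiv_iff_ratio
proof (intro conjI pos)
  show "eventually (\<lambda>x. 0 < f x) at_top"
    using close[OF half_gt_zero[OF zero_less_one]] pos by eventually_elim linarith
  show "((\<lambda>x. f x / h x) \<longlongrightarrow> 1) at_top"
  proof (rule tendstoI)
    fix e :: real assume e: "0 < e"
    show "eventually (\<lambda>x. dist (f x / h x) 1 < e) at_top"
      using close[OF half_gt_zero[OF e]] pos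
    proof (eventually_elim)
      case (elim x)
      have "\<bar>f x / h x - 1\<bar> = \<bar>f x - h x\<bar> / h x"
        using elim(2) by (simp add: field_simps abs_if)
      also have "\<dots> \<le> e / 2"
        using elim e by (simp add: pos_divide_le_eq)
      finally show ?case using e by (simp add: dist_real_def)
    qed
  qed
qed

lemma tail_equivD:
  assumes "tail_equiv f h" "0 < \<epsilon>"
  shows "eventually (\<lambda>x. 0 < f x \<and> 0 < h x \<and> \<bar>f x - h x\<bar> \<le> \<epsilon> * h x) at_top"
proof -
  have lim: "((\<lambda>x. f x / h x) \<longlongrightarrow> 1) at_top" and pos: "eventually (\<lambda>x. 0 < f x) at_top"
      "eventually (\<lambda>x. 0 < h x) at_top"
    using assms unfolding tail_equiv_iff_ratio by auto
  have "eventually (\<lambda>x. \<bar>f x / h x - 1\<bar> < \<epsilon>) at_top"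
    using tendstoD[OF lim assms(2)] by (simp add: dist_real_def)
  with pos show ?thesis
  proof eventually_elim
    case (elim x)
    have "\<bar>f x - h x\<bar> = \<bar>f x / h x - 1\<bar> * h x"
      using elim by (simp add: field_simps abs_if)
    also have "\<dots> \<le> \<epsilon> * h x" using elim by (intro mult_right_mono) auto
    finally show ?case using elim by auto
  qed
qed

lemma tail_equiv_sym: "tail_equiv f h \<Longrightarrow> tail_equiv h f"
  unfolding tail_equiv_def by (auto simp: asymp_equiv_sym)

lemma tail_equiv_trans: "tail_equiv f g \<Longrightarrow> tail_equiv g h \<Longrightarrow> tail_equiv f h"
  unfolding tail_equiv_def by (auto intro: asymp_equiv_trans)

lemma tail_equiv_cong:
  assumes "eventually (\<lambda>x. f' x = f x) at_top" "tail_equiv f h" shows "tail_equiv f' h"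
proof (rule tail_equivI_ratio)
  show "eventually (\<lambda>x. 0 < h x) at_top"
    using tail_equivD[OF assms(2) zero_less_one] by eventually_elim simp
  show "eventually (\<lambda>x. \<bar>f' x - h x\<bar> \<le> \<epsilon> * h x) at_top" if "0 < \<epsilon>" for \<epsilon>
    using tail_equivD[OF assms(2) that] assms(1) by eventually_elim simp
qed

lemma filterlim_shift_at_top: "filterlim (\<lambda>x::real. x + a) at_top at_top"
  using filterlim_tendsto_add_at_top[OF tendsto_const[of a] filterlim_ident] by (simp add: add.commute)

lemma eventually_shift:
  assumes "eventually P at_top" shows "eventually (\<lambda>x::real. P (x + a)) at_top"
  by (rule eventually_compose_filterlim[OF assms filterlim_shift_at_top])

lemma tail_equiv_shift:
  assumes "tail_equiv f h" shows "tail_equiv (\<lambda>x. f (x + a)) (\<lambda>x. h (x + a))"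
  using assms eventually_shift filterlim_compose[OF _ filterlim_shift_at_top]
  unfolding tail_equiv_iff_ratio by auto

lemma tail_equiv_cmult:
  assumes "tail_equiv f h" "0 < C" shows "tail_equiv (\<lambda>x. C * f x) (\<lambda>x. C * h x)"
  using assms unfolding tail_equiv_iff_ratio by (auto simp: zero_less_mult_iff)

lemma long_tailed_tail_equiv:
  assumes "h \<in> long_tailed" "tail_equiv f h" "f \<in> borel_measurable borel" "\<And>x. 0 \<le> f x"
  shows "f \<in> long_tailed"
proof -
  have "tail_equiv (\<lambda>x. f (x + a)) f" for a
  proof -
    have "tail_equiv (\<lambda>x. f (x + a)) (\<lambda>x. h (x + a))" by (rule tail_equiv_shift[OF assms(2)])
    moreover have "tail_equiv (\<lambda>x. h (x + a)) h" using assms(1) by (auto simp: long_tailed_def)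
    ultimately show ?thesis using tail_equiv_sym[OF assms(2)] tail_equiv_trans by blast
  qed
  then show ?thesis using assms by (auto simp: long_tailed_def)
qed

lemma long_tailed_cmult:
  assumes "h \<in> long_tailed" "0 < C" shows "(\<lambda>x. C * h x) \<in> long_tailed"
  using assms tail_equiv_cmult[OF _ assms(2)] by (auto simp: long_tailed_def)

lemma long_tailedD:
  assumes "h \<in> long_tailed"
  shows "h \<in> borel_measurable borel" "0 \<le> h x" "eventually (\<lambda>x. 0 < h x) at_top"
    and "((\<lambda>x. h (x + a) / h x) \<longlongrightarrow> 1) at_top"
  using assms by (auto simp: long_tailed_def tail_equiv_iff_ratio)

text \<open>
  If \<open>g (x n + a n)\<close> stays away from \<open>g (x n)\<close> along some sequences, then for every \<open>t\<close> the value
  \<open>g (x n + t)\<close> is away from one of the two. Integrated over a compact range of \<open>t\<close>, this contradicts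
  dominated convergence along \<open>x n\<close> and along \<open>x n + a n\<close>.
\<close>

lemma translation_limit_uniform:
  fixes g :: "real \<Rightarrow> real"
  assumes [measurable]: "g \<in> borel_measurable borel"
    and lim: "\<And>a. ((\<lambda>x. g (x + a) - g x) \<longlongrightarrow> 0) at_top"
    and \<delta>: "0 < \<delta>" and T: "0 < T"
  shows "\<exists>X. \<forall>x\<ge>X. \<forall>a\<in>{0..T}. \<bar>g (x + a) - g x\<bar> < \<delta>"
proof (rule ccontr)
  assume "\<not> ?thesis"
  then have "\<forall>n::nat. \<exists>x a. real n \<le> x \<and> 0 \<le> a \<and> a \<le> T \<and> \<delta> \<le> \<bar>g (x + a) - g x\<bar>"
    by (simp add: Bex_def not_less conj_assoc)
  then obtain x a where xa: "\<And>n::nat. real n \<le> x n" "\<And>n. 0 \<le> a n" "\<And>n. a n \<le> T"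
      "\<And>n. \<delta> \<le> \<bar>g (x n + a n) - g (x n)\<bar>"
    by metis
  define D where "D y t = indicator {0..2*T} t * min 1 \<bar>g (y + t) - g y\<bar>" for y t
  have [measurable]: "D y \<in> borel_measurable borel" for y unfolding D_def by measurable
  have D_int: "integrable lborel (D y)" for y
    by (rule Bochner_Integration.integrable_bound[where f="indicator {0..2*T} :: real \<Rightarrow> real"])
       (use T in \<open>auto simp: D_def indicator_def intro!: integrable_real_indicator\<close>)
  have D_lim: "(\<lambda>n. LINT t|lborel. D (y n) t) \<longlonglongrightarrow> 0"
    if y: "\<And>n. real n \<le> y n" for y :: "nat \<Rightarrow> real"
  proof -
    have yt: "filterlim y at_top sequentially"
      by (rule filterlim_at_top_mono[OF filterlim_real_sequentially]) (simp add: y)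
    have "(\<lambda>n. LINT t|lborel. D (y n) t) \<longlonglongrightarrow> (LINT t::real|lborel. (0::real))"
    proof (rule integral_dominated_convergence[where s="\<lambda>n. D (y n)" and f="\<lambda>t. 0" and w="indicator {0..2*T}"])
      show "AE t in lborel. (\<lambda>n. D (y n) t) \<longlonglongrightarrow> 0"
      proof (rule AE_I2)
        fix t :: real
        have "(\<lambda>n. g (y n + t) - g (y n)) \<longlonglongrightarrow> 0"
          by (rule filterlim_compose[OF lim yt])
        then have "(\<lambda>n. indicator {0..2*T} t * min 1 \<bar>g (y n + t) - g (y n)\<bar>) \<longlonglongrightarrow>
            indicator {0..2*T} t * min 1 \<bar>0\<bar>"
          by (intro tendsto_intros)
        then show "(\<lambda>n. D (y n) t) \<longlonglongrightarrow> 0" by (simp add: D_def)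
      qed
    qed (use T in \<open>auto simp: D_def indicator_def intro!: integrable_real_indicator\<close>)
    then show ?thesis by simp
  qed
  \<comment> \<open>every \<open>t\<close> in \<open>[T, 2 T]\<close> is within reach of both \<open>x n\<close> and \<open>x n + a n\<close>\<close>
  have low: "T * min 1 \<delta> \<le> (LINT t|lborel. D (x n) t) + (LINT t|lborel. D (x n + a n) t)" for n
  proof -
    have shift: "(LINT t|lborel. D (x n + a n) t) = (LINT t|lborel. D (x n + a n) (- a n + t))"
      using lborel_integral_real_affine[of 1 "D (x n + a n)" "- a n"] by simp
    have shift_int: "integrable lborel (\<lambda>t. D (x n + a n) (- a n + t))"
      using lborel_integrable_real_affine[OF D_int, of 1 "x n + a n" "- a n"] by simp
    have "T * min 1 \<delta> = (LINT t|lborel. min 1 \<delta> * indicator {T..2*T} t)"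
      using T by simp
    also have "\<dots> \<le> (LINT t|lborel. D (x n) t + D (x n + a n) (- a n + t))"
    proof (rule integral_mono)
      fix t
      show "min 1 \<delta> * indicator {T..2*T} t \<le> D (x n) t + D (x n + a n) (- a n + t)"
        using xa(2-4)[of n] T unfolding D_def by (auto simp: indicator_def min_def)
    qed (use T D_int shift_int in \<open>auto intro!: integrable_mult_right integrable_real_indicator\<close>)
    also have "\<dots> = (LINT t|lborel. D (x n) t) + (LINT t|lborel. D (x n + a n) t)"
      unfolding shift by (rule Bochner_Integration.integral_add[OF D_int shift_int])
    finally show ?thesis .
  qed
  have "(\<lambda>n. (LINT t|lborel. D (x n) t) + (LINT t|lborel. D (x n + a n) t)) \<longlonglongrightarrow> 0 + 0"
    by (intro tendsto_add D_lim) (use xa(1,2) in \<open>simp_all add: add_increasing2\<close>)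
  then have "T * min 1 \<delta> \<le> 0"
    using LIMSEQ_le_const[of _ 0] low by auto
  then show False using T \<delta> by (simp add: mult_le_0_iff min_def split: if_splits)
qed

text \<open>
  Applied to \<open>ln h\<close>, the previous lemma bounds the ratio for shifts to the right; shifts to the left are
  shifts to the right from the other end.
\<close>

lemma long_tailed_uniform:
  assumes h: "h \<in> long_tailed" and \<epsilon>: "0 < \<epsilon>"
  shows "eventually (\<lambda>x. \<forall>a. \<bar>a\<bar> \<le> T \<longrightarrow> 0 < h (x + a) \<and> \<bar>h (x + a) - h x\<bar> \<le> \<epsilon> * h x) at_top"
proof -
  note [measurable] = long_tailedD(1)[OF h]
  define T' where "T' = max T 1"
  obtain A where A: "\<And>x. A \<le> x \<Longrightarrow> 0 < h x"
    using long_tailedD(3)[OF h] unfolding eventually_at_top_linorder by auto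
  have lim: "((\<lambda>x. ln (h (x + a)) - ln (h x)) \<longlongrightarrow> 0) at_top" for a
  proof -
    have "((\<lambda>x. ln (h (x + a) / h x)) \<longlongrightarrow> ln 1) at_top"
      by (intro tendsto_ln long_tailedD(4)[OF h]) auto
    moreover have "eventually (\<lambda>x. ln (h (x + a) / h x) = ln (h (x + a)) - ln (h x)) at_top"
      using eventually_ge_at_top[of A] eventually_ge_at_top[of "A - a"]
    proof eventually_elim
      case (elim x)
      have "0 < h x" "0 < h (x + a)" using elim by (auto intro!: A)
      then show ?case by (simp add: ln_div)
    qed
    ultimately show ?thesis by (simp cong: filterlim_cong)
  qed
  obtain X where X: "\<And>x a. X \<le> x \<Longrightarrow> 0 \<le> a \<Longrightarrow> a \<le> T' \<Longrightarrow> \<bar>ln (h (x + a)) - ln (h x)\<bar> < ln (1 + \<epsilon>)"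
  proof -
    have "0 < ln (1 + \<epsilon>)" "0 < T'" using \<epsilon> by (auto simp: T'_def)
    from translation_limit_uniform[OF borel_measurable_ln[OF long_tailedD(1)[OF h]] lim this]
    obtain X where "\<forall>x\<ge>X. \<forall>a\<in>{0..T'}. \<bar>ln (h (x + a)) - ln (h x)\<bar> < ln (1 + \<epsilon>)" by blast
    then show ?thesis by (intro that[of X]) auto
  qed
  show ?thesis
    using eventually_ge_at_top[of "max A X + T'"]
  proof (eventually_elim, intro allI impI)
    fix x a assume x: "max A X + T' \<le> x" and "\<bar>a\<bar> \<le> T"
    then have a: "\<bar>a\<bar> \<le> T'" by (simp add: T'_def)
    have pos: "0 < h x" "0 < h (x + a)" using x a by (auto intro!: A)
    have "\<bar>ln (h (x + a)) - ln (h x)\<bar> < ln (1 + \<epsilon>)"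
    proof (cases "0 \<le> a")
      case True
      then show ?thesis using X[of x a] x a by auto
    next
      case False
      moreover have "X \<le> x + a" using x a max.cobounded2[of X A] by linarith
      ultimately show ?thesis using X[of "x + a" "- a"] a by (simp add: abs_minus_commute)
    qed
    then have "ln (h (x + a)) < ln ((1 + \<epsilon>) * h x)" "ln (h x) < ln ((1 + \<epsilon>) * h (x + a))"
      using pos \<epsilon> by (auto simp: ln_mult)
    then have *: "h (x + a) < (1 + \<epsilon>) * h x" "h x < (1 + \<epsilon>) * h (x + a)"
      using pos \<epsilon> by (auto simp: ln_less_cancel_iff zero_less_mult_iff)
    have "h x - h (x + a) \<le> \<epsilon> * h x"
    proof (cases "h x \<le> h (x + a)")
      case True then show ?thesis using pos \<epsilon> by (smt (verit) mult_nonneg_nonneg)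
    next
      case False
      then have "\<epsilon> * h (x + a) \<le> \<epsilon> * h x" using \<epsilon> by auto
      then show ?thesis using * by (simp add: algebra_simps)
    qed
    then show "0 < h (x + a) \<and> \<bar>h (x + a) - h x\<bar> \<le> \<epsilon> * h x"
      using * pos by (auto simp: algebra_simps abs_le_iff)
  qed
qed

text \<open>
  Far out, a step of length \<open>1\<close> changes the value by a factor of at most \<open>2\<close>, so boundedness propagates
  by unit steps. On bounded ranges below that a long-tailed function is arbitrary, whence the
  starting point \<open>A\<close>.
\<close>

lemma long_tailed_locally_bounded:
  assumes h: "h \<in> long_tailed"
  shows "\<exists>A. \<forall>x\<ge>A. \<exists>b>0. \<exists>B. \<forall>y\<in>{A..x}. b \<le> h y \<and> h y \<le> B"
proof -
  obtain A where A: "\<And>x a. A \<le> x \<Longrightarrow> \<bar>a\<bar> \<le> 1 \<Longrightarrow> 0 < h (x + a) \<and> \<bar>h (x + a) - h x\<bar> \<le> (1/2) * h x"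
    using long_tailed_uniform[OF h, of "1/2" 1] unfolding eventually_at_top_linorder by auto
  have "\<exists>b>0. \<exists>B. \<forall>y\<in>{A..A + real n}. b \<le> h y \<and> h y \<le> B" for n
  proof (induction n)
    case 0
    have "0 < h A" using A[of A 0] by simp
    then show ?case by (intro exI[of _ "h A"]) auto
  next
    case (Suc n)
    then obtain b B where b: "0 < b" "\<And>y. y \<in> {A..A + real n} \<Longrightarrow> b \<le> h y \<and> h y \<le> B" by blast
    have "b / 2 \<le> h y \<and> h y \<le> 2 * B" if y: "y \<in> {A..A + real (Suc n)}" for y
    proof (cases "y \<le> A + real n")
      case True then show ?thesis using b(2)[of y] b(1) y by auto
    next
      case False
      define z where "z = A + real n"
      have "b \<le> h z" "h z \<le> B" "\<bar>y - z\<bar> \<le> 1" "A \<le> z"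
        using b(2)[of z] y False by (auto simp: z_def)
      moreover from this have "\<bar>h y - h z\<bar> \<le> h z / 2" using A[of z "y - z"] by simp
      ultimately show ?thesis using b(1) by linarith
    qed
    then show ?case using b(1) half_gt_zero by blast
  qed
  note * = this
  show ?thesis
  proof (rule exI[of _ A], intro allI impI)
    fix x assume "A \<le> x"
    obtain b B where "0 < b" "\<forall>y\<in>{A..A + real (nat \<lceil>x - A\<rceil>)}. b \<le> h y \<and> h y \<le> B"
      using *[of "nat \<lceil>x - A\<rceil>"] by blast
    moreover have "x \<le> A + real (nat \<lceil>x - A\<rceil>)" by linarith
    ultimately show "\<exists>b>0. \<exists>B. \<forall>y\<in>{A..x}. b \<le> h y \<and> h y \<le> B" by force
  qed
qed

section \<open>Convolution of distributions on the half line\<close>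

lemma real_distributionI:
  assumes "prob_space M" "sets M = sets borel"
  shows "real_distribution M"
  using assms by (simp add: real_distribution_def real_distribution_axioms_def)

lemma real_distributionD:
  assumes "real_distribution M"
  shows "prob_space M" "finite_measure M" "sigma_finite_measure M" "sets M = sets borel" "space M = UNIV"
proof -
  interpret real_distribution M by fact
  show "prob_space M" "finite_measure M" "sigma_finite_measure M" "sets M = sets borel" "space M = UNIV"
    by (simp_all add: prob_space_axioms finite_measure_axioms sigma_finite_measure_axioms)
qed

lemma real_distribution_convolution:
  assumes M: "real_distribution M" and N: "real_distribution N"
  shows "real_distribution (M \<star> N)"
proof (rule real_distributionI)
  note [measurable_cong] = real_distributionD(4)[OF M] real_distributionD(4)[OF N]
  interpret M: prob_space M using real_distributionD[OF M] by simp
  interpret N: prob_space N using real_distributionD[OF N] by simp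
  interpret pair_prob_space M N ..
  show "prob_space (M \<star> N)"
    unfolding convolution_def by (intro prob_space_distr) measurable
qed simp

lemma char_convolution:
  assumes M: "real_distribution M" and N: "real_distribution N"
  shows "char (M \<star> N) t = char M t * char N t"
proof -
  note [measurable_cong] = real_distributionD(4)[OF M] real_distributionD(4)[OF N]
  interpret M: prob_space M using real_distributionD[OF M] by simp
  interpret N: prob_space N using real_distributionD[OF N] by simp
  interpret pair_prob_space M N ..
  have int: "integrable (M \<Otimes>\<^sub>M N) (\<lambda>x. iexp (t * (fst x + snd x)))"
    by (rule integrable_const_bound[where B=1]) auto
  have "char (M \<star> N) t = (CLINT x|M \<Otimes>\<^sub>M N. iexp (t * (fst x + snd x)))"
    unfolding char_def convolution_def by (subst integral_distr) (auto simp: split_beta)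
  also have "\<dots> = (CLINT x|M. CLINT y|N. iexp (t * (x + y)))"
    using integral_fst'[OF int] by simp
  also have "\<dots> = (CLINT x|M. iexp (t * x) * (CLINT y|N. iexp (t * y)))"
    by (simp add: distrib_left exp_add[symmetric] of_real_add[symmetric] del: of_real_add)
       (simp add: algebra_simps exp_add)
  also have "\<dots> = char M t * char N t"
    unfolding char_def by simp
  finally show ?thesis .
qed

lemma real_distribution_conv_power:
  assumes "real_distribution M"
  shows "real_distribution (conv_power M n)"
proof (induction n)
  case 0
  show ?case by (auto intro!: real_distributionI prob_space_return)
qed (auto intro: real_distribution_convolution assms)

lemma char_conv_power:
  assumes "real_distribution M"
  shows "char (conv_power M n) t = char M t ^ n"
proof (induction n)
  case 0
  show ?case by (simp add: char_def integral_return)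
qed (simp add: char_convolution real_distribution_conv_power assms)

lemma AE_nonneg:
  assumes "sets M = sets borel" "emeasure M {..<0::real} = 0"
  shows "AE x in M. 0 \<le> x"
  by (rule AE_I[where N="{..<0}"]) (use assms in \<open>auto simp: not_le\<close>)

lemma nn_integral_conv:
  assumes "real_distribution M" "real_distribution N" "f \<in> borel_measurable borel"
  shows "(\<integral>\<^sup>+x. f x \<partial>(M \<star> N)) = (\<integral>\<^sup>+x. \<integral>\<^sup>+y. f (x + y) \<partial>N \<partial>M)"
  by (rule nn_integral_convolution) (use assms real_distributionD in auto)

lemma convolution_nonneg:
  assumes M: "real_distribution M" "emeasure M {..<0} = 0"
    and N: "real_distribution N" "emeasure N {..<0} = 0"
  shows "emeasure (M \<star> N) {..<0} = 0"
proof -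
  note MD = real_distributionD[OF M(1)] and ND = real_distributionD[OF N(1)]
  have "emeasure (M \<star> N) {..<0} = (\<integral>\<^sup>+x. \<integral>\<^sup>+y. indicator {..<0} (x + y) \<partial>N \<partial>M)"
    by (rule convolution_emeasure') (use MD ND in auto)
  also have "\<dots> = (\<integral>\<^sup>+x. \<integral>\<^sup>+y. 0 \<partial>N \<partial>M)"
  proof (rule nn_integral_cong_AE)
    show "AE x in M. (\<integral>\<^sup>+y. indicator {..<0} (x + y) \<partial>N) = (\<integral>\<^sup>+y. 0 \<partial>N)"
      using AE_nonneg[OF MD(4) M(2)]
    proof eventually_elim
      case (elim x)
      show ?case
      proof (rule nn_integral_cong_AE)
        show "AE y in N. (indicator {..<0} (x + y) :: ennreal) = 0"
          using AE_nonneg[OF ND(4) N(2)] by eventually_elim (use elim in simp)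
      qed
    qed
  qed
  finally show ?thesis by simp
qed

lemma conv_power_nonneg:
  assumes "real_distribution M" "emeasure M {..<0} = 0"
  shows "emeasure (conv_power M n) {..<0} = 0"
  by (induction n) (auto intro: convolution_nonneg real_distribution_conv_power assms)

section \<open>Compound Poisson distributions\<close>

text \<open>
  By exchangeability of the summands, weighting an \<open>(n+1)\<close>-fold sum by its value amounts to weighting
  one summand by its own value, \<open>n + 1\<close> times over.
\<close>

lemma size_bias_conv_power:
  fixes \<phi> :: "real \<Rightarrow> ennreal"
  assumes M: "real_distribution M" "emeasure M {..<0} = 0"
    and "\<phi> \<in> borel_measurable borel"
  shows "(\<integral>\<^sup>+x. ennreal x * \<phi> x \<partial>(conv_power M (Suc n))) =
    of_nat (Suc n) * (\<integral>\<^sup>+u. \<integral>\<^sup>+v. ennreal u * \<phi> (u + v) \<partial>(conv_power M n) \<partial>M)"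
  using assms(3)
proof (induction n arbitrary: \<phi>)
  case 0
  note [measurable] = 0
  note [measurable_cong] = real_distributionD(4)[OF M(1)]
  have "real_distribution (return borel (0::real))" using real_distribution_conv_power[OF M(1), of 0] by simp
  then show ?case
    by (simp add: nn_integral_conv[OF M(1)] nn_integral_return)
next
  case (Suc n)
  note [measurable] = Suc.prems
  define P where "P k = conv_power M k" for k
  have PD: "real_distribution (P k)" for k by (simp add: P_def real_distribution_conv_power M)
  have Pn: "emeasure (P k) {..<0} = 0" for k by (simp add: P_def conv_power_nonneg M)
  note MD = real_distributionD[OF M(1)]
  note [measurable_cong] = MD(4) real_distributionD(4)[OF PD]
  interpret M: sigma_finite_measure M by (rule MD)
  interpret P: sigma_finite_measure "P k" for k by (rule real_distributionD[OF PD])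
  interpret MM: pair_sigma_finite M M ..
  have PSuc: "P (Suc k) = (M \<star> P k)" for k by (simp add: P_def)
  have "(\<integral>\<^sup>+x. ennreal x * \<phi> x \<partial>P (Suc (Suc n)))
      = (\<integral>\<^sup>+u. \<integral>\<^sup>+w. ennreal (u + w) * \<phi> (u + w) \<partial>P (Suc n) \<partial>M)"
    unfolding PSuc[of "Suc n"] by (rule nn_integral_conv[OF M(1) PD]) measurable
  also have "\<dots> = (\<integral>\<^sup>+u. (\<integral>\<^sup>+w. ennreal u * \<phi> (u + w) \<partial>P (Suc n)) +
        (\<integral>\<^sup>+w. ennreal w * \<phi> (u + w) \<partial>P (Suc n)) \<partial>M)"
  proof (rule nn_integral_cong_AE)
    show "AE u in M. (\<integral>\<^sup>+w. ennreal (u + w) * \<phi> (u + w) \<partial>P (Suc n)) =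
      (\<integral>\<^sup>+w. ennreal u * \<phi> (u + w) \<partial>P (Suc n)) + (\<integral>\<^sup>+w. ennreal w * \<phi> (u + w) \<partial>P (Suc n))"
      using AE_nonneg[OF MD(4) M(2)]
    proof eventually_elim
      case (elim u)
      have "(\<integral>\<^sup>+w. ennreal (u + w) * \<phi> (u + w) \<partial>P (Suc n)) =
          (\<integral>\<^sup>+w. ennreal u * \<phi> (u + w) + ennreal w * \<phi> (u + w) \<partial>P (Suc n))"
        by (rule nn_integral_cong_AE,
            use AE_nonneg[OF real_distributionD(4)[OF PD] Pn, of "Suc n"] in eventually_elim)
           (use elim in \<open>simp add: ennreal_plus distrib_right\<close>)
      then show ?case by (simp add: nn_integral_add)
    qed
  qed
  also have "\<dots> = (\<integral>\<^sup>+u. \<integral>\<^sup>+w. ennreal u * \<phi> (u + w) \<partial>P (Suc n) \<partial>M) +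
        (\<integral>\<^sup>+u. \<integral>\<^sup>+w. ennreal w * \<phi> (u + w) \<partial>P (Suc n) \<partial>M)"
    by (rule nn_integral_add) measurable
  also have "(\<integral>\<^sup>+u. \<integral>\<^sup>+w. ennreal w * \<phi> (u + w) \<partial>P (Suc n) \<partial>M) =
      (\<integral>\<^sup>+u. of_nat (Suc n) * (\<integral>\<^sup>+t. \<integral>\<^sup>+v. ennreal t * \<phi> (u + (t + v)) \<partial>P n \<partial>M) \<partial>M)"
    unfolding P_def
    by (intro nn_integral_cong Suc.IH) measurable
  also have "\<dots> = of_nat (Suc n) * (\<integral>\<^sup>+u. \<integral>\<^sup>+t. \<integral>\<^sup>+v. ennreal t * \<phi> (u + (t + v)) \<partial>P n \<partial>M \<partial>M)"
    by (rule nn_integral_cmult) measurable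
  also have "(\<integral>\<^sup>+u. \<integral>\<^sup>+t. \<integral>\<^sup>+v. ennreal t * \<phi> (u + (t + v)) \<partial>P n \<partial>M \<partial>M) =
      (\<integral>\<^sup>+t. \<integral>\<^sup>+u. \<integral>\<^sup>+v. ennreal t * \<phi> (u + (t + v)) \<partial>P n \<partial>M \<partial>M)"
    by (rule MM.Fubini') measurable
  also have "\<dots> = (\<integral>\<^sup>+t. \<integral>\<^sup>+w. ennreal t * \<phi> (t + w) \<partial>P (Suc n) \<partial>M)"
    unfolding PSuc
    by (intro nn_integral_cong, subst nn_integral_conv[OF M(1) PD])
       (measurable, simp add: add.left_commute)
  finally show ?case
    unfolding P_def[symmetric] by (simp add: algebra_simps)
qed

lemma integral_poisson_power:
  fixes w :: complex
  assumes l: "0 < l" and w: "norm w \<le> 1"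
  shows "(\<integral>n. w ^ n \<partial>measure_pmf (poisson_pmf l)) = exp (of_real l * (w - 1))"
proof -
  let ?f = "\<lambda>n. (l ^ n / fact n * exp (- l)) *\<^sub>R w ^ n"
  have int: "integrable (measure_pmf (poisson_pmf l)) (\<lambda>n. w ^ n)"
    by (rule measure_pmf.integrable_const_bound[where B=1]) (auto simp: norm_power w power_le_one)
  have int': "integrable (count_space UNIV) ?f"
    using int l unfolding measure_pmf_eq_density
    by (subst (asm) integrable_density) auto
  have "(\<integral>n. w ^ n \<partial>measure_pmf (poisson_pmf l)) = (\<integral>n. ?f n \<partial>count_space UNIV)"
    using l unfolding measure_pmf_eq_density by (subst integral_density) auto
  moreover have "?f sums (\<integral>n. ?f n \<partial>count_space UNIV)"
    by (rule sums_integral_count_space_nat[OF int'])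
  moreover have "?f sums (exp (- of_real l) * exp (of_real l * w))"
  proof -
    have "(\<lambda>n. exp (- of_real l) * ((of_real l * w) ^ n /\<^sub>R fact n)) sums (exp (- of_real l) * exp (of_real l * w))"
      by (intro sums_mult exp_converges)
    moreover have e: "exp (- of_real l) = (of_real (exp (- l)) :: complex)"
      by (metis exp_of_real of_real_minus)
    have "exp (- of_real l) * ((of_real l * w) ^ n /\<^sub>R fact n) = ?f n" for n
      unfolding e by (simp add: scaleR_conv_of_real power_mult_distrib divide_inverse mult_ac)
    ultimately show ?thesis by simp
  qed
  moreover have "exp (- of_real l) * exp (of_real l * w) = exp (of_real l * (w - 1))"
    by (simp add: exp_add[symmetric] algebra_simps)
  ultimately show ?thesis using sums_unique2 by metis
qed

text \<open>
  The distribution is the Poisson mixture of the convolution powers of the normalized jump measure. Its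
  size-bias property comes from that of the powers, because \<open>n + 1\<close> times the Poisson weight of \<open>n + 1\<close>
  is \<open>l\<close> times the weight of \<open>n\<close>.
\<close>

lemma compound_poisson_exists:
  fixes \<rho> :: "real measure"
  assumes fin: "finite_measure \<rho>" and sets: "sets \<rho> = sets borel" and nonneg: "emeasure \<rho> {..<0} = 0"
  obtains \<kappa> where "real_distribution \<kappa>" "emeasure \<kappa> {..<0} = 0"
    "exp (- measure \<rho> UNIV) \<le> measure \<kappa> {0}"
    "\<And>z. char \<kappa> z = exp (CLINT x|\<rho>. iexp (z * x) - 1)"
    "\<And>\<phi>. \<phi> \<in> borel_measurable borel \<Longrightarrow>
      (\<integral>\<^sup>+x. ennreal x * \<phi> x \<partial>\<kappa>) = (\<integral>\<^sup>+v. \<integral>\<^sup>+u. ennreal u * \<phi> (u + v) \<partial>\<rho> \<partial>\<kappa>)"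
proof -
  note [measurable_cong] = sets
  interpret \<rho>: finite_measure \<rho> by fact
  have sp: "space \<rho> = UNIV" using sets_eq_imp_space_eq[OF sets] by simp
  define l where "l = measure \<rho> UNIV"
  have em: "emeasure \<rho> UNIV = ennreal l" by (simp add: l_def \<rho>.emeasure_eq_measure)
  show ?thesis
  proof (cases "l = 0")
    case True
    then have ae: "AE x in \<rho>. P x" for P
      using em sp by (intro AE_I[where N=UNIV]) (auto simp: sets)
    have R: "real_distribution (return borel (0::real))"
      by (auto intro!: real_distributionI prob_space_return)
    show ?thesis
    proof (rule that[OF R])
      fix z
      have "(CLINT x|\<rho>. iexp (z * x) - 1) = (CLINT x|\<rho>. 0)"
        by (rule integral_cong_AE) (auto intro: ae)
      then show "char (return borel 0) z = exp (CLINT x|\<rho>. iexp (z * x) - 1)"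
        by (simp add: char_def integral_return)
    next
      fix \<phi> :: "real \<Rightarrow> ennreal" assume [measurable]: "\<phi> \<in> borel_measurable borel"
      have "(\<integral>\<^sup>+u. ennreal u * \<phi> (u + v) \<partial>\<rho>) = (\<integral>\<^sup>+u. 0 \<partial>\<rho>)" for v
        by (rule nn_integral_cong_AE) (rule ae)
      then show "(\<integral>\<^sup>+x. ennreal x * \<phi> x \<partial>return borel 0) =
          (\<integral>\<^sup>+v. \<integral>\<^sup>+u. ennreal u * \<phi> (u + v) \<partial>\<rho> \<partial>return borel 0)"
        by (simp add: nn_integral_return)
    qed (use True in \<open>auto simp: l_def measure_return\<close>)
  next
    case False
    then have l: "0 < l" by (simp add: l_def less_le)
    define M where "M = density \<rho> (\<lambda>_. ennreal (1 / l))"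
    have Ms: "sets M = sets borel" by (simp add: M_def sets)
    have nnM: "(\<integral>\<^sup>+x. f x \<partial>M) = ennreal (1 / l) * (\<integral>\<^sup>+x. f x \<partial>\<rho>)"
      if [measurable]: "f \<in> borel_measurable borel" for f
      unfolding M_def by (subst nn_integral_density) (auto intro: nn_integral_cmult)
    have emM: "emeasure M A = ennreal (1 / l) * emeasure \<rho> A" if "A \<in> sets borel" for A
      using nnM[of "indicator A"] that by (simp add: Ms sets)
    have "prob_space M"
    proof
      show "emeasure M (space M) = 1"
        using emM[of UNIV] l by (simp add: M_def sp em ennreal_mult[symmetric])
    qed
    then have M: "real_distribution M" by (intro real_distributionI Ms)
    have Mn: "emeasure M {..<0} = 0" using emM[of "{..<0}"] nonneg by simp
    define P where "P n = conv_power M n" for n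
    have PD: "real_distribution (P k)" for k by (simp add: P_def real_distribution_conv_power M)
    have Pn: "emeasure (P k) {..<0} = 0" for k by (simp add: P_def conv_power_nonneg M Mn)
    note [measurable_cong] = Ms real_distributionD(4)[OF PD]
    interpret M: sigma_finite_measure M by (rule real_distributionD[OF M])
    interpret P: sigma_finite_measure "P k" for k by (rule real_distributionD[OF PD])
    define W where "W = measure_pmf (poisson_pmf l)"
    have K: "P \<in> measurable W (subprob_algebra borel)"
      unfolding W_def
      by (auto simp: space_subprob_algebra intro!: prob_space_imp_subprob_space real_distributionD[OF PD])
    define \<kappa> where "\<kappa> = bind W P"
    have ks: "sets \<kappa> = sets borel" unfolding \<kappa>_def
      by (rule sets_bind[where N=borel]) (auto simp: W_def real_distributionD(4)[OF PD])
    have nnk: "(\<integral>\<^sup>+x. f x \<partial>\<kappa>) = (\<Sum>n. ennreal (pmf (poisson_pmf l) n) * (\<integral>\<^sup>+x. f x \<partial>P n))"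
      if "f \<in> borel_measurable borel" for f
      unfolding \<kappa>_def W_def nn_integral_bind[OF that K[unfolded W_def]]
      by (simp add: nn_integral_measure_pmf nn_integral_count_space_nat)
    have emk: "emeasure \<kappa> A = (\<Sum>n. ennreal (pmf (poisson_pmf l) n) * emeasure (P n) A)"
      if "A \<in> sets borel" for A
      using nnk[of "indicator A"] that by (simp add: ks real_distributionD(4)[OF PD])
    have "prob_space \<kappa>" unfolding \<kappa>_def
      by (rule prob_space.prob_space_bind[OF _ _ K])
         (simp_all add: W_def prob_space_measure_pmf real_distributionD(1)[OF PD])
    then have kD: "real_distribution \<kappa>" by (intro real_distributionI ks)
    show ?thesis
    proof (rule that[OF kD])
      show "emeasure \<kappa> {..<0} = 0" by (simp add: emk Pn)
      have "ennreal (exp (- l)) \<le> (\<Sum>n\<in>{0}. ennreal (pmf (poisson_pmf l) n) * emeasure (P n) {0})"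
        using l by (simp add: P_def)
      also have "\<dots> \<le> emeasure \<kappa> {0}"
        by (subst emk, simp, rule sum_le_suminf) auto
      finally show "exp (- measure \<rho> UNIV) \<le> measure \<kappa> {0}"
        using real_distributionD[OF kD] by (simp add: l_def finite_measure.emeasure_eq_measure)
    next
      fix z
      have wn: "norm (char M z) \<le> 1" by (rule real_distribution.cmod_char_le_1[OF M])
      have bnd: "integrable Q (\<lambda>x. iexp (z * x))" if "real_distribution Q" for Q
        by (rule prob_space.integrable_iexp) (use real_distributionD[OF that] in auto)
      have bind: "(\<integral>x. f x \<partial>\<kappa>) = (\<integral>n. (\<integral>x. f x \<partial>P n) \<partial>W)"
        if "f \<in> borel_measurable borel" "\<And>x. \<bar>f x\<bar> \<le> 1" for f :: "real \<Rightarrow> real"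
        unfolding \<kappa>_def
      proof (rule integral_bind[where K=borel and B=1 and B'=1])
        show "AE n in W. emeasure (P n) (space (P n)) \<le> ennreal 1"
          using prob_space.emeasure_space_1[OF real_distributionD(1)[OF PD]] by simp
      qed (use that K in \<open>auto simp: W_def measure_pmf.finite_measure_axioms\<close>)
      have int: "integrable W (\<lambda>n. char (P n) z)"
        unfolding W_def
        by (rule measure_pmf.integrable_const_bound[where B=1])
           (auto simp: real_distribution.cmod_char_le_1[OF PD])
      have Re: "Re (char Q z) = (\<integral>x. cos (z * x) \<partial>Q)" and Im: "Im (char Q z) = (\<integral>x. sin (z * x) \<partial>Q)"
        if "real_distribution Q" for Q
        using integral_Re[OF bnd[OF that]] integral_Im[OF bnd[OF that]]
        by (simp_all add: char_def Re_exp Im_exp)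
      have "char \<kappa> z = (\<integral>n. char (P n) z \<partial>W)"
      proof (rule complex_eqI)
        show "Re (char \<kappa> z) = Re (\<integral>n. char (P n) z \<partial>W)"
          using integral_Re[OF int] bind[of "\<lambda>x. cos (z * x)"] by (simp add: Re[OF kD] Re[OF PD])
        show "Im (char \<kappa> z) = Im (\<integral>n. char (P n) z \<partial>W)"
          using integral_Im[OF int] bind[of "\<lambda>x. sin (z * x)"] by (simp add: Im[OF kD] Im[OF PD])
      qed
      also have "\<dots> = exp (of_real l * (char M z - 1))"
        unfolding W_def P_def char_conv_power[OF M] by (rule integral_poisson_power[OF l wn])
      also have "of_real l * (char M z - 1) = (CLINT x|\<rho>. iexp (z * x) - 1)"
      proof -
        have i: "integrable \<rho> (\<lambda>x. iexp (z * x))"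
          by (rule \<rho>.integrable_const_bound[where B=1]) auto
        have "char M z = (1 / l) *\<^sub>R (CLINT x|\<rho>. iexp (z * x))"
          unfolding char_def M_def using l by (subst integral_density) auto
        moreover have "(CLINT x|\<rho>. iexp (z * x) - 1) = (CLINT x|\<rho>. iexp (z * x)) - of_real l"
          by (subst Bochner_Integration.integral_diff[OF i]) (auto simp: l_def sp scaleR_conv_of_real)
        ultimately show ?thesis using l by (simp add: scaleR_conv_of_real field_simps)
      qed
      finally show "char \<kappa> z = exp (CLINT x|\<rho>. iexp (z * x) - 1)" .
    next
      fix \<phi> :: "real \<Rightarrow> ennreal" assume [measurable]: "\<phi> \<in> borel_measurable borel"
      define I where "I n = (\<integral>\<^sup>+v. \<integral>\<^sup>+u. ennreal u * \<phi> (u + v) \<partial>\<rho> \<partial>P n)" for n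
      have step: "ennreal (pmf (poisson_pmf l) (Suc n)) * (\<integral>\<^sup>+x. ennreal x * \<phi> x \<partial>P (Suc n)) =
          ennreal (pmf (poisson_pmf l) n) * I n" for n
      proof -
        interpret MP: pair_sigma_finite M "P n" ..
        have "(\<integral>\<^sup>+u. \<integral>\<^sup>+v. ennreal u * \<phi> (u + v) \<partial>P n \<partial>M) =
            (\<integral>\<^sup>+v. \<integral>\<^sup>+u. ennreal u * \<phi> (u + v) \<partial>M \<partial>P n)"
          by (rule MP.Fubini'[symmetric]) measurable
        also have "\<dots> = ennreal (1 / l) * I n"
          unfolding I_def by (simp add: nnM nn_integral_cmult)
        finally have "(\<integral>\<^sup>+x. ennreal x * \<phi> x \<partial>P (Suc n)) = of_nat (Suc n) * (ennreal (1 / l) * I n)"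
          using size_bias_conv_power[OF M Mn, of \<phi> n] by (simp add: P_def)
        moreover have "ennreal (pmf (poisson_pmf l) (Suc n)) * of_nat (Suc n) * ennreal (1 / l) =
            ennreal (pmf (poisson_pmf l) n)"
          using l by (simp add: ennreal_of_nat_eq_real_of_nat ennreal_mult[symmetric] field_simps del: of_nat_Suc)
        ultimately show ?thesis by (simp add: mult.assoc[symmetric])
      qed
      have "(\<integral>\<^sup>+x. ennreal x * \<phi> x \<partial>\<kappa>) =
          (\<Sum>n. ennreal (pmf (poisson_pmf l) n) * (\<integral>\<^sup>+x. ennreal x * \<phi> x \<partial>P n))"
        by (rule nnk) measurable
      also have "\<dots> = (\<Sum>n. ennreal (pmf (poisson_pmf l) (Suc n)) * (\<integral>\<^sup>+x. ennreal x * \<phi> x \<partial>P (Suc n)))"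
        using suminf_offset[of "\<lambda>n. ennreal (pmf (poisson_pmf l) n) * (\<integral>\<^sup>+x. ennreal x * \<phi> x \<partial>P n)" 1]
        by (simp add: P_def nn_integral_return)
      also have "\<dots> = (\<Sum>n. ennreal (pmf (poisson_pmf l) n) * I n)" by (simp add: step)
      also have "\<dots> = (\<integral>\<^sup>+v. \<integral>\<^sup>+u. ennreal u * \<phi> (u + v) \<partial>\<rho> \<partial>\<kappa>)"
        unfolding I_def by (rule nnk[symmetric]) measurable
      finally show "(\<integral>\<^sup>+x. ennreal x * \<phi> x \<partial>\<kappa>) = (\<integral>\<^sup>+v. \<integral>\<^sup>+u. ennreal u * \<phi> (u + v) \<partial>\<rho> \<partial>\<kappa>)" .
    qed
  qed
qed

section \<open>Splitting off the large jumps\<close>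

lemma levy_measureD:
  assumes "levy_measure \<nu>"
  shows "sets \<nu> = sets borel" "space \<nu> = UNIV" "AE x in \<nu>. 0 < x"
    "(\<integral>\<^sup>+x. ennreal (min 1 x) \<partial>\<nu>) < \<infinity>" "integrable \<nu> (\<lambda>x. min 1 x)"
proof -
  show s: "sets \<nu> = sets borel" and f: "(\<integral>\<^sup>+x. ennreal (min 1 x) \<partial>\<nu>) < \<infinity>"
    using assms by (auto simp: levy_measure_def)
  show "space \<nu> = UNIV" using sets_eq_imp_space_eq[OF s] by simp
  have "emeasure \<nu> {..0} \<le> emeasure \<nu> {..<0} + emeasure \<nu> {0}"
    by (subst ivl_disj_un_singleton(2)[symmetric], rule emeasure_subadditive) (auto simp: s)
  then have "emeasure \<nu> {..0} = 0" using assms by (simp add: levy_measure_def)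
  then show ae: "AE x in \<nu>. 0 < x"
    by (intro AE_I[where N="{..0}"]) (auto simp: s)
  have "(\<integral>\<^sup>+x. ennreal (norm (min 1 x)) \<partial>\<nu>) = (\<integral>\<^sup>+x. ennreal (min 1 x) \<partial>\<nu>)"
    by (rule nn_integral_cong_AE) (use ae in eventually_elim, simp)
  with f show "integrable \<nu> (\<lambda>x. min 1 x)"
    by (intro integrableI_bounded) (auto simp: measurable_cong_sets[OF s refl])
qed

lemma levy_tail_finite:
  assumes \<nu>: "levy_measure \<nu>" and \<epsilon>: "0 < \<epsilon>"
  shows "emeasure \<nu> {\<epsilon><..} < \<infinity>"
proof -
  note [measurable_cong] = levy_measureD(1)[OF \<nu>]
  have "ennreal (min 1 \<epsilon>) * emeasure \<nu> {\<epsilon><..} = (\<integral>\<^sup>+x. ennreal (min 1 \<epsilon>) * indicator {\<epsilon><..} x \<partial>\<nu>)"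
    by (subst nn_integral_cmult_indicator) (auto simp: levy_measureD[OF \<nu>])
  also have "\<dots> \<le> (\<integral>\<^sup>+x. ennreal (min 1 x) \<partial>\<nu>)"
    by (rule nn_integral_mono) (use \<epsilon> in \<open>auto simp: indicator_def intro!: ennreal_leI\<close>)
  also have "\<dots> < \<infinity>" by (rule levy_measureD[OF \<nu>])
  finally show ?thesis using \<epsilon> by (auto simp: ennreal_mult_less_top)
qed

text \<open>The part of the exponent of the characteristic function that is due to jumps in \<open>S\<close>.\<close>

definition levy_exponent :: "real measure \<Rightarrow> real set \<Rightarrow> real \<Rightarrow> complex" where
  "levy_exponent \<nu> S z = (CLINT x|\<nu>. indicator S x *\<^sub>R (iexp (z * x) - 1))"

text \<open>The Levy measure of the jumps in \<open>S\<close> when every jump is retained with the proportion \<open>s\<close>.\<close>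

definition jump_part :: "real measure \<Rightarrow> real \<Rightarrow> real set \<Rightarrow> real measure" where
  "jump_part \<nu> s S = density \<nu> (\<lambda>x. ennreal (s * indicator S x))"

definition small_jump_mean :: "real measure \<Rightarrow> real \<Rightarrow> ennreal" where
  "small_jump_mean \<nu> \<epsilon> = (\<integral>\<^sup>+u. ennreal u * indicator {..\<epsilon>} u \<partial>\<nu>)"

lemma norm_iexp_minus_one_le:
  assumes "0 \<le> x" shows "norm (iexp (z * x) - 1) \<le> (2 + \<bar>z\<bar>) * min 1 x"
proof -
  have 1: "norm (iexp (z * x) - 1) \<le> \<bar>z\<bar> * x" using iexp_approx1[of "z * x" 0] assms by (simp add: abs_mult)
  have 2: "norm (iexp (z * x) - 1) \<le> 2"
    using norm_triangle_ineq4[of "iexp (z * x)" 1] by simp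
  have "\<bar>z\<bar> * x \<le> (2 + \<bar>z\<bar>) * x" using assms by (intro mult_right_mono) auto
  with 1 2 show ?thesis by (auto simp: min_def)
qed

lemma integrable_levy_exponent:
  assumes \<nu>: "levy_measure \<nu>"
  shows "integrable \<nu> (\<lambda>x. iexp (z * x) - 1)"
proof (rule Bochner_Integration.integrable_bound)
  note [measurable_cong] = levy_measureD(1)[OF \<nu>]
  show "integrable \<nu> (\<lambda>x. (2 + \<bar>z\<bar>) * min 1 x)" using levy_measureD(5)[OF \<nu>] by simp
  show "(\<lambda>x. iexp (z * x) - 1) \<in> borel_measurable \<nu>" by measurable
  show "AE x in \<nu>. norm (iexp (z * x) - 1) \<le> norm ((2 + \<bar>z\<bar>) * min 1 x)"
    using levy_measureD(3)[OF \<nu>]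
  proof eventually_elim
    case (elim x)
    then show ?case using norm_iexp_minus_one_le[of x z] by (simp add: abs_mult)
  qed
qed

lemma levy_exponent_split:
  assumes \<nu>: "levy_measure \<nu>" and S: "S \<in> sets borel"
  shows "levy_exponent \<nu> S z + levy_exponent \<nu> (- S) z = (CLINT x|\<nu>. iexp (z * x) - 1)"
proof -
  have i: "integrable \<nu> (\<lambda>x. indicator T x *\<^sub>R (iexp (z * x) - 1))" if "T \<in> sets borel" for T
    by (rule integrable_mult_indicator) (use that integrable_levy_exponent[OF \<nu>] levy_measureD[OF \<nu>] in auto)
  have "- S \<in> sets borel" using S by (rule borel_comp)
  have "levy_exponent \<nu> S z + levy_exponent \<nu> (- S) z =
      (CLINT x|\<nu>. indicator S x *\<^sub>R (iexp (z * x) - 1) + indicator (- S) x *\<^sub>R (iexp (z * x) - 1))"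
    unfolding levy_exponent_def
    by (rule Bochner_Integration.integral_add[OF i[OF S] i[OF \<open>- S \<in> sets borel\<close>], symmetric])
  also have "\<dots> = (CLINT x|\<nu>. iexp (z * x) - 1)"
    by (intro Bochner_Integration.integral_cong) (simp_all add: indicator_def)
  finally show ?thesis .
qed

lemma jump_part_facts:
  assumes \<nu>: "levy_measure \<nu>" and S: "S \<in> sets borel" and s: "0 \<le> s"
  shows "sets (jump_part \<nu> s S) = sets borel"
    and "f \<in> borel_measurable borel \<Longrightarrow>
      (\<integral>\<^sup>+x. f x \<partial>jump_part \<nu> s S) = ennreal s * (\<integral>\<^sup>+x. f x * indicator S x \<partial>\<nu>)"
    and "(CLINT x|jump_part \<nu> s S. iexp (z * x) - 1) = of_real s * levy_exponent \<nu> S z"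
    and "emeasure (jump_part \<nu> s S) {..<0} = 0"
proof -
  note [measurable_cong] = levy_measureD(1)[OF \<nu>] and [measurable] = S
  show sets: "sets (jump_part \<nu> s S) = sets borel" by (simp add: jump_part_def levy_measureD[OF \<nu>])
  have nn: "(\<integral>\<^sup>+x. f x \<partial>jump_part \<nu> s S) = ennreal s * (\<integral>\<^sup>+x. f x * indicator S x \<partial>\<nu>)"
    if [measurable]: "f \<in> borel_measurable borel" for f
  proof -
    have "(\<integral>\<^sup>+x. f x \<partial>jump_part \<nu> s S) = (\<integral>\<^sup>+x. ennreal s * (f x * indicator S x) \<partial>\<nu>)"
      unfolding jump_part_def
      by (subst nn_integral_density) (auto intro!: nn_integral_cong simp: indicator_def)
    also have "\<dots> = ennreal s * (\<integral>\<^sup>+x. f x * indicator S x \<partial>\<nu>)"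
      by (rule nn_integral_cmult) measurable
    finally show ?thesis .
  qed
  then show "f \<in> borel_measurable borel \<Longrightarrow>
      (\<integral>\<^sup>+x. f x \<partial>jump_part \<nu> s S) = ennreal s * (\<integral>\<^sup>+x. f x * indicator S x \<partial>\<nu>)" .
  have "(CLINT x|jump_part \<nu> s S. iexp (z * x) - 1) = (CLINT x|\<nu>. (s * indicator S x) *\<^sub>R (iexp (z * x) - 1))"
    unfolding jump_part_def by (rule integral_density) (use s in auto)
  then show "(CLINT x|jump_part \<nu> s S. iexp (z * x) - 1) = of_real s * levy_exponent \<nu> S z"
    unfolding levy_exponent_def integral_mult_right_zero[symmetric]
    by (simp add: scaleR_conv_of_real mult.assoc)
  have "emeasure (jump_part \<nu> s S) {..<0} = (\<integral>\<^sup>+x. indicator {..<0} x \<partial>jump_part \<nu> s S)"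
    by (simp add: sets)
  also have "\<dots> = ennreal s * (\<integral>\<^sup>+x. indicator {..<0} x * indicator S x \<partial>\<nu>)" by (rule nn) simp
  also have "(\<integral>\<^sup>+x. indicator {..<0} x * indicator S x \<partial>\<nu>) = (\<integral>\<^sup>+x. 0 \<partial>\<nu>)"
    by (rule nn_integral_cong_AE) (use levy_measureD(3)[OF \<nu>] in eventually_elim, simp)
  finally show "emeasure (jump_part \<nu> s S) {..<0} = 0" by simp
qed

lemma finite_measure_jump_part:
  assumes \<nu>: "levy_measure \<nu>" and S: "S \<in> sets borel" "S \<subseteq> {\<epsilon><..}" "0 < \<epsilon>" and s: "0 \<le> s"
  shows "finite_measure (jump_part \<nu> s S)" "measure (jump_part \<nu> s S) UNIV = s * measure \<nu> S"
proof -
  note J = jump_part_facts[OF \<nu> S(1) s]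
  have sp: "space (jump_part \<nu> s S) = UNIV" using sets_eq_imp_space_eq[OF J(1)] by simp
  have Sfin: "emeasure \<nu> S < \<infinity>"
    using emeasure_mono[OF S(2), of \<nu>] levy_tail_finite[OF \<nu> S(3)] levy_measureD(1)[OF \<nu>]
    by (auto intro: le_less_trans)
  have em: "emeasure (jump_part \<nu> s S) UNIV = ennreal s * emeasure \<nu> S"
    using J(2)[of "\<lambda>_. 1"] S(1) by (simp add: levy_measureD[OF \<nu>] sp)
  show "finite_measure (jump_part \<nu> s S)"
    by (rule finite_measureI) (use Sfin in \<open>simp add: sp em ennreal_mult_eq_top_iff\<close>)
  show "measure (jump_part \<nu> s S) UNIV = s * measure \<nu> S"
    using s by (simp add: measure_def em enn2real_mult)
qed

lemma compound_poisson_jump_part: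
  assumes \<nu>: "levy_measure \<nu>" and S: "S \<in> sets borel" "S \<subseteq> {\<epsilon><..}" "0 < \<epsilon>" and s: "0 \<le> s"
  obtains \<kappa> where "real_distribution \<kappa>" "emeasure \<kappa> {..<0} = 0"
    "exp (- s * measure \<nu> S) \<le> measure \<kappa> {0}"
    "\<And>z. char \<kappa> z = exp (of_real s * levy_exponent \<nu> S z)"
    "\<And>\<phi>. \<phi> \<in> borel_measurable borel \<Longrightarrow>
      (\<integral>\<^sup>+x. ennreal x * \<phi> x \<partial>\<kappa>) = (\<integral>\<^sup>+v. \<integral>\<^sup>+u. ennreal u * \<phi> (u + v) \<partial>jump_part \<nu> s S \<partial>\<kappa>)"
proof -
  let ?\<rho> = "jump_part \<nu> s S"
  note J = jump_part_facts[OF \<nu> S(1) s]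
  note fm = finite_measure_jump_part[OF \<nu> S s]
  from compound_poisson_exists[OF fm(1) J(1) J(4)] obtain \<kappa> where "real_distribution \<kappa>" "emeasure \<kappa> {..<0} = 0"
    "exp (- measure ?\<rho> UNIV) \<le> measure \<kappa> {0}"
    "\<And>z. char \<kappa> z = exp (CLINT x|?\<rho>. iexp (z * x) - 1)"
    "\<And>\<phi>. \<phi> \<in> borel_measurable borel \<Longrightarrow>
      (\<integral>\<^sup>+x. ennreal x * \<phi> x \<partial>\<kappa>) = (\<integral>\<^sup>+v. \<integral>\<^sup>+u. ennreal u * \<phi> (u + v) \<partial>?\<rho> \<partial>\<kappa>)"
    by blast
  then show ?thesis by (intro that[of \<kappa>]) (simp_all only: fm(2) J(3) mult_minus_left)
qed

lemma small_jump_mean_le: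
  assumes \<nu>: "levy_measure \<nu>"
  shows "small_jump_mean \<nu> \<epsilon> \<le> ennreal (max 1 \<epsilon>) * (\<integral>\<^sup>+x. ennreal (min 1 x) \<partial>\<nu>)"
    and "small_jump_mean \<nu> \<epsilon> < \<infinity>"
proof -
  note [measurable_cong] = levy_measureD(1)[OF \<nu>]
  have "small_jump_mean \<nu> \<epsilon> \<le> (\<integral>\<^sup>+x. ennreal (max 1 \<epsilon>) * ennreal (min 1 x) \<partial>\<nu>)"
    unfolding small_jump_mean_def
  proof (rule nn_integral_mono_AE, use levy_measureD(3)[OF \<nu>] in eventually_elim)
    fix x :: real assume x: "0 < x"
    have "x \<le> max 1 \<epsilon> * min 1 x" if "x \<le> \<epsilon>" using x that by (auto simp: min_def max_def)
    then show "ennreal x * indicator {..\<epsilon>} x \<le> ennreal (max 1 \<epsilon>) * ennreal (min 1 x)"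
      using x by (auto simp: indicator_def ennreal_mult[symmetric] intro!: ennreal_leI)
  qed
  also have "\<dots> = ennreal (max 1 \<epsilon>) * (\<integral>\<^sup>+x. ennreal (min 1 x) \<partial>\<nu>)"
    by (rule nn_integral_cmult) measurable
  finally show *: "small_jump_mean \<nu> \<epsilon> \<le> ennreal (max 1 \<epsilon>) * (\<integral>\<^sup>+x. ennreal (min 1 x) \<partial>\<nu>)" .
  also have "\<dots> < \<infinity>" using levy_measureD(4)[OF \<nu>] by (simp add: ennreal_mult_less_top)
  finally show "small_jump_mean \<nu> \<epsilon> < \<infinity>" .
qed

lemma small_jump_mean_tendsto_0:
  assumes \<nu>: "levy_measure \<nu>"
  shows "(\<lambda>k. small_jump_mean \<nu> (1 / real (Suc k))) \<longlonglongrightarrow> 0"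
proof -
  note [measurable_cong] = levy_measureD(1)[OF \<nu>]
  have "(\<lambda>k. small_jump_mean \<nu> (1 / real (Suc k))) \<longlonglongrightarrow> (\<integral>\<^sup>+x. 0 \<partial>\<nu>)"
    unfolding small_jump_mean_def
  proof (rule nn_integral_dominated_convergence[where w="\<lambda>u. ennreal u * indicator {..1} u"])
    show "AE x in \<nu>. (\<lambda>k. ennreal x * indicator {..1 / real (Suc k)} x) \<longlonglongrightarrow> 0"
      using levy_measureD(3)[OF \<nu>]
    proof eventually_elim
      case (elim x)
      have "eventually (\<lambda>k. 1 / real (Suc k) < x) sequentially"
        using order_tendstoD(2)[OF LIMSEQ_inverse_real_of_nat elim] by (simp add: inverse_eq_divide)
      then have "eventually (\<lambda>k. ennreal x * indicator {..1 / real (Suc k)} x = 0) sequentially"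
        by eventually_elim (simp add: indicator_def)
      then show ?case by (rule tendsto_eventually)
    qed
    show "AE x in \<nu>. ennreal x * indicator {..1 / real (Suc j)} x \<le> ennreal x * indicator {..1} x" for j
    proof (rule AE_I2)
      fix x :: real
      have "1 / real (Suc j) \<le> 1" by simp
      then have "x \<le> 1" if "x \<le> 1 / real (Suc j)" using that by (rule order_trans[rotated])
      then show "ennreal x * indicator {..1 / real (Suc j)} x \<le> ennreal x * indicator {..1} x"
        by (simp add: indicator_def)
    qed
    show "(\<integral>\<^sup>+u. ennreal u * indicator {..1} u \<partial>\<nu>) < \<infinity>"
      using small_jump_mean_le(2)[OF \<nu>, of 1] by (simp add: small_jump_mean_def)
  qed measurable
  then show ?thesis by simp
qed

text \<open>
  The small jumps have finite mean, so the compound Poisson distributions with jumps in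
  \<open>(1/k, \<epsilon>]\<close> form a tight sequence; any weak limit has the required characteristic function.
\<close>

lemma small_jump_distribution_exists:
  assumes \<nu>: "levy_measure \<nu>" and \<epsilon>: "0 < \<epsilon>"
  obtains \<tau> where "real_distribution \<tau>" "emeasure \<tau> {..<0} = 0"
    "\<And>z. char \<tau> z = exp (levy_exponent \<nu> {..\<epsilon>} z)"
    "(\<integral>\<^sup>+x. ennreal (min 1 x) \<partial>\<tau>) \<le> small_jump_mean \<nu> \<epsilon>"
proof -
  note [measurable_cong] = levy_measureD(1)[OF \<nu>]
  define S where "S k = {1 / real (Suc k)<..\<epsilon>}" for k
  have S: "S k \<in> sets borel" "S k \<subseteq> {1 / real (Suc k)<..}" "0 < 1 / real (Suc k)" for k
    by (auto simp: S_def)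
  have "\<exists>\<kappa>. real_distribution \<kappa> \<and> emeasure \<kappa> {..<0} = 0 \<and> (\<forall>z. char \<kappa> z = exp (levy_exponent \<nu> (S k) z)) \<and>
      (\<integral>\<^sup>+x. ennreal x \<partial>\<kappa>) \<le> small_jump_mean \<nu> \<epsilon>" for k
  proof -
    obtain \<kappa> where \<kappa>: "real_distribution \<kappa>" "emeasure \<kappa> {..<0} = 0"
      "\<And>z. char \<kappa> z = exp (of_real 1 * levy_exponent \<nu> (S k) z)"
      "\<And>\<phi>. \<phi> \<in> borel_measurable borel \<Longrightarrow>
        (\<integral>\<^sup>+x. ennreal x * \<phi> x \<partial>\<kappa>) = (\<integral>\<^sup>+v. \<integral>\<^sup>+u. ennreal u * \<phi> (u + v) \<partial>jump_part \<nu> 1 (S k) \<partial>\<kappa>)"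
      by (rule compound_poisson_jump_part[OF \<nu> S zero_le_one]) blast
    have "(\<integral>\<^sup>+x. ennreal x \<partial>\<kappa>) = (\<integral>\<^sup>+v. \<integral>\<^sup>+u. ennreal u \<partial>jump_part \<nu> 1 (S k) \<partial>\<kappa>)"
      using \<kappa>(4)[of "\<lambda>_. 1"] by simp
    also have "\<dots> = (\<integral>\<^sup>+u. ennreal u \<partial>jump_part \<nu> 1 (S k))"
      using prob_space.emeasure_space_1[OF real_distributionD(1)[OF \<kappa>(1)]] by simp
    also have "\<dots> = (\<integral>\<^sup>+u. ennreal u * indicator (S k) u \<partial>\<nu>)"
      by (subst jump_part_facts(2)[OF \<nu> S(1)]) auto
    also have "\<dots> \<le> small_jump_mean \<nu> \<epsilon>"
      unfolding small_jump_mean_def by (rule nn_integral_mono) (auto simp: S_def indicator_def)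
    finally show ?thesis using \<kappa> by auto
  qed
  then obtain \<kappa> where \<kappa>: "\<And>k. real_distribution (\<kappa> k)" "\<And>k. emeasure (\<kappa> k) {..<0} = 0"
    "\<And>k z. char (\<kappa> k) z = exp (levy_exponent \<nu> (S k) z)"
    "\<And>k. (\<integral>\<^sup>+x. ennreal x \<partial>\<kappa> k) \<le> small_jump_mean \<nu> \<epsilon>"
    by metis
  define m where "m = enn2real (small_jump_mean \<nu> \<epsilon>)"
  have m: "small_jump_mean \<nu> \<epsilon> = ennreal m" "0 \<le> m"
    using small_jump_mean_le(2)[OF \<nu>, of \<epsilon>] by (auto simp: m_def)
  have "tight \<kappa>"
    unfolding tight_def
  proof (intro conjI allI impI \<kappa>(1))
    fix e :: real assume e: "0 < e"
    \<comment> \<open>Markov: a mean of at most \<open>m\<close> leaves mass less than \<open>e\<close> beyond \<open>b\<close>\<close>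
    define b where "b = (m + 1) / e"
    have b: "0 < b" using e m by (simp add: b_def)
    have "1 - e < measure (\<kappa> n) {-1<..b}" for n
    proof -
      interpret real_distribution "\<kappa> n" by (rule \<kappa>)
      have "ennreal b * emeasure (\<kappa> n) {b<..} = (\<integral>\<^sup>+x. ennreal b * indicator {b<..} x \<partial>\<kappa> n)"
        by (subst nn_integral_cmult_indicator) auto
      also have "\<dots> \<le> (\<integral>\<^sup>+x. ennreal x \<partial>\<kappa> n)"
        by (rule nn_integral_mono) (use b in \<open>auto simp: indicator_def intro!: ennreal_leI\<close>)
      also have "\<dots> \<le> ennreal m" using \<kappa>(4) m by simp
      finally have "b * prob {b<..} \<le> m"
        using b m by (simp add: emeasure_eq_measure ennreal_mult[symmetric])
      moreover have "m < b * e" using e by (simp add: b_def)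
      ultimately have "b * prob {b<..} < b * e" by simp
      then have 1: "prob {b<..} < e" using b by simp
      have 2: "prob {..<0} = 0" using \<kappa>(2)[of n] by (simp add: emeasure_eq_measure)
      have "1 = prob ({..<0} \<union> ({-1<..b} \<union> {b<..}))"
      proof -
        have "{..<0} \<union> ({-1<..b} \<union> {b<..}) = (UNIV :: real set)" by auto
        then show ?thesis using prob_space by simp
      qed
      also have "\<dots> \<le> prob {..<0} + prob ({-1<..b} \<union> {b<..})"
        by (rule measure_Un_le) auto
      also have "prob ({-1<..b} \<union> {b<..}) \<le> prob {-1<..b} + prob {b<..}"
        by (rule measure_Un_le) auto
      finally show ?thesis using 1 2 by simp
    qed
    then show "\<exists>a b. a < b \<and> (\<forall>n. 1 - e < measure (\<kappa> n) {a<..b})"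
      using b by (intro exI[of _ "-1"] exI[of _ b]) auto
  qed
  from tight_imp_convergent_subsubsequence[OF this, of "\<lambda>n. n"] obtain r \<tau>
    where r: "strict_mono r" and \<tau>: "real_distribution \<tau>" and "weak_conv_m (\<kappa> \<circ> (\<lambda>n. n) \<circ> r) \<tau>"
    by (auto simp: strict_mono_def)
  then have conv: "weak_conv_m (\<lambda>n. \<kappa> (r n)) \<tau>" by (simp add: comp_def)
  have lim: "(\<lambda>n. \<integral>x. f x \<partial>\<kappa> (r n)) \<longlonglongrightarrow> (\<integral>x. f x \<partial>\<tau>)"
    if "\<And>x. isCont f x" "\<And>x. norm (f x) \<le> 1" for f :: "real \<Rightarrow> real"
    by (rule weak_conv_imp_integral_bdd_continuous_conv[OF \<kappa>(1) \<tau> conv that])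
  interpret \<tau>: real_distribution \<tau> by fact
  \<comment> \<open>a bounded continuous function that detects mass on the negative half line\<close>
  have neg: "(\<integral>x. min 1 (max 0 (- x)) \<partial>\<kappa> n) = 0" for n
  proof -
    have "(\<integral>x. min 1 (max 0 (- x)) \<partial>\<kappa> n) = (\<integral>x. 0 \<partial>\<kappa> n)"
      by (rule integral_cong_AE)
         (use AE_nonneg[OF real_distributionD(4)[OF \<kappa>(1)] \<kappa>(2), of n] in \<open>auto elim!: eventually_mono
          simp: measurable_cong_sets[OF real_distributionD(4)[OF \<kappa>(1)] refl]\<close>)
    then show ?thesis by simp
  qed
  have "(\<lambda>n. \<integral>x. min 1 (max 0 (- x)) \<partial>\<kappa> (r n)) \<longlonglongrightarrow> (\<integral>x. min 1 (max 0 (- x)) \<partial>\<tau>)"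
    by (rule lim) (auto intro!: continuous_intros)
  then have "(\<integral>x. min 1 (max 0 (- x)) \<partial>\<tau>) = 0"
    unfolding neg by (simp add: LIMSEQ_const_iff)
  moreover have "integrable \<tau> (\<lambda>x. min 1 (max 0 (- x)))"
    by (rule \<tau>.integrable_const_bound[where B=1]) auto
  ultimately have "AE x in \<tau>. min 1 (max 0 (- x)) = 0"
    by (subst (asm) integral_nonneg_eq_0_iff_AE) auto
  then have "AE x in \<tau>. 0 \<le> x" by eventually_elim (auto simp: min_def max_def split: if_splits)
  then have \<tau>0: "emeasure \<tau> {..<0} = 0"
    by (subst (asm) AE_iff_measurable[where N="{..<0}"]) (auto simp: not_le)
  show ?thesis
  proof (rule that[OF \<tau> \<tau>0])
    fix z
    have "(\<lambda>k. levy_exponent \<nu> (S k) z) \<longlonglongrightarrow> levy_exponent \<nu> {..\<epsilon>} z"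
      unfolding levy_exponent_def
    proof (rule integral_dominated_convergence[where w="\<lambda>x. norm (iexp (z * x) - 1)"])
      show "integrable \<nu> (\<lambda>x. norm (iexp (z * x) - 1))"
        using integrable_levy_exponent[OF \<nu>] by (rule integrable_norm)
      show "AE x in \<nu>. (\<lambda>k. indicator (S k) x *\<^sub>R (iexp (z * x) - 1)) \<longlonglongrightarrow> indicator {..\<epsilon>} x *\<^sub>R (iexp (z * x) - 1)"
        using levy_measureD(3)[OF \<nu>]
      proof eventually_elim
        case (elim x)
        have "eventually (\<lambda>k. 1 / real (Suc k) < x) sequentially"
          using order_tendstoD(2)[OF LIMSEQ_inverse_real_of_nat elim] by (simp add: inverse_eq_divide)
        then have "eventually (\<lambda>k. indicator (S k) x *\<^sub>R (iexp (z * x) - 1) = indicator {..\<epsilon>} x *\<^sub>R (iexp (z * x) - 1)) sequentially"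
          by eventually_elim (simp add: indicator_def S_def)
        then show ?case by (rule tendsto_eventually)
      qed
    qed (auto simp: S_def indicator_def)
    then have "(\<lambda>k. char (\<kappa> k) z) \<longlonglongrightarrow> exp (levy_exponent \<nu> {..\<epsilon>} z)"
      unfolding \<kappa>(3) by (rule tendsto_exp)
    from LIMSEQ_subseq_LIMSEQ[OF this r]
    have "(\<lambda>k. char (\<kappa> (r k)) z) \<longlonglongrightarrow> exp (levy_exponent \<nu> {..\<epsilon>} z)" by (simp add: comp_def)
    moreover have "(\<lambda>k. char (\<kappa> (r k)) z) \<longlonglongrightarrow> char \<tau> z"
      by (rule levy_continuity1[OF \<kappa>(1) \<tau> conv])
    ultimately show "char \<tau> z = exp (levy_exponent \<nu> {..\<epsilon>} z)" by (metis LIMSEQ_unique)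
  next
    have "(\<lambda>n. \<integral>x. min 1 (max 0 x) \<partial>\<kappa> (r n)) \<longlonglongrightarrow> (\<integral>x. min 1 (max 0 x) \<partial>\<tau>)"
      by (rule lim) (auto intro!: continuous_intros)
    moreover have "(\<integral>x. min 1 (max 0 x) \<partial>\<kappa> n) \<le> m" for n
    proof (rule integral_real_bounded[OF m(2)])
      have "(\<integral>\<^sup>+x. ennreal (min 1 (max 0 x)) \<partial>\<kappa> n) \<le> (\<integral>\<^sup>+x. ennreal x \<partial>\<kappa> n)"
        by (rule nn_integral_mono) (auto simp: ennreal_le_iff2)
      also have "\<dots> \<le> ennreal m" using \<kappa>(4) m by simp
      finally show "(\<integral>\<^sup>+x. ennreal (min 1 (max 0 x)) \<partial>\<kappa> n) \<le> ennreal m" .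
    qed
    ultimately have le: "(\<integral>x. min 1 (max 0 x) \<partial>\<tau>) \<le> m" by (auto intro: LIMSEQ_le_const2)
    have "(\<integral>\<^sup>+x. ennreal (min 1 x) \<partial>\<tau>) \<le> (\<integral>\<^sup>+x. ennreal (min 1 (max 0 x)) \<partial>\<tau>)"
      by (rule nn_integral_mono) (auto intro!: ennreal_leI)
    also have "\<dots> = ennreal (\<integral>x. min 1 (max 0 x) \<partial>\<tau>)"
      by (rule nn_integral_eq_integral) (auto intro!: \<tau>.integrable_const_bound[where B=1])
    also have "\<dots> \<le> small_jump_mean \<nu> \<epsilon>" using le m by (simp add: ennreal_leI)
    finally show "(\<integral>\<^sup>+x. ennreal (min 1 x) \<partial>\<tau>) \<le> small_jump_mean \<nu> \<epsilon>" .
  qed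
qed

lemma levy_khintchineD:
  assumes "levy_khintchine_on_nonneg \<mu> 0 \<nu>"
  shows "real_distribution \<mu>" "emeasure \<mu> {..<0} = 0" "levy_measure \<nu>"
    "char \<mu> z = exp (CLINT x|\<nu>. iexp (z * x) - 1)"
  using assms by (auto simp: levy_khintchine_on_nonneg_def infinitely_divisible_def)

lemma factor_out_small_jumps:
  assumes \<mu>: "levy_khintchine_on_nonneg \<mu> 0 \<nu>" and \<epsilon>: "0 < \<epsilon>"
    and \<tau>: "real_distribution \<tau>" "\<And>z. char \<tau> z = exp (levy_exponent \<nu> {..\<epsilon>} z)"
    and M: "real_distribution M" "\<And>z. char M z = exp (levy_exponent \<nu> {\<epsilon><..} z)"
  shows "\<mu> = (M \<star> \<tau>)"
proof (rule Levy_uniqueness)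
  note L = levy_khintchineD[OF \<mu>]
  show "char \<mu> = char (M \<star> \<tau>)"
  proof
    fix z
    have "- {\<epsilon><..} = {..\<epsilon>}" by auto
    then have "levy_exponent \<nu> {\<epsilon><..} z + levy_exponent \<nu> {..\<epsilon>} z = (CLINT x|\<nu>. iexp (z * x) - 1)"
      using levy_exponent_split[OF L(3), of "{\<epsilon><..}" z] by simp
    then show "char \<mu> z = char (M \<star> \<tau>) z"
      by (simp add: L(4) char_convolution M \<tau> exp_add[symmetric])
  qed
qed (use levy_khintchineD[OF \<mu>] real_distribution_convolution[OF M(1) \<tau>(1)] in auto)

text \<open>
  A compound Poisson distribution with jump measure of mass \<open>m\<close> has an atom of mass at least \<open>exp (- m)\<close> at
  \<open>0\<close>. Spreading the large jumps evenly over \<open>n\<close> convolution factors replaces \<open>m\<close> by \<open>m / n\<close>.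
\<close>

lemma factor_with_heavy_atom:
  assumes \<mu>: "levy_khintchine_on_nonneg \<mu> 0 \<nu>" and \<epsilon>: "0 < \<epsilon>"
  obtains \<tau> \<kappa> n where "real_distribution \<tau>" "emeasure \<tau> {..<0} = 0"
    "(\<integral>\<^sup>+x. ennreal (min 1 x) \<partial>\<tau>) \<le> small_jump_mean \<nu> \<epsilon>"
    "real_distribution \<kappa>" "emeasure \<kappa> {..<0} = 0" "1 / 2 < measure \<kappa> {0}"
    "0 < n" "\<mu> = (conv_power \<kappa> n \<star> \<tau>)"
proof -
  note L = levy_khintchineD[OF \<mu>]
  obtain \<tau> where \<tau>: "real_distribution \<tau>" "emeasure \<tau> {..<0} = 0"
    "\<And>z. char \<tau> z = exp (levy_exponent \<nu> {..\<epsilon>} z)"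
    "(\<integral>\<^sup>+x. ennreal (min 1 x) \<partial>\<tau>) \<le> small_jump_mean \<nu> \<epsilon>"
    by (rule small_jump_distribution_exists[OF L(3) \<epsilon>]) blast
  have "(\<lambda>n. exp (- (1 / real (Suc n)) * measure \<nu> {\<epsilon><..})) \<longlonglongrightarrow> exp (- 0 * measure \<nu> {\<epsilon><..})"
    using LIMSEQ_inverse_real_of_nat by (intro tendsto_intros) (simp add: inverse_eq_divide)
  then have "eventually (\<lambda>n. 1 / 2 < exp (- (1 / real (Suc n)) * measure \<nu> {\<epsilon><..})) sequentially"
    by (rule order_tendstoD) simp
  then obtain k where k: "1 / 2 < exp (- (1 / real (Suc k)) * measure \<nu> {\<epsilon><..})"
    by (auto simp: eventually_sequentially)
  obtain \<kappa> where \<kappa>: "real_distribution \<kappa>" "emeasure \<kappa> {..<0} = 0"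
    "exp (- (1 / real (Suc k)) * measure \<nu> {\<epsilon><..}) \<le> measure \<kappa> {0}"
    "\<And>z. char \<kappa> z = exp (of_real (1 / real (Suc k)) * levy_exponent \<nu> {\<epsilon><..} z)"
    by (rule compound_poisson_jump_part[OF L(3) _ order_refl \<epsilon>, of "1 / real (Suc k)"]) auto
  have "char (conv_power \<kappa> (Suc k)) z = exp (levy_exponent \<nu> {\<epsilon><..} z)" for z
  proof -
    have "char (conv_power \<kappa> (Suc k)) z = exp (of_nat (Suc k) * (of_real (1 / real (Suc k)) * levy_exponent \<nu> {\<epsilon><..} z))"
      by (simp only: char_conv_power[OF \<kappa>(1)] \<kappa>(4) exp_of_nat_mult[symmetric])
    also have "of_nat (Suc k) * (of_real (1 / real (Suc k)) * levy_exponent \<nu> {\<epsilon><..} z) = levy_exponent \<nu> {\<epsilon><..} z"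
      by (simp del: of_nat_Suc)
    finally show ?thesis .
  qed
  then have "\<mu> = (conv_power \<kappa> (Suc k) \<star> \<tau>)"
    by (intro factor_out_small_jumps[OF \<mu> \<epsilon> \<tau>(1,3)] real_distribution_conv_power \<kappa>(1))
  then show ?thesis using \<tau> \<kappa> k by (intro that[of \<tau> \<kappa> "Suc k"]) auto
qed

section \<open>The size-bias identity\<close>

text \<open>
  Let \<open>\<mu> = \<kappa> \<star> \<tau>\<close>, where \<open>\<kappa>\<close> collects the jumps exceeding \<open>1/k\<close>. The identity is exact for the compound
  Poisson distribution \<open>\<kappa>\<close>. Convolving with \<open>\<tau>\<close> leaves an error in which the weight falls on \<open>\<tau>\<close>; it is at
  most a multiple of the mean of the small jumps, which vanishes as \<open>k\<close> grows. This is where zero drift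
  enters.
\<close>

lemma size_bias_identity:
  assumes \<mu>: "levy_khintchine_on_nonneg \<mu> 0 \<nu>"
  shows "(\<integral>\<^sup>+x. ennreal x * indicator {a<..b} x \<partial>\<mu>) =
    (\<integral>\<^sup>+v. \<integral>\<^sup>+u. ennreal u * indicator {a<..b} (u + v) \<partial>\<nu> \<partial>\<mu>)"
proof -
  note L = levy_khintchineD[OF \<mu>]
  note [measurable_cong] = levy_measureD(1)[OF L(3)] real_distributionD(4)[OF L(1)]
  define W :: "real \<Rightarrow> ennreal" where "W = indicator {a<..b}"
  have [measurable]: "W \<in> borel_measurable borel" by (simp add: W_def)
  define Z where "Z = (\<integral>\<^sup>+x. ennreal x * W x \<partial>\<mu>)"
  define S where "S k = {1 / real (Suc k)<..}" for k
  have S: "S k \<in> sets borel" "S k \<subseteq> {1 / real (Suc k)<..}" "0 < 1 / real (Suc k)" for k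
    by (auto simp: S_def)
  define I where "I k = (\<integral>\<^sup>+v. \<integral>\<^sup>+u. ennreal u * W (u + v) \<partial>jump_part \<nu> 1 (S k) \<partial>\<mu>)" for k
  define m where "m k = small_jump_mean \<nu> (1 / real (Suc k))" for k
  have bounds: "I k \<le> Z \<and> Z \<le> I k + ennreal (max 1 b) * m k" for k
  proof -
    let ?\<rho> = "jump_part \<nu> 1 (S k)"
    obtain \<kappa> where \<kappa>: "real_distribution \<kappa>" "emeasure \<kappa> {..<0} = 0"
      "\<And>z. char \<kappa> z = exp (of_real 1 * levy_exponent \<nu> (S k) z)"
      "\<And>\<phi>. \<phi> \<in> borel_measurable borel \<Longrightarrow>
        (\<integral>\<^sup>+x. ennreal x * \<phi> x \<partial>\<kappa>) = (\<integral>\<^sup>+v. \<integral>\<^sup>+u. ennreal u * \<phi> (u + v) \<partial>?\<rho> \<partial>\<kappa>)"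
      by (rule compound_poisson_jump_part[OF L(3) S zero_le_one]) blast
    obtain \<tau> where \<tau>: "real_distribution \<tau>" "emeasure \<tau> {..<0} = 0"
      "\<And>z. char \<tau> z = exp (levy_exponent \<nu> {..1 / real (Suc k)} z)"
      "(\<integral>\<^sup>+x. ennreal (min 1 x) \<partial>\<tau>) \<le> m k"
      unfolding m_def by (rule small_jump_distribution_exists[OF L(3) S(3)]) blast
    have \<mu>_eq: "\<mu> = (\<kappa> \<star> \<tau>)"
      by (rule factor_out_small_jumps[OF \<mu> S(3) \<tau>(1,3) \<kappa>(1)]) (simp add: \<kappa>(3) S_def)
    note [measurable_cong] = real_distributionD(4)[OF \<kappa>(1)] real_distributionD(4)[OF \<tau>(1)]
      jump_part_facts(1)[OF L(3) S(1) zero_le_one]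
    interpret \<kappa>: sigma_finite_measure \<kappa> by (rule real_distributionD[OF \<kappa>(1)])
    interpret \<tau>: sigma_finite_measure \<tau> by (rule real_distributionD[OF \<tau>(1)])
    interpret \<kappa>\<tau>: pair_sigma_finite \<kappa> \<tau> ..
    interpret \<rho>: finite_measure ?\<rho> by (rule finite_measure_jump_part[OF L(3) S zero_le_one])
    have cond: "(\<integral>\<^sup>+y. \<integral>\<^sup>+u. ennreal u * W (u + (y + t)) \<partial>?\<rho> \<partial>\<kappa>) = (\<integral>\<^sup>+y. ennreal y * W (y + t) \<partial>\<kappa>)" for t
      using \<kappa>(4)[of "\<lambda>x. W (x + t)"] by (simp add: add.assoc)
    have "I k = (\<integral>\<^sup>+y. \<integral>\<^sup>+t. \<integral>\<^sup>+u. ennreal u * W (u + (y + t)) \<partial>?\<rho> \<partial>\<tau> \<partial>\<kappa>)"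
      unfolding I_def \<mu>_eq by (rule nn_integral_conv[OF \<kappa>(1) \<tau>(1)]) measurable
    also have "\<dots> = (\<integral>\<^sup>+t. \<integral>\<^sup>+y. \<integral>\<^sup>+u. ennreal u * W (u + (y + t)) \<partial>?\<rho> \<partial>\<kappa> \<partial>\<tau>)"
      by (rule \<kappa>\<tau>.Fubini'[symmetric]) measurable
    also have "\<dots> = (\<integral>\<^sup>+t. \<integral>\<^sup>+y. ennreal y * W (y + t) \<partial>\<kappa> \<partial>\<tau>)"
      by (simp only: cond)
    also have "\<dots> = (\<integral>\<^sup>+y. \<integral>\<^sup>+t. ennreal y * W (y + t) \<partial>\<tau> \<partial>\<kappa>)"
      by (rule \<kappa>\<tau>.Fubini') measurable
    finally have I: "I k = (\<integral>\<^sup>+y. \<integral>\<^sup>+t. ennreal y * W (y + t) \<partial>\<tau> \<partial>\<kappa>)" .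
    have "Z = (\<integral>\<^sup>+y. \<integral>\<^sup>+t. ennreal (y + t) * W (y + t) \<partial>\<tau> \<partial>\<kappa>)"
      unfolding Z_def \<mu>_eq by (rule nn_integral_conv[OF \<kappa>(1) \<tau>(1)]) measurable
    also have "\<dots> = (\<integral>\<^sup>+y. (\<integral>\<^sup>+t. ennreal y * W (y + t) \<partial>\<tau>) + (\<integral>\<^sup>+t. ennreal t * W (y + t) \<partial>\<tau>) \<partial>\<kappa>)"
    proof (rule nn_integral_cong_AE)
      show "AE y in \<kappa>. (\<integral>\<^sup>+t. ennreal (y + t) * W (y + t) \<partial>\<tau>) =
          (\<integral>\<^sup>+t. ennreal y * W (y + t) \<partial>\<tau>) + (\<integral>\<^sup>+t. ennreal t * W (y + t) \<partial>\<tau>)"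
        using AE_nonneg[OF real_distributionD(4)[OF \<kappa>(1)] \<kappa>(2)]
      proof eventually_elim
        case (elim y)
        have "(\<integral>\<^sup>+t. ennreal (y + t) * W (y + t) \<partial>\<tau>) = (\<integral>\<^sup>+t. ennreal y * W (y + t) + ennreal t * W (y + t) \<partial>\<tau>)"
          by (rule nn_integral_cong_AE,
              use AE_nonneg[OF real_distributionD(4)[OF \<tau>(1)] \<tau>(2)] in eventually_elim)
             (use elim in \<open>simp add: ennreal_plus distrib_right\<close>)
        then show ?case by (simp add: nn_integral_add)
      qed
    qed
    also have "\<dots> = I k + (\<integral>\<^sup>+y. \<integral>\<^sup>+t. ennreal t * W (y + t) \<partial>\<tau> \<partial>\<kappa>)"
      unfolding I by (rule nn_integral_add) measurable
    finally have Z: "Z = I k + (\<integral>\<^sup>+y. \<integral>\<^sup>+t. ennreal t * W (y + t) \<partial>\<tau> \<partial>\<kappa>)" .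
    have "(\<integral>\<^sup>+y. \<integral>\<^sup>+t. ennreal t * W (y + t) \<partial>\<tau> \<partial>\<kappa>) \<le> (\<integral>\<^sup>+y. ennreal (max 1 b) * m k \<partial>\<kappa>)"
    proof (rule nn_integral_mono_AE)
      show "AE y in \<kappa>. (\<integral>\<^sup>+t. ennreal t * W (y + t) \<partial>\<tau>) \<le> ennreal (max 1 b) * m k"
        using AE_nonneg[OF real_distributionD(4)[OF \<kappa>(1)] \<kappa>(2)]
      proof eventually_elim
        case (elim y)
        have "(\<integral>\<^sup>+t. ennreal t * W (y + t) \<partial>\<tau>) \<le> (\<integral>\<^sup>+t. ennreal (max 1 b) * ennreal (min 1 t) \<partial>\<tau>)"
        proof (rule nn_integral_mono_AE, use AE_nonneg[OF real_distributionD(4)[OF \<tau>(1)] \<tau>(2)] in eventually_elim)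
          fix t :: real assume t: "0 \<le> t"
          have "t \<le> max 1 b * min 1 t" if "t \<le> b" using t that by (auto simp: min_def max_def mult_le_cancel_right1)
          then show "ennreal t * W (y + t) \<le> ennreal (max 1 b) * ennreal (min 1 t)"
            using t elim by (auto simp: W_def indicator_def ennreal_mult[symmetric] intro!: ennreal_leI)
        qed
        also have "\<dots> = ennreal (max 1 b) * (\<integral>\<^sup>+t. ennreal (min 1 t) \<partial>\<tau>)"
          by (rule nn_integral_cmult) measurable
        also have "\<dots> \<le> ennreal (max 1 b) * m k" by (intro mult_left_mono \<tau>(4)) auto
        finally show ?case .
      qed
    qed
    also have "\<dots> = ennreal (max 1 b) * m k"
      using prob_space.emeasure_space_1[OF real_distributionD(1)[OF \<kappa>(1)]] by simp
    finally show ?thesis unfolding Z by (auto intro: add_left_mono)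
  qed
  have conv: "I \<longlonglongrightarrow> (\<integral>\<^sup>+v. \<integral>\<^sup>+u. ennreal u * W (u + v) \<partial>\<nu> \<partial>\<mu>)"
  proof -
    define J where "J k v = (\<integral>\<^sup>+u. ennreal u * W (u + v) * indicator (S k) u \<partial>\<nu>)" for k v
    have IJ: "I k = (\<integral>\<^sup>+v. J k v \<partial>\<mu>)" for k
      unfolding I_def J_def by (subst jump_part_facts(2)[OF L(3) S(1)]) auto
    have Smono: "indicator (S i) u \<le> (indicator (S j) u :: ennreal)" if "i \<le> j" for i j u
    proof -
      have "1 / real (Suc j) \<le> 1 / real (Suc i)" using that by (simp add: frac_le)
      then show ?thesis by (auto simp: S_def indicator_def)
    qed
    have Jlim: "(\<lambda>k. J k v) \<longlonglongrightarrow> (\<integral>\<^sup>+u. ennreal u * W (u + v) \<partial>\<nu>)" for v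
      unfolding J_def
    proof (rule nn_integral_LIMSEQ)
      show "incseq (\<lambda>k u. ennreal u * W (u + v) * indicator (S k) u)"
        by (auto simp: incseq_def le_fun_def intro!: mult_left_mono Smono)
      show "(\<lambda>k. ennreal u * W (u + v) * indicator (S k) u) \<longlonglongrightarrow> ennreal u * W (u + v)" for u
      proof (cases "0 < u")
        case True
        have "eventually (\<lambda>k. 1 / real (Suc k) < u) sequentially"
          using order_tendstoD(2)[OF LIMSEQ_inverse_real_of_nat True] by (simp add: inverse_eq_divide)
        then have "eventually (\<lambda>k. ennreal u * W (u + v) * indicator (S k) u = ennreal u * W (u + v)) sequentially"
          by eventually_elim (simp add: indicator_def S_def)
        then show ?thesis by (rule tendsto_eventually)
      next
        case False
        then show ?thesis by (simp add: ennreal_neg)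
      qed
    qed (use S in measurable)
    have "(\<lambda>k. \<integral>\<^sup>+v. J k v \<partial>\<mu>) \<longlonglongrightarrow> (\<integral>\<^sup>+v. \<integral>\<^sup>+u. ennreal u * W (u + v) \<partial>\<nu> \<partial>\<mu>)"
    proof (rule nn_integral_LIMSEQ)
      show "incseq J"
        unfolding J_def by (auto simp: incseq_def le_fun_def intro!: nn_integral_mono mult_left_mono Smono)
      show "J k \<in> borel_measurable \<mu>" for k
      proof -
        interpret finite_measure "jump_part \<nu> 1 (S k)"
          by (rule finite_measure_jump_part[OF L(3) S zero_le_one])
        note [measurable_cong] = jump_part_facts(1)[OF L(3) S(1)[of k] zero_le_one]
        have "J k = (\<lambda>v. \<integral>\<^sup>+u. ennreal u * W (u + v) \<partial>jump_part \<nu> 1 (S k))"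
          unfolding J_def by (subst jump_part_facts(2)[OF L(3) S(1)]) auto
        then show ?thesis by simp
      qed
    qed (rule Jlim)
    then show ?thesis unfolding IJ[symmetric] by (simp add: fun_eq_iff)
  qed
  have "(\<lambda>k. I k + ennreal (max 1 b) * m k) \<longlonglongrightarrow>
      (\<integral>\<^sup>+v. \<integral>\<^sup>+u. ennreal u * W (u + v) \<partial>\<nu> \<partial>\<mu>) + ennreal (max 1 b) * 0"
    unfolding m_def
    by (intro tendsto_add conv ennreal_tendsto_cmult small_jump_mean_tendsto_0 L(3)) simp
  then have "Z \<le> (\<integral>\<^sup>+v. \<integral>\<^sup>+u. ennreal u * W (u + v) \<partial>\<nu> \<partial>\<mu>)"
    using bounds by (auto intro: LIMSEQ_le_const)
  moreover have "(\<integral>\<^sup>+v. \<integral>\<^sup>+u. ennreal u * W (u + v) \<partial>\<nu> \<partial>\<mu>) \<le> Z"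
    using conv bounds by (auto intro: LIMSEQ_le_const2)
  ultimately show ?thesis by (simp add: Z_def W_def)
qed

lemma window_size_bias_bounds:
  assumes M: "sets M = sets borel" and fin: "emeasure M {x<..x + c} < \<infinity>" and x: "0 \<le> x" "0 \<le> c"
  shows "ennreal (x * measure M {x<..x + c}) \<le> (\<integral>\<^sup>+y. ennreal y * indicator {x<..x + c} y \<partial>M)"
    and "(\<integral>\<^sup>+y. ennreal y * indicator {x<..x + c} y \<partial>M) \<le> ennreal ((x + c) * measure M {x<..x + c})"
proof -
  have em: "(\<integral>\<^sup>+y. ennreal b * indicator {x<..x + c} y \<partial>M) = ennreal (b * measure M {x<..x + c})" if "0 \<le> b" for b
    using fin that by (subst nn_integral_cmult_indicator) (auto simp: M emeasure_eq_ennreal_measure ennreal_mult)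
  have "ennreal (x * measure M {x<..x + c}) = (\<integral>\<^sup>+y. ennreal x * indicator {x<..x + c} y \<partial>M)"
    using x by (subst em) auto
  also have "\<dots> \<le> (\<integral>\<^sup>+y. ennreal y * indicator {x<..x + c} y \<partial>M)"
    by (rule nn_integral_mono) (auto simp: indicator_def intro!: ennreal_leI)
  finally show "ennreal (x * measure M {x<..x + c}) \<le> (\<integral>\<^sup>+y. ennreal y * indicator {x<..x + c} y \<partial>M)" .
  have "(\<integral>\<^sup>+y. ennreal y * indicator {x<..x + c} y \<partial>M) \<le> (\<integral>\<^sup>+y. ennreal (x + c) * indicator {x<..x + c} y \<partial>M)"
    by (rule nn_integral_mono) (auto simp: indicator_def intro!: ennreal_leI)
  also have "\<dots> = ennreal ((x + c) * measure M {x<..x + c})" using x by (subst em) auto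
  finally show "(\<integral>\<^sup>+y. ennreal y * indicator {x<..x + c} y \<partial>M) \<le> ennreal ((x + c) * measure M {x<..x + c})" .
qed

text \<open>The window masses of the measure \<open>u \<nu>(du)\<close>, which is finite on bounded sets.\<close>

definition levy_window :: "real measure \<Rightarrow> real \<Rightarrow> real \<Rightarrow> real" where
  "levy_window \<nu> c x = enn2real (\<integral>\<^sup>+u. ennreal u * indicator {x<..x + c} u \<partial>\<nu>)"

lemma levy_window_nonneg: "0 \<le> levy_window \<nu> c x"
  by (simp add: levy_window_def)

lemma
  assumes \<nu>: "levy_measure \<nu>"
  shows ennreal_levy_window: "ennreal (levy_window \<nu> c x) = (\<integral>\<^sup>+u. ennreal u * indicator {x<..x + c} u \<partial>\<nu>)"
    and levy_window_le: "levy_window \<nu> c x \<le> enn2real (small_jump_mean \<nu> (x + c))"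
    and borel_measurable_levy_window: "0 < c \<Longrightarrow> levy_window \<nu> c \<in> borel_measurable borel"
    and levy_window_zero: "x < - c \<Longrightarrow> levy_window \<nu> c x = 0"
    and levy_window_mono: "{x<..x + c} \<subseteq> {y<..y + d} \<Longrightarrow> levy_window \<nu> c x \<le> levy_window \<nu> d y"
proof -
  note [measurable_cong] = levy_measureD(1)[OF \<nu>]
  have le: "(\<integral>\<^sup>+u. ennreal u * indicator {x<..x + c} u \<partial>\<nu>) \<le> small_jump_mean \<nu> (x + c)" for x c
    unfolding small_jump_mean_def by (rule nn_integral_mono) (auto simp: indicator_def)
  have fin: "(\<integral>\<^sup>+u. ennreal u * indicator {x<..x + c} u \<partial>\<nu>) < \<infinity>" for x c
    by (rule le_less_trans[OF le small_jump_mean_le(2)[OF \<nu>]])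
  show eq: "ennreal (levy_window \<nu> c x) = (\<integral>\<^sup>+u. ennreal u * indicator {x<..x + c} u \<partial>\<nu>)" for x c
    using fin[of x c] by (simp add: levy_window_def less_top)
  show "levy_window \<nu> c x \<le> enn2real (small_jump_mean \<nu> (x + c))"
    unfolding levy_window_def using small_jump_mean_le(2)[OF \<nu>, of "x + c"] le by (intro enn2real_mono) auto
  show "levy_window \<nu> c x = 0" if "x < - c"
  proof -
    have "(\<integral>\<^sup>+u. ennreal u * indicator {x<..x + c} u \<partial>\<nu>) = (\<integral>\<^sup>+u. 0 \<partial>\<nu>)"
      by (rule nn_integral_cong) (use that in \<open>auto simp: indicator_def ennreal_neg\<close>)
    then show ?thesis by (simp add: levy_window_def)
  qed
  show "levy_window \<nu> c x \<le> levy_window \<nu> d y" if "{x<..x + c} \<subseteq> {y<..y + d}"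
    unfolding levy_window_def using fin[of y d] that
    by (intro enn2real_mono nn_integral_mono) (auto simp: indicator_def)
  show "levy_window \<nu> c \<in> borel_measurable borel" if c: "0 < c"
  proof -
    define \<Phi> where "\<Phi> b = enn2real (small_jump_mean \<nu> b)" for b
    have "mono \<Phi>"
      unfolding \<Phi>_def mono_def small_jump_mean_def
      using small_jump_mean_le(2)[OF \<nu>] unfolding small_jump_mean_def
      by (auto intro!: enn2real_mono nn_integral_mono simp: indicator_def)
    then have [measurable]: "\<Phi> \<in> borel_measurable borel" by (rule borel_measurable_mono)
    have "levy_window \<nu> c x = \<Phi> (x + c) - \<Phi> x" for x
    proof -
      have "small_jump_mean \<nu> (x + c) = small_jump_mean \<nu> x + ennreal (levy_window \<nu> c x)"
        unfolding eq small_jump_mean_def using c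
        by (subst nn_integral_add[symmetric]) (auto intro!: nn_integral_cong simp: indicator_def)
      then show ?thesis
        using small_jump_mean_le(2)[OF \<nu>, of x]
        by (simp add: \<Phi>_def enn2real_plus levy_window_nonneg)
    qed
    then have "levy_window \<nu> c = (\<lambda>x. \<Phi> (x + c) - \<Phi> x)" by (simp add: fun_eq_iff)
    then show ?thesis by simp
  qed
qed

lemma size_bias_windows:
  assumes \<mu>: "levy_khintchine_on_nonneg \<mu> 0 \<nu>"
  shows "(\<integral>\<^sup>+v. ennreal (levy_window \<nu> c (x - v)) \<partial>\<mu>) = (\<integral>\<^sup>+y. ennreal y * indicator {x<..x + c} y \<partial>\<mu>)"
  unfolding size_bias_identity[OF \<mu>] ennreal_levy_window[OF levy_khintchineD(3)[OF \<mu>]]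
  by (intro nn_integral_cong) (auto simp: indicator_def algebra_simps)

lemma levy_window_bounds:
  assumes \<nu>: "levy_measure \<nu>" and x: "0 < x" and c: "0 \<le> c"
  shows "x * measure \<nu> {x<..x + c} \<le> levy_window \<nu> c x \<and> levy_window \<nu> c x \<le> (x + c) * measure \<nu> {x<..x + c}"
proof -
  have "emeasure \<nu> {x<..x + c} \<le> emeasure \<nu> {x<..}"
    by (rule emeasure_mono) (auto simp: levy_measureD[OF \<nu>])
  then have "emeasure \<nu> {x<..x + c} < \<infinity>" using levy_tail_finite[OF \<nu> x] by (rule le_less_trans)
  then show ?thesis
    using window_size_bias_bounds[OF levy_measureD(1)[OF \<nu>] _ less_imp_le[OF x] c]
    unfolding ennreal_levy_window[OF \<nu>, symmetric] using x c by (simp add: ennreal_le_iff levy_window_nonneg)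
qed

section \<open>Convolving window functions\<close>

text \<open>
  The function \<open>y \<mapsto> M(y, y + c]\<close> of a locally finite measure \<open>M\<close> on the half line has these properties.
  They make its averages over distributions on the half line finite, and they are preserved by averaging.
\<close>

definition window_function :: "(real \<Rightarrow> real) \<Rightarrow> bool" where
  "window_function g \<longleftrightarrow> g \<in> borel_measurable borel \<and> (\<forall>x. 0 \<le> g x) \<and>
     (\<exists>c. \<forall>x<c. g x = 0) \<and> (\<forall>A. \<exists>B. \<forall>x\<le>A. g x \<le> B)"

text \<open>If \<open>g\<close> gives the window masses of \<open>M\<close>, this gives those of \<open>M \<star> \<sigma>\<close>.\<close>

definition average :: "real measure \<Rightarrow> (real \<Rightarrow> real) \<Rightarrow> real \<Rightarrow> real" where
  "average \<sigma> g x = (\<integral>v. g (x - v) \<partial>\<sigma>)"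

definition locally_dominated :: "real measure \<Rightarrow> (real \<Rightarrow> real) \<Rightarrow> bool" where
  "locally_dominated \<sigma> p \<longleftrightarrow>
     (\<forall>T. \<exists>K\<ge>0. eventually (\<lambda>x. measure \<sigma> {x - T<..x + T} \<le> K * p x) at_top)"

lemma window_functionD:
  assumes "window_function g"
  shows "g \<in> borel_measurable borel" "0 \<le> g x" "\<exists>c. \<forall>x<c. g x = 0" "\<exists>B\<ge>0. \<forall>x\<le>A. g x \<le> B"
proof -
  show "g \<in> borel_measurable borel" "0 \<le> g x" "\<exists>c. \<forall>x<c. g x = 0"
    using assms by (auto simp: window_function_def)
  obtain B where "\<forall>x\<le>A. g x \<le> B" using assms unfolding window_function_def by blast
  then show "\<exists>B\<ge>0. \<forall>x\<le>A. g x \<le> B" by (intro exI[of _ "max 0 B"]) auto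
qed

lemma ennreal_average:
  assumes g: "window_function g" and \<sigma>: "real_distribution \<sigma>" "emeasure \<sigma> {..<0} = 0"
  shows "ennreal (average \<sigma> g x) = (\<integral>\<^sup>+v. ennreal (g (x - v)) \<partial>\<sigma>)"
proof -
  note [measurable] = window_functionD(1)[OF g] and [measurable_cong] = real_distributionD(4)[OF \<sigma>(1)]
  interpret \<sigma>: real_distribution \<sigma> by fact
  obtain B where B: "\<And>y. y \<le> x \<Longrightarrow> g y \<le> B" using window_functionD(4)[OF g, of x] by blast
  have "integrable \<sigma> (\<lambda>v. g (x - v))"
    by (rule \<sigma>.integrable_const_bound[where B=B])
       (use AE_nonneg[OF real_distributionD(4)[OF \<sigma>(1)] \<sigma>(2)] B window_functionD(2)[OF g] in
        \<open>auto elim!: eventually_mono\<close>)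
  then show ?thesis
    unfolding average_def by (subst nn_integral_eq_integral) (auto simp: window_functionD(2)[OF g])
qed

lemma average_nonneg: "window_function g \<Longrightarrow> 0 \<le> average \<sigma> g x"
  unfolding average_def by (auto intro!: integral_nonneg simp: window_functionD(2))

lemma window_function_average:
  assumes g: "window_function g" and \<sigma>: "real_distribution \<sigma>" "emeasure \<sigma> {..<0} = 0"
  shows "window_function (average \<sigma> g)"
  unfolding window_function_def
proof (intro conjI allI)
  note [measurable] = window_functionD(1)[OF g] and [measurable_cong] = real_distributionD(4)[OF \<sigma>(1)]
  interpret \<sigma>: real_distribution \<sigma> by fact
  note ae = AE_nonneg[OF real_distributionD(4)[OF \<sigma>(1)] \<sigma>(2)]
  show "average \<sigma> g \<in> borel_measurable borel" unfolding average_def by measurable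
  show "0 \<le> average \<sigma> g x" for x by (rule average_nonneg[OF g])
  obtain c where c: "\<And>x. x < c \<Longrightarrow> g x = 0" using window_functionD(3)[OF g] by blast
  have "average \<sigma> g x = 0" if "x < c" for x
  proof -
    have "average \<sigma> g x = (\<integral>v. 0 \<partial>\<sigma>)" unfolding average_def
      by (rule integral_cong_AE) (use ae c that in \<open>auto elim!: eventually_mono\<close>)
    then show ?thesis by simp
  qed
  then show "\<exists>c. \<forall>x<c. average \<sigma> g x = 0" by blast
  fix A
  obtain B where B: "0 \<le> B" "\<And>y. y \<le> A \<Longrightarrow> g y \<le> B" using window_functionD(4)[OF g, of A] by blast
  have "average \<sigma> g x \<le> B" if "x \<le> A" for x
  proof -
    have "ennreal (average \<sigma> g x) \<le> (\<integral>\<^sup>+v. ennreal B \<partial>\<sigma>)"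
      unfolding ennreal_average[OF g \<sigma>]
    proof (rule nn_integral_mono_AE, use ae in eventually_elim)
      fix v :: real assume "0 \<le> v"
      then show "ennreal (g (x - v)) \<le> ennreal B" using B(2)[of "x - v"] that by (intro ennreal_leI) auto
    qed
    then show ?thesis using B(1) \<sigma>.emeasure_space_1 by simp
  qed
  then show "\<exists>B. \<forall>x\<le>A. average \<sigma> g x \<le> B" by blast
qed

lemma average_convolution:
  assumes g: "window_function g" and M: "real_distribution M" "emeasure M {..<0} = 0"
    and N: "real_distribution N" "emeasure N {..<0} = 0"
  shows "average (M \<star> N) g = average M (average N g)"
proof
  fix x
  note [measurable] = window_functionD(1)[OF g]
  have "ennreal (average (M \<star> N) g x) = (\<integral>\<^sup>+u. \<integral>\<^sup>+v. ennreal (g (x - (u + v))) \<partial>N \<partial>M)"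
    unfolding ennreal_average[OF g real_distribution_convolution[OF M(1) N(1)] convolution_nonneg[OF M N]]
    by (rule nn_integral_conv[OF M(1) N(1)]) measurable
  also have "\<dots> = ennreal (average M (average N g) x)"
    unfolding ennreal_average[OF window_function_average[OF g N] M] ennreal_average[OF g N]
    by (simp add: diff_diff_eq)
  finally show "average (M \<star> N) g x = average M (average N g) x"
    by (simp add: average_nonneg window_function_average g N)
qed

lemma average_return: "window_function g \<Longrightarrow> average (return borel 0) g = g"
  unfolding average_def
  by (rule ext, subst integral_return) (auto dest: window_functionD(1))

lemma nn_integral_reflect:
  fixes f :: "real \<Rightarrow> ennreal"
  assumes "f \<in> borel_measurable borel"
  shows "(\<integral>\<^sup>+t. f (x - t) \<partial>lborel) = (\<integral>\<^sup>+t. f t \<partial>lborel)"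
  using nn_integral_real_affine[OF assms, of "-1" x] by simp

lemma tail_le:
  assumes "real_distribution \<sigma>" and "0 < (\<delta>::real)"
  shows "eventually (\<lambda>A. measure \<sigma> {A<..} \<le> \<delta>) at_top"
proof -
  interpret real_distribution \<sigma> by fact
  have "eventually (\<lambda>A. 1 - \<delta> < cdf \<sigma> A) at_top"
    using cdf_lim_at_top_prob assms(2) by (intro order_tendstoD(1)) auto
  then show ?thesis
  proof eventually_elim
    case (elim A)
    have "prob {A<..} = 1 - prob {..A}"
      using prob_compl[of "{..A}"] by (simp add: Compl_eq_Diff_UNIV[symmetric] not_le flip: Compl_atMost)
    then show ?case using elim by (simp add: cdf_def)
  qed
qed

lemma mass_Icc:
  assumes "real_distribution \<tau>" "emeasure \<tau> {..<0} = 0" "0 \<le> B"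
  shows "measure \<tau> {0..B} = 1 - measure \<tau> {B<..}"
proof -
  interpret real_distribution \<tau> by fact
  have "- {B<..} = {..<0} \<union> {0..B}" using assms(3) by auto
  then have "prob ({..<0} \<union> {0..B}) = 1 - prob {B<..}"
    using prob_compl[of "{B<..}"] by (simp add: Compl_eq_Diff_UNIV)
  moreover have "prob ({..<0} \<union> {0..B}) = prob {0..B}"
    using assms(2) by (subst finite_measure_Union) (auto simp: measure_def)
  ultimately show ?thesis by simp
qed

lemma mass_Icc_half:
  assumes "real_distribution \<tau>" "emeasure \<tau> {..<0} = 0"
  obtains B where "0 \<le> B" "1/2 \<le> measure \<tau> {0..B}"
proof -
  have "eventually (\<lambda>B. 0 \<le> B \<and> measure \<tau> {B<..} \<le> 1/2) at_top"
    by (intro eventually_conj eventually_ge_at_top tail_le assms) simp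
  then obtain B where "0 \<le> B" "measure \<tau> {B<..} \<le> 1/2" unfolding eventually_at_top_linorder by blast
  then show ?thesis using mass_Icc[OF assms] that by simp
qed

text \<open>
  Replacing a measure by the density \<open>t \<mapsto> \<sigma>(t, t+1]\<close>: write the value at \<open>v\<close> as its integral over
  \<open>t \<in> [v-1, v)\<close> and exchange the order of integration.
\<close>

lemma nn_integral_le_window_density:
  fixes f F :: "real \<Rightarrow> ennreal"
  assumes \<sigma>: "sigma_finite_measure \<sigma>" "sets \<sigma> = sets borel"
    and [measurable]: "f \<in> borel_measurable borel" "F \<in> borel_measurable borel"
    and le: "\<And>v t. a < v \<Longrightarrow> v \<le> b \<Longrightarrow> v - 1 \<le> t \<Longrightarrow> t < v \<Longrightarrow> f v \<le> F t"
  shows "(\<integral>\<^sup>+v. f v * indicator {a<..b} v \<partial>\<sigma>)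
    \<le> (\<integral>\<^sup>+t. F t * emeasure \<sigma> {t<..t + 1} * indicator {a - 1..b} t \<partial>lborel)"
proof -
  note [measurable_cong] = \<sigma>(2)
  interpret \<sigma>: sigma_finite_measure \<sigma> by fact
  interpret P: pair_sigma_finite \<sigma> lborel ..
  have "(\<integral>\<^sup>+v. f v * indicator {a<..b} v \<partial>\<sigma>) =
      (\<integral>\<^sup>+v. \<integral>\<^sup>+t. f v * indicator {a<..b} v * indicator {v - 1..<v} t \<partial>lborel \<partial>\<sigma>)"
    by (intro nn_integral_cong) (simp add: nn_integral_cmult)
  also have "\<dots> \<le> (\<integral>\<^sup>+v. \<integral>\<^sup>+t. F t * indicator {a - 1..b} t * (if t < v \<and> v \<le> t + 1 then 1 else 0) \<partial>lborel \<partial>\<sigma>)"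
    by (intro nn_integral_mono) (auto simp: indicator_def intro: le)
  also have "\<dots> = (\<integral>\<^sup>+t. \<integral>\<^sup>+v. F t * indicator {a - 1..b} t * (if t < v \<and> v \<le> t + 1 then 1 else 0) \<partial>\<sigma> \<partial>lborel)"
    by (rule P.Fubini'[symmetric]) measurable
  also have "\<dots> = (\<integral>\<^sup>+t. F t * emeasure \<sigma> {t<..t + 1} * indicator {a - 1..b} t \<partial>lborel)"
  proof (intro nn_integral_cong)
    fix t
    have "(\<integral>\<^sup>+v. F t * indicator {a - 1..b} t * (if t < v \<and> v \<le> t + 1 then 1 else 0) \<partial>\<sigma>) =
        (\<integral>\<^sup>+v. F t * indicator {a - 1..b} t * indicator {t<..t + 1} v \<partial>\<sigma>)"
      by (intro nn_integral_cong) (auto simp: indicator_def)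
    also have "\<dots> = F t * indicator {a - 1..b} t * emeasure \<sigma> {t<..t + 1}"
      by (subst nn_integral_cmult_indicator) (auto simp: \<sigma>(2))
    finally show "(\<integral>\<^sup>+v. F t * indicator {a - 1..b} t * (if t < v \<and> v \<le> t + 1 then 1 else 0) \<partial>\<sigma>) =
        F t * emeasure \<sigma> {t<..t + 1} * indicator {a - 1..b} t" by (simp add: mult_ac)
  qed
  finally show ?thesis .
qed

section \<open>Convolution with a measure dominated by a subexponential density\<close>

lemma subexp_densitiesD:
  assumes "p \<in> subexp_densities"
  shows "p \<in> long_tailed" "prob_density p" "tail_equiv (density_conv p p) (\<lambda>x. 2 * p x)"
  using assms by (auto simp: subexp_densities_def long_tailed_densities_def)

lemma density_conv_nn_integral:
  assumes "density_conv p p x \<noteq> 0" "\<And>x. 0 \<le> p x"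
  shows "(\<integral>\<^sup>+t. ennreal (p (x - t) * p t) \<partial>lborel) = ennreal (density_conv p p x)"
proof -
  have "integrable lborel (\<lambda>t. p (x - t) * p t)"
    using assms(1) unfolding density_conv_def by (metis not_integrable_integral_eq)
  then show ?thesis
    unfolding density_conv_def by (rule nn_integral_eq_integral) (simp add: assms(2))
qed

lemma real_distribution_density:
  assumes "prob_density p"
  shows "real_distribution (density lborel (\<lambda>x. ennreal (p x)))"
  using assms by (intro real_distributionI prob_spaceI) (auto simp: prob_density_def emeasure_density)

lemma AE_density_nonneg:
  fixes p :: "real \<Rightarrow> real"
  assumes "p \<in> borel_measurable borel" "\<forall>x<0. p x = 0"
  shows "AE x in density lborel (\<lambda>x. ennreal (p x)). 0 \<le> x"
proof (subst AE_density)
  show "AE x in lborel. 0 < ennreal (p x) \<longrightarrow> 0 \<le> x"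
    by (rule AE_I2) (use assms(2) in \<open>force simp: not_le[symmetric]\<close>)
qed (use assms in simp)

lemma emeasure_density_neg:
  fixes p :: "real \<Rightarrow> real"
  assumes "p \<in> borel_measurable borel" "\<forall>x<0. p x = 0"
  shows "emeasure (density lborel (\<lambda>x. ennreal (p x))) {..<0} = 0"
  using AE_density_nonneg[OF assms] by (subst (asm) AE_iff_measurable[where N="{..<0}"]) (auto simp: not_le)

lemma mass_near_origin:
  assumes p: "prob_density p" "\<forall>x<0. p x = 0" and \<delta>: "0 < \<delta>"
  shows "eventually (\<lambda>A. ennreal (1 - \<delta>) \<le> (\<integral>\<^sup>+t. ennreal (p t) * indicator {0..A} t \<partial>lborel)) at_top"
  using tail_le[OF real_distribution_density[OF p(1)] \<delta>] eventually_ge_at_top[of 0]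
proof eventually_elim
  case (elim A)
  have [measurable]: "p \<in> borel_measurable borel" using p by (auto simp: prob_density_def)
  let ?\<mu> = "density lborel (\<lambda>x. ennreal (p x))"
  note R = real_distribution_density[OF p(1)]
  have "ennreal (1 - \<delta>) \<le> ennreal (measure ?\<mu> {0..A})"
    using elim mass_Icc[OF R emeasure_density_neg] p by (intro ennreal_leI) simp
  also have "\<dots> = (\<integral>\<^sup>+t. ennreal (p t) * indicator {0..A} t \<partial>lborel)"
    by (subst finite_measure.emeasure_eq_measure[symmetric], rule real_distributionD[OF R], subst emeasure_density) auto
  finally show ?case .
qed

text \<open>
  Near either end of the range of integration one factor is close to \<open>p x\<close> while the other one integrates
  to nearly \<open>1\<close>, and for large \<open>x\<close> the two ends do not overlap.
\<close>

lemma long_tailed_conv_ends: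
  assumes p: "p \<in> long_tailed" "prob_density p" "\<forall>x<0. p x = 0" and \<delta>: "0 < \<delta>" "\<delta> \<le> 1/2"
  shows "\<exists>A. eventually (\<lambda>x. ennreal (2 * (1 - \<delta>)\<^sup>2 * p x) +
      (\<integral>\<^sup>+t. ennreal (p (x - t) * p t) * indicator {A..x - A} t \<partial>lborel)
    \<le> (\<integral>\<^sup>+t. ennreal (p (x - t) * p t) \<partial>lborel)) at_top"
proof -
  have [measurable]: "p \<in> borel_measurable borel" and p0: "\<And>x. 0 \<le> p x"
    using p(2) by (auto simp: prob_density_def)
  obtain A where A: "0 \<le> A" "ennreal (1 - \<delta>) \<le> (\<integral>\<^sup>+t. ennreal (p t) * indicator {0..A} t \<partial>lborel)"
    using eventually_conj[OF eventually_ge_at_top[of 0] mass_near_origin[OF p(2,3) \<delta>(1)]]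
    by (auto simp: eventually_at_top_linorder)
  have "eventually (\<lambda>x. ennreal (2 * (1 - \<delta>)\<^sup>2 * p x) +
      (\<integral>\<^sup>+t. ennreal (p (x - t) * p t) * indicator {A + 1..x - (A + 1)} t \<partial>lborel)
    \<le> (\<integral>\<^sup>+t. ennreal (p (x - t) * p t) \<partial>lborel)) at_top"
    using long_tailed_uniform[OF p(1) \<delta>(1), of A] eventually_ge_at_top[of "2 * A + 2"]
  proof eventually_elim
    case (elim x)
    let ?f = "\<lambda>t. ennreal (p (x - t) * p t)"
    let ?e = "\<integral>\<^sup>+t. ?f t * indicator {0..A} t \<partial>lborel"
    let ?e' = "\<integral>\<^sup>+t. ?f t * indicator {x - A..x} t \<partial>lborel"
    let ?M = "\<integral>\<^sup>+t. ?f t * indicator {A + 1..x - (A + 1)} t \<partial>lborel"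
    have px: "0 < p x" using elim(1)[rule_format, of 0] A by simp
    have refl: "?e' = ?e"
      by (subst nn_integral_reflect[symmetric, of _ x], measurable)
         (auto intro!: nn_integral_cong simp: indicator_def mult.commute)
    have "ennreal ((1 - \<delta>) * p x * (1 - \<delta>)) = ennreal ((1 - \<delta>) * p x) * ennreal (1 - \<delta>)"
      using \<delta> px by (subst ennreal_mult) auto
    also have "\<dots> \<le> ennreal ((1 - \<delta>) * p x) * (\<integral>\<^sup>+t. ennreal (p t) * indicator {0..A} t \<partial>lborel)"
      by (intro mult_left_mono A) auto
    also have "\<dots> = (\<integral>\<^sup>+t. ennreal ((1 - \<delta>) * p x) * (ennreal (p t) * indicator {0..A} t) \<partial>lborel)"
      by (rule nn_integral_cmult[symmetric]) measurable
    also have "\<dots> \<le> ?e"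
    proof (rule nn_integral_mono)
      fix t
      have "(1 - \<delta>) * p x * p t \<le> p (x - t) * p t" if "t \<in> {0..A}"
        using elim(1)[rule_format, of "- t"] that
        by (intro mult_right_mono p0) (auto simp: abs_le_iff algebra_simps)
      then show "ennreal ((1 - \<delta>) * p x) * (ennreal (p t) * indicator {0..A} t) \<le> ?f t * indicator {0..A} t"
        using \<delta> px by (auto simp: indicator_def ennreal_mult[symmetric] p0 intro!: ennreal_leI)
    qed
    finally have e: "ennreal ((1 - \<delta>) * p x * (1 - \<delta>)) \<le> ?e" .
    have "ennreal (2 * (1 - \<delta>)\<^sup>2 * p x) = ennreal ((1 - \<delta>) * p x * (1 - \<delta>)) + ennreal ((1 - \<delta>) * p x * (1 - \<delta>))"
    proof -
      have "0 \<le> (1 - \<delta>) * p x * (1 - \<delta>)" using \<delta> px by auto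
      moreover have "2 * (1 - \<delta>)\<^sup>2 * p x = (1 - \<delta>) * p x * (1 - \<delta>) + (1 - \<delta>) * p x * (1 - \<delta>)"
        by (simp add: power2_eq_square algebra_simps)
      ultimately show ?thesis by (simp only: ennreal_plus)
    qed
    also have "\<dots> \<le> ?e + ?e'" unfolding refl by (intro add_mono e)
    finally have "ennreal (2 * (1 - \<delta>)\<^sup>2 * p x) + ?M \<le> ?e + ?e' + ?M" by (rule add_right_mono)
    also have "?e + ?e' + ?M =
        (\<integral>\<^sup>+t. ?f t * indicator {0..A} t + ?f t * indicator {x - A..x} t + ?f t * indicator {A + 1..x - (A + 1)} t \<partial>lborel)"
      by (simp add: nn_integral_add)
    also have "\<dots> \<le> (\<integral>\<^sup>+t. ?f t \<partial>lborel)"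
      by (rule nn_integral_mono) (use elim(2) A in \<open>auto simp: indicator_def\<close>)
    finally show ?case .
  qed
  then show ?thesis by blast
qed

text \<open>
  By subexponentiality the convolution is asymptotic to \<open>2 p x\<close>, and the two ends already use this up.
\<close>

lemma subexp_middle_negligible:
  assumes p: "p \<in> subexp_densities" "\<forall>x<0. p x = 0" and \<epsilon>: "0 < \<epsilon>"
  shows "\<exists>A. \<forall>A'\<ge>A. eventually (\<lambda>x.
    (\<integral>\<^sup>+t. ennreal (p (x - t) * p t) * indicator {A'..x - A'} t \<partial>lborel) \<le> ennreal (\<epsilon> * p x)) at_top"
proof -
  note S = subexp_densitiesD[OF p(1)]
  have [measurable]: "p \<in> borel_measurable borel" and p0: "\<And>x. 0 \<le> p x"
    using S(2) by (auto simp: prob_density_def)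
  define \<delta> where "\<delta> = min (1/2) (\<epsilon> / 6)"
  have \<delta>: "0 < \<delta>" "\<delta> \<le> 1/2" "6 * \<delta> \<le> \<epsilon>" using \<epsilon> by (auto simp: \<delta>_def)
  define M where "M A' x = (\<integral>\<^sup>+t. ennreal (p (x - t) * p t) * indicator {A'..x - A'} t \<partial>lborel)" for A' x
  obtain A where A: "eventually (\<lambda>x. ennreal (2 * (1 - \<delta>)\<^sup>2 * p x) + M A x
      \<le> (\<integral>\<^sup>+t. ennreal (p (x - t) * p t) \<partial>lborel)) at_top"
    using long_tailed_conv_ends[OF S(1,2) p(2) \<delta>(1,2)] unfolding M_def by blast
  have "eventually (\<lambda>x. M A x \<le> ennreal (\<epsilon> * p x)) at_top"
    using tail_equivD[OF S(3) \<delta>(1)] A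
  proof eventually_elim
    case (elim x)
    have px: "0 < p x" and c: "density_conv p p x \<noteq> 0" "density_conv p p x \<le> (2 + 2 * \<delta>) * p x"
      using elim(1) by (auto simp: abs_le_iff algebra_simps)
    note elim(2)
    also have "(\<integral>\<^sup>+t. ennreal (p (x - t) * p t) \<partial>lborel) = ennreal (density_conv p p x)"
      by (rule density_conv_nn_integral[OF c(1) p0])
    also have "\<dots> \<le> ennreal ((2 + 2 * \<delta>) * p x)" by (intro ennreal_leI c)
    finally have sum: "ennreal (2 * (1 - \<delta>)\<^sup>2 * p x) + M A x \<le> ennreal ((2 + 2 * \<delta>) * p x)" .
    then have "M A x \<le> ennreal ((2 + 2 * \<delta>) * p x)" by (rule order_trans[rotated]) simp
    then obtain m where m: "M A x = ennreal m" "0 \<le> m"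
      by (cases "M A x") (auto simp: top_unique)
    have "ennreal (2 * (1 - \<delta>)\<^sup>2 * p x + m) \<le> ennreal ((2 + 2 * \<delta>) * p x)"
      using sum px m(2) unfolding m(1) by (subst ennreal_plus) auto
    then have "2 * (1 - \<delta>)\<^sup>2 * p x + m \<le> (2 + 2 * \<delta>) * p x"
      using \<delta> px by (subst (asm) ennreal_le_iff) auto
    then have "m \<le> (6 * \<delta> - 2 * \<delta> * \<delta>) * p x" by (simp add: power2_eq_square algebra_simps)
    also have "\<dots> \<le> \<epsilon> * p x" using \<delta> px by (intro mult_right_mono) (auto intro: order_trans[rotated])
    finally show ?case unfolding m by (rule ennreal_leI)
  qed
  then have "eventually (\<lambda>x. M A' x \<le> ennreal (\<epsilon> * p x)) at_top" if "A \<le> A'" for A'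
  proof eventually_elim
    case (elim x)
    have "M A' x \<le> M A x" unfolding M_def
      by (rule nn_integral_mono) (use that in \<open>auto simp: indicator_def\<close>)
    then show ?case using elim by (rule order_trans)
  qed
  then show ?thesis unfolding M_def by blast
qed

text \<open>
  Averages of functions on the scale \<open>x p x\<close> split into three ranges of the averaging variable. Near
  \<open>0\<close> the long tail makes the argument shift harmless. In the middle the averaging measure may be
  replaced by \<open>p\<close>, and subexponentiality applies. Near \<open>x\<close> the function is bounded, so the contribution
  is of the order \<open>p x\<close>, without the factor \<open>x\<close>.
\<close>

lemma average_near_part:
  assumes w: "w \<in> long_tailed" and U: "0 \<le> U" "eventually (\<lambda>y. g y \<le> U * (y * w y)) at_top" and \<epsilon>: "0 < \<epsilon>"
  shows "eventually (\<lambda>x. \<forall>v\<in>{0..A}. g (x - v) \<le> (U + \<epsilon>) * (x * w x)) at_top"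
proof -
  define \<eta> where "\<eta> = \<epsilon> / (U + 1)"
  have \<eta>: "0 < \<eta>" "U * \<eta> \<le> \<epsilon>" using \<epsilon> U(1) by (auto simp: \<eta>_def field_simps)
  obtain Y where Y: "\<And>y. Y \<le> y \<Longrightarrow> g y \<le> U * (y * w y)" using U(2) unfolding eventually_at_top_linorder by blast
  show ?thesis
    using long_tailed_uniform[OF w \<eta>(1), of A] eventually_ge_at_top[of "max 0 (Y + A)"] eventually_ge_at_top[of A]
  proof (eventually_elim, intro ballI)
    fix x v
    assume u: "\<forall>a. \<bar>a\<bar> \<le> A \<longrightarrow> 0 < w (x + a) \<and> \<bar>w (x + a) - w x\<bar> \<le> \<eta> * w x"
      and x: "max 0 (Y + A) \<le> x" "A \<le> x" and v: "v \<in> {0..A}"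
    have wx: "0 \<le> w x" by (rule long_tailedD(2)[OF w])
    have "\<bar>w (x + - v) - w x\<bar> \<le> \<eta> * w x" using u[rule_format, of "- v"] v by simp
    then have "w (x - v) \<le> (1 + \<eta>) * w x" by (simp add: abs_le_iff algebra_simps)
    then have "(x - v) * w (x - v) \<le> x * ((1 + \<eta>) * w x)"
      using v x long_tailedD(2)[OF w] by (intro mult_mono) auto
    then have "U * ((x - v) * w (x - v)) \<le> U * (x * ((1 + \<eta>) * w x))" using U(1) by (rule mult_left_mono)
    also have "\<dots> = (U + U * \<eta>) * (x * w x)" by (simp add: algebra_simps)
    also have "\<dots> \<le> (U + \<epsilon>) * (x * w x)" using \<eta> x wx by (intro mult_right_mono) auto
    finally show "g (x - v) \<le> (U + \<epsilon>) * (x * w x)" using Y[of "x - v"] v x by auto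
  qed
qed

lemma average_far_part:
  assumes p: "p \<in> long_tailed" and \<sigma>: "real_distribution \<sigma>" "locally_dominated \<sigma> p"
    and g: "window_function g" and \<epsilon>: "0 < \<epsilon>"
  shows "eventually (\<lambda>x. (\<integral>\<^sup>+v. ennreal (g (x - v)) * indicator {x - A<..} v \<partial>\<sigma>) \<le> ennreal (\<epsilon> * (x * p x))) at_top"
proof -
  note [measurable_cong] = real_distributionD(4)[OF \<sigma>(1)]
  interpret \<sigma>: real_distribution \<sigma> by fact
  obtain c where c: "\<And>x. x < c \<Longrightarrow> g x = 0" using window_functionD(3)[OF g] by blast
  obtain B where B: "0 \<le> B" "\<And>y. y \<le> A \<Longrightarrow> g y \<le> B" using window_functionD(4)[OF g, of A] by blast
  define T where "T = max \<bar>A\<bar> \<bar>c\<bar> + 1"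
  obtain K where K: "0 \<le> K" "eventually (\<lambda>x. measure \<sigma> {x - T<..x + T} \<le> K * p x) at_top"
    using \<sigma>(2) unfolding locally_dominated_def by blast
  show ?thesis
    using K(2) eventually_ge_at_top[of "B * K / \<epsilon>"]
  proof eventually_elim
    case (elim x)
    have x: "B * K \<le> \<epsilon> * x" using elim(2) \<epsilon> by (simp add: divide_le_eq mult.commute)
    have "(\<integral>\<^sup>+v. ennreal (g (x - v)) * indicator {x - A<..} v \<partial>\<sigma>) \<le> (\<integral>\<^sup>+v. ennreal B * indicator {x - T<..x + T} v \<partial>\<sigma>)"
    proof (rule nn_integral_mono)
      fix v
      show "ennreal (g (x - v)) * indicator {x - A<..} v \<le> ennreal B * indicator {x - T<..x + T} v"
      proof (cases "x - A < v \<and> v \<le> x - c")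
        case True
        then have "v \<in> {x - T<..x + T}" by (auto simp: T_def)
        then show ?thesis using True B(2)[of "x - v"] by (auto intro!: ennreal_leI)
      next
        case False
        then show ?thesis using c[of "x - v"] by (cases "x - A < v") auto
      qed
    qed
    also have "\<dots> = ennreal (B * measure \<sigma> {x - T<..x + T})"
      using B(1) by (subst nn_integral_cmult_indicator) (auto simp: \<sigma>.emeasure_eq_measure ennreal_mult)
    also have "\<dots> \<le> ennreal (\<epsilon> * (x * p x))"
    proof (rule ennreal_leI)
      have "B * measure \<sigma> {x - T<..x + T} \<le> B * (K * p x)" by (intro mult_left_mono elim(1) B)
      also have "\<dots> \<le> (\<epsilon> * x) * p x"
        using mult_right_mono[OF x long_tailedD(2)[OF p, of x]] by (simp add: mult.assoc)
      finally show "B * measure \<sigma> {x - T<..x + T} \<le> \<epsilon> * (x * p x)" by (simp add: mult.assoc)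
    qed
    finally show ?case .
  qed
qed

lemma average_middle_part:
  assumes p: "p \<in> subexp_densities" "\<forall>x<0. p x = 0"
    and \<sigma>: "real_distribution \<sigma>" "locally_dominated \<sigma> p"
    and g: "g \<in> borel_measurable borel" and U: "0 \<le> U" "eventually (\<lambda>y. g y \<le> U * (y * p y)) at_top" and \<epsilon>: "0 < \<epsilon>"
  shows "\<exists>A\<ge>0. eventually (\<lambda>x. (\<integral>\<^sup>+v. ennreal (g (x - v)) * indicator {A<..x - A} v \<partial>\<sigma>) \<le> ennreal (\<epsilon> * (x * p x))) at_top"
proof -
  note SE = subexp_densitiesD[OF p(1)]
  have [measurable]: "p \<in> borel_measurable borel" and p0: "\<And>x. 0 \<le> p x"
    using SE(2) by (auto simp: prob_density_def)
  note [measurable] = g and [measurable_cong] = real_distributionD(4)[OF \<sigma>(1)]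
  interpret \<sigma>: real_distribution \<sigma> by fact
  obtain K where K: "0 \<le> K" "eventually (\<lambda>x. measure \<sigma> {x - 1<..x + 1} \<le> K * p x) at_top"
    using \<sigma>(2) unfolding locally_dominated_def by blast
  define d where "d = (U + 1) * (2 * K + 1)"
  define \<epsilon>' where "\<epsilon>' = \<epsilon> / d"
  have d: "0 < d" "U * (2 * K) \<le> d"
    using U(1) K(1) mult_mono[of U "U + 1" "2 * K" "2 * K + 1"] by (auto simp: d_def intro!: mult_pos_pos)
  have \<epsilon>': "0 < \<epsilon>'" "U * (2 * K * \<epsilon>') \<le> \<epsilon>"
  proof -
    show "0 < \<epsilon>'" using \<epsilon> d by (simp add: \<epsilon>'_def)
    then have "(U * (2 * K)) * \<epsilon>' \<le> d * \<epsilon>'" using d by (intro mult_right_mono) auto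
    then show "U * (2 * K * \<epsilon>') \<le> \<epsilon>" using d by (simp add: \<epsilon>'_def mult.assoc)
  qed
  obtain A0 where A0: "\<And>A'. A0 \<le> A' \<Longrightarrow> eventually (\<lambda>x.
      (\<integral>\<^sup>+t. ennreal (p (x - t) * p t) * indicator {A'..x - A'} t \<partial>lborel) \<le> ennreal (\<epsilon>' * p x)) at_top"
    using subexp_middle_negligible[OF p \<epsilon>'(1)] by blast
  have half: "(0::real) < 1/2" by simp
  obtain a1 where a1: "\<And>y. a1 \<le> y \<Longrightarrow> g y \<le> U * (y * p y)"
    using U(2) unfolding eventually_at_top_linorder by blast
  obtain a2 where a2: "\<And>y. a2 \<le> y \<Longrightarrow> measure \<sigma> {y - 1<..y + 1} \<le> K * p y"
    using K(2) unfolding eventually_at_top_linorder by blast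
  obtain a3 where a3: "\<And>y a. a3 \<le> y \<Longrightarrow> \<bar>a\<bar> \<le> 1 \<Longrightarrow> 0 < p (y + a) \<and> \<bar>p (y + a) - p y\<bar> \<le> (1/2) * p y"
    using long_tailed_uniform[OF SE(1) half, of 1] unfolding eventually_at_top_linorder by blast
  define A where "A = max (A0 + 1) (max 1 (max a1 (max (a2 + 1) a3)))"
  have A: "A0 \<le> A - 1" "1 \<le> A" "a1 \<le> A" "a2 \<le> A - 1" "a3 \<le> A" by (auto simp: A_def)
  have "eventually (\<lambda>x. (\<integral>\<^sup>+v. ennreal (g (x - v)) * indicator {A<..x - A} v \<partial>\<sigma>) \<le> ennreal (\<epsilon> * (x * p x))) at_top"
    using A0[OF A(1)] eventually_ge_at_top[of 0]
  proof eventually_elim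
    case (elim x)
    have "(\<integral>\<^sup>+v. ennreal (g (x - v)) * indicator {A<..x - A} v \<partial>\<sigma>)
        \<le> (\<integral>\<^sup>+t. ennreal (U * x * (2 * p (x - t))) * emeasure \<sigma> {t<..t + 1} * indicator {A - 1..x - A} t \<partial>lborel)"
    proof (rule nn_integral_le_window_density)
      fix v t assume vt: "A < v" "v \<le> x - A" "v - 1 \<le> t" "t < v"
      have "\<bar>p (x - t) - p (x - v)\<bar> \<le> (1/2) * p (x - v)" using a3[of "x - v" "v - t"] vt A by simp
      then have "(x - v) * p (x - v) \<le> x * (2 * p (x - t))"
        using vt A p0 elim(2) by (intro mult_mono) (linarith | simp)+
      then have "g (x - v) \<le> U * (x * (2 * p (x - t)))"
        using a1[of "x - v"] vt A mult_left_mono[OF _ U(1)] by (force intro: order_trans)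
      then show "ennreal (g (x - v)) \<le> ennreal (U * x * (2 * p (x - t)))" by (intro ennreal_leI) (simp add: mult.assoc)
    qed (auto intro: real_distributionD[OF \<sigma>(1)])
    also have "\<dots> \<le> (\<integral>\<^sup>+t. ennreal (U * x * (2 * K)) * (ennreal (p (x - t) * p t) * indicator {A - 1..x - (A - 1)} t) \<partial>lborel)"
    proof (rule nn_integral_mono)
      fix t
      have "ennreal (U * x * (2 * p (x - t))) * emeasure \<sigma> {t<..t + 1} \<le> ennreal (U * x * (2 * K)) * ennreal (p (x - t) * p t)"
        if "t \<in> {A - 1..x - A}"
      proof -
        have "measure \<sigma> {t<..t + 1} \<le> measure \<sigma> {t - 1<..t + 1}" by (rule \<sigma>.finite_measure_mono) auto
        also have "\<dots> \<le> K * p t" using a2 A that by auto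
        finally have "U * x * (2 * p (x - t)) * measure \<sigma> {t<..t + 1} \<le> U * x * (2 * p (x - t)) * (K * p t)"
          using U(1) elim(2) by (intro mult_left_mono) (auto simp: p0)
        then show ?thesis
          using K(1) U(1) elim(2) by (simp add: \<sigma>.emeasure_eq_measure ennreal_mult[symmetric] p0 ennreal_leI mult_ac)
      qed
      then show "ennreal (U * x * (2 * p (x - t))) * emeasure \<sigma> {t<..t + 1} * indicator {A - 1..x - A} t
          \<le> ennreal (U * x * (2 * K)) * (ennreal (p (x - t) * p t) * indicator {A - 1..x - (A - 1)} t)"
        by (auto simp: indicator_def)
    qed
    also have "\<dots> = ennreal (U * x * (2 * K)) * (\<integral>\<^sup>+t. ennreal (p (x - t) * p t) * indicator {A - 1..x - (A - 1)} t \<partial>lborel)"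
      by (rule nn_integral_cmult) measurable
    also have "\<dots> \<le> ennreal (U * x * (2 * K)) * ennreal (\<epsilon>' * p x)"
      by (intro mult_left_mono elim(1)) auto
    also have "\<dots> = ennreal ((U * (2 * K * \<epsilon>')) * (x * p x))"
      using U(1) elim(2) K(1) \<epsilon>'(1) p0 by (simp add: ennreal_mult[symmetric] mult_ac)
    also have "\<dots> \<le> ennreal (\<epsilon> * (x * p x))" using \<epsilon>'(2) elim(2) p0 by (intro ennreal_leI mult_right_mono) auto
    finally show ?case .
  qed
  then show ?thesis using A(2) by (intro exI[of _ A]) auto
qed

lemma average_upper:
  assumes p: "p \<in> subexp_densities" "\<forall>x<0. p x = 0"
    and \<sigma>: "real_distribution \<sigma>" "emeasure \<sigma> {..<0} = 0" "locally_dominated \<sigma> p"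
    and g: "window_function g" and U: "0 \<le> U" "eventually (\<lambda>y. g y \<le> U * (y * p y)) at_top"
    and S: "S \<in> sets borel" and \<epsilon>: "0 < \<epsilon>"
  shows "eventually (\<lambda>x. (\<integral>\<^sup>+v. ennreal (g (x - v)) * indicator S v \<partial>\<sigma>)
    \<le> ennreal ((U * measure \<sigma> S + \<epsilon>) * (x * p x))) at_top"
proof -
  note SE = subexp_densitiesD[OF p(1)]
  note [measurable] = window_functionD(1)[OF g] S and [measurable_cong] = real_distributionD(4)[OF \<sigma>(1)]
  interpret \<sigma>: real_distribution \<sigma> by fact
  have e: "0 < \<epsilon> / 3" using \<epsilon> by simp
  obtain A where A: "0 \<le> A"
    "eventually (\<lambda>x. (\<integral>\<^sup>+v. ennreal (g (x - v)) * indicator {A<..x - A} v \<partial>\<sigma>) \<le> ennreal (\<epsilon> / 3 * (x * p x))) at_top"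
    using average_middle_part[OF p \<sigma>(1,3) window_functionD(1)[OF g] U e] by blast
  show ?thesis
    using average_near_part[OF SE(1) U e, of A] A(2) average_far_part[OF SE(1) \<sigma>(1,3) g e, of A] eventually_ge_at_top[of 0]
  proof eventually_elim
    case (elim x)
    define r where "r = x * p x"
    have r: "0 \<le> r" using elim(4) long_tailedD(2)[OF SE(1)] by (simp add: r_def)
    let ?g = "\<lambda>v. ennreal (g (x - v))"
    have "(\<integral>\<^sup>+v. ?g v * indicator S v \<partial>\<sigma>) \<le> (\<integral>\<^sup>+v. ennreal ((U + \<epsilon> / 3) * r) * indicator S v
        + ?g v * indicator {A<..x - A} v + ?g v * indicator {x - A<..} v \<partial>\<sigma>)"
    proof (rule nn_integral_mono_AE, use AE_nonneg[OF real_distributionD(4)[OF \<sigma>(1)] \<sigma>(2)] in eventually_elim)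
      fix v :: real assume "0 \<le> v"
      then consider "v \<in> {0..A}" | "v \<in> {A<..x - A}" | "v \<in> {x - A<..}" by force
      then show "?g v * indicator S v \<le> ennreal ((U + \<epsilon> / 3) * r) * indicator S v
          + ?g v * indicator {A<..x - A} v + ?g v * indicator {x - A<..} v"
      proof cases
        case 1
        then have "?g v * indicator S v \<le> ennreal ((U + \<epsilon> / 3) * r) * indicator S v"
          using elim(1) unfolding r_def by (intro mult_right_mono ennreal_leI) auto
        then show ?thesis by (simp add: add_increasing2 add.assoc)
      qed (auto simp: indicator_def add_increasing add_increasing2)
    qed
    also have "\<dots> = ennreal ((U + \<epsilon> / 3) * r) * ennreal (measure \<sigma> S)
        + (\<integral>\<^sup>+v. ?g v * indicator {A<..x - A} v \<partial>\<sigma>) + (\<integral>\<^sup>+v. ?g v * indicator {x - A<..} v \<partial>\<sigma>)"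
      by (subst nn_integral_add, measurable, subst nn_integral_add, measurable)
         (simp add: nn_integral_cmult_indicator \<sigma>.emeasure_eq_measure)
    also have "\<dots> \<le> ennreal ((U + \<epsilon> / 3) * r) * ennreal (measure \<sigma> S) + ennreal (\<epsilon> / 3 * r) + ennreal (\<epsilon> / 3 * r)"
      using elim(2,3) unfolding r_def by (intro add_mono) auto
    also have "\<dots> = ennreal ((U + \<epsilon> / 3) * r * measure \<sigma> S + \<epsilon> / 3 * r + \<epsilon> / 3 * r)"
      using r U(1) \<epsilon> by (simp add: ennreal_mult[symmetric] ennreal_plus[symmetric] del: ennreal_plus)
    also have "\<dots> \<le> ennreal ((U * measure \<sigma> S + \<epsilon>) * r)"
    proof (rule ennreal_leI)
      have "\<epsilon> / 3 * r * measure \<sigma> S \<le> \<epsilon> / 3 * r * 1" using r \<epsilon> by (intro mult_left_mono) auto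
      then show "(U + \<epsilon> / 3) * r * measure \<sigma> S + \<epsilon> / 3 * r + \<epsilon> / 3 * r \<le> (U * measure \<sigma> S + \<epsilon>) * r"
        by (simp add: algebra_simps)
    qed
    finally show ?case unfolding r_def .
  qed
qed

text \<open>
  Only the range near \<open>0\<close>, which carries almost all of the mass of \<open>\<sigma>\<close>, is needed for a lower bound.
\<close>

lemma average_lower:
  assumes p: "p \<in> long_tailed"
    and \<sigma>: "real_distribution \<sigma>" "emeasure \<sigma> {..<0} = 0"
    and L: "0 \<le> L" "eventually (\<lambda>y. L * (y * p y) \<le> g y) at_top"
    and S: "S \<in> sets borel" and \<epsilon>: "0 < \<epsilon>"
  shows "eventually (\<lambda>x. ennreal ((L * measure \<sigma> S - \<epsilon>) * (x * p x))
    \<le> (\<integral>\<^sup>+v. ennreal (g (x - v)) * indicator S v \<partial>\<sigma>)) at_top"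
proof -
  note [measurable_cong] = real_distributionD(4)[OF \<sigma>(1)] and [measurable] = S
  interpret \<sigma>: real_distribution \<sigma> by fact
  define \<eta> where "\<eta> = min (1/2) (\<epsilon> / (3 * (L + 1)))"
  have \<eta>: "0 < \<eta>" "\<eta> \<le> 1/2" "3 * (L * \<eta>) \<le> \<epsilon>"
  proof -
    show "0 < \<eta>" using \<epsilon> L(1) by (auto simp: \<eta>_def)
    show "\<eta> \<le> 1/2" unfolding \<eta>_def by (rule min.cobounded1)
    have "3 * (L * \<eta>) \<le> 3 * (L * (\<epsilon> / (3 * (L + 1))))" using L(1) by (intro mult_left_mono) (auto simp: \<eta>_def)
    also have "\<dots> \<le> \<epsilon>" using L(1) \<epsilon> by (simp add: field_simps)
    finally show "3 * (L * \<eta>) \<le> \<epsilon>" .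
  qed
  obtain Y where Y: "\<And>y. Y \<le> y \<Longrightarrow> L * (y * p y) \<le> g y" using L(2) by (auto simp: eventually_at_top_linorder)
  have "eventually (\<lambda>A. 0 \<le> A \<and> measure \<sigma> {A<..} \<le> \<eta>) at_top"
    by (intro eventually_conj eventually_ge_at_top tail_le \<sigma> \<eta>)
  then obtain A where A: "0 \<le> A" "measure \<sigma> {A<..} \<le> \<eta>" by (auto simp: eventually_at_top_linorder)
  define s where "s = measure \<sigma> (S \<inter> {0..A})"
  have s: "measure \<sigma> S - \<eta> \<le> s" "0 \<le> s" "s \<le> 1"
  proof -
    have "measure \<sigma> S \<le> measure \<sigma> ((S \<inter> {0..A}) \<union> ({A<..} \<union> {..<0}))"
      by (rule \<sigma>.finite_measure_mono) auto
    also have "\<dots> \<le> s + measure \<sigma> ({A<..} \<union> {..<0})"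
      unfolding s_def by (rule measure_Un_le) auto
    also have "measure \<sigma> ({A<..} \<union> {..<0}) \<le> measure \<sigma> {A<..} + measure \<sigma> {..<0}"
      by (rule measure_Un_le) auto
    also have "measure \<sigma> {..<0} = 0" using \<sigma>(2) by (simp add: measure_def)
    finally show "measure \<sigma> S - \<eta> \<le> s" using A by simp
  qed (auto simp: s_def)
  show ?thesis
    using long_tailed_uniform[OF p \<eta>(1), of A] eventually_ge_at_top[of "max 1 (max (Y + A) (A / \<eta>))"]
  proof eventually_elim
    case (elim x)
    have px: "0 < p x" using elim(1)[rule_format, of 0] A by simp
    have x: "1 \<le> x" "Y + A \<le> x" "A \<le> \<eta> * x" using elim(2) \<eta> by (auto simp: field_simps)
    have "\<eta> * x \<le> 1 * x" using \<eta> x by (intro mult_right_mono) auto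
    with x(3) have Ax: "A \<le> x" by linarith
    define a where "a = L * (((1 - \<eta>) * x) * ((1 - \<eta>) * p x))"
    have a0: "0 \<le> a" using L \<eta> x px by (auto simp: a_def)
    have "(L * measure \<sigma> S - \<epsilon>) * (x * p x) \<le> a * s"
    proof -
      have sq: "1 - 2 * \<eta> \<le> (1 - \<eta>) * (1 - \<eta>)" by (simp add: algebra_simps)
      have "L * measure \<sigma> S - \<epsilon> \<le> L * (s + \<eta>) - 3 * (L * \<eta>)"
        using s(1) \<eta>(3) L(1) by (intro diff_mono mult_left_mono) auto
      also have "\<dots> \<le> L * (s * (1 - 2 * \<eta>))"
      proof -
        have "L * (2 * \<eta> * s) \<le> L * (2 * \<eta> * 1)" using s(3) \<eta> L(1) by (intro mult_left_mono) auto
        then show ?thesis by (simp add: algebra_simps)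
      qed
      also have "\<dots> \<le> L * (s * ((1 - \<eta>) * (1 - \<eta>)))" using L(1) s(2) sq by (intro mult_left_mono)
      finally have "(L * measure \<sigma> S - \<epsilon>) * (x * p x) \<le> L * (s * ((1 - \<eta>) * (1 - \<eta>))) * (x * p x)"
        using x px by (intro mult_right_mono) auto
      then show ?thesis by (simp add: a_def mult_ac)
    qed
    then have "ennreal ((L * measure \<sigma> S - \<epsilon>) * (x * p x)) \<le> ennreal (a * s)" by (rule ennreal_leI)
    also have "\<dots> = ennreal a * emeasure \<sigma> (S \<inter> {0..A})"
      using a0 s by (simp add: ennreal_mult s_def \<sigma>.emeasure_eq_measure)
    also have "\<dots> = (\<integral>\<^sup>+v. ennreal a * indicator (S \<inter> {0..A}) v \<partial>\<sigma>)"
      by (rule nn_integral_cmult_indicator[symmetric]) simp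
    also have "\<dots> \<le> (\<integral>\<^sup>+v. ennreal (g (x - v)) * indicator S v \<partial>\<sigma>)"
    proof (rule nn_integral_mono)
      fix v
      have "a \<le> g (x - v)" if v: "0 \<le> v" "v \<le> A"
      proof -
        have "a \<le> L * ((x - v) * p (x - v))"
          unfolding a_def
        proof (intro mult_left_mono mult_mono)
          show "(1 - \<eta>) * x \<le> x - v" using v x(3) by (simp add: algebra_simps)
          show "(1 - \<eta>) * p x \<le> p (x - v)"
            using elim(1)[rule_format, of "- v"] v by (simp add: abs_le_iff algebra_simps)
          show "0 \<le> x - v" using v Ax by simp
          show "0 \<le> (1 - \<eta>) * p x" using px \<eta> by simp
          show "0 \<le> L" by (rule L)
        qed
        also have "\<dots> \<le> g (x - v)" using v x by (intro Y) auto
        finally show ?thesis .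
      qed
      then show "ennreal a * indicator (S \<inter> {0..A}) v \<le> ennreal (g (x - v)) * indicator S v"
        by (auto simp: indicator_def intro!: ennreal_leI)
    qed
    finally show ?case .
  qed
qed

text \<open>
  If a measure has window masses asymptotic to \<open>c w(x)\<close>, then the measure weighted by \<open>x\<close> has window
  masses asymptotic to \<open>c x w(x)\<close>. All functions averaged below are compared on this scale.
\<close>

definition size_bias_asymp :: "(real \<Rightarrow> real) \<Rightarrow> (real \<Rightarrow> real) \<Rightarrow> real \<Rightarrow> bool" where
  "size_bias_asymp w g c \<longleftrightarrow>
     (\<forall>\<epsilon>>0. eventually (\<lambda>x. \<bar>g x - c * (x * w x)\<bar> \<le> \<epsilon> * (x * w x)) at_top)"

lemma size_bias_asympD:
  assumes "size_bias_asymp w g c" "0 < \<epsilon>"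
  shows "eventually (\<lambda>x. (c - \<epsilon>) * (x * w x) \<le> g x \<and> g x \<le> (c + \<epsilon>) * (x * w x)) at_top"
  using assms(1)[unfolded size_bias_asymp_def, rule_format, OF assms(2)]
  by eventually_elim (simp add: abs_le_iff algebra_simps)

lemma size_bias_asympI:
  assumes "\<And>\<epsilon>. 0 < \<epsilon> \<Longrightarrow> eventually (\<lambda>x. (c - \<epsilon>) * (x * w x) \<le> g x \<and> g x \<le> (c + \<epsilon>) * (x * w x)) at_top"
  shows "size_bias_asymp w g c"
  unfolding size_bias_asymp_def
proof (intro allI impI)
  fix \<epsilon> :: real assume "0 < \<epsilon>"
  from assms[OF this] show "eventually (\<lambda>x. \<bar>g x - c * (x * w x)\<bar> \<le> \<epsilon> * (x * w x)) at_top"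
    by eventually_elim (simp add: abs_le_iff algebra_simps)
qed

lemma size_bias_asymp_of_windows:
  assumes m: "tail_equiv m (\<lambda>x. c * w x)" and c: "0 < c" "0 \<le> b"
    and g: "eventually (\<lambda>x. x * m x \<le> g x \<and> g x \<le> (x + b) * m x) at_top"
  shows "size_bias_asymp w g c"
proof (rule size_bias_asympI)
  fix \<epsilon> :: real assume \<epsilon>: "0 < \<epsilon>"
  define \<eta> where "\<eta> = min 1 (\<epsilon> / (3 * c))"
  have \<eta>: "0 < \<eta>" "\<eta> \<le> 1" "3 * (c * \<eta>) \<le> \<epsilon>"
  proof -
    show "0 < \<eta>" "\<eta> \<le> 1" using \<epsilon> c by (auto simp: \<eta>_def)
    have "c * \<eta> \<le> c * (\<epsilon> / (3 * c))" using c by (intro mult_left_mono) (auto simp: \<eta>_def)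
    then show "3 * (c * \<eta>) \<le> \<epsilon>" using c by simp
  qed
  show "eventually (\<lambda>x. (c - \<epsilon>) * (x * w x) \<le> g x \<and> g x \<le> (c + \<epsilon>) * (x * w x)) at_top"
    using tail_equivD[OF m \<eta>(1)] g eventually_ge_at_top[of "max 0 (b / \<eta>)"]
  proof eventually_elim
    case (elim x)
    have x: "0 \<le> x" "b \<le> \<eta> * x" using elim(3) \<eta> by (auto simp: divide_le_eq mult.commute)
    have w: "0 < w x" using elim(1) c by (simp add: zero_less_mult_iff)
    have mx: "(1 - \<eta>) * (c * w x) \<le> m x" "m x \<le> (1 + \<eta>) * (c * w x)"
      using elim(1) by (auto simp: abs_le_iff algebra_simps)
    have r: "0 \<le> x * w x" using x w by simp
    have "(x + b) * m x \<le> ((1 + \<eta>) * x) * ((1 + \<eta>) * (c * w x))"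
      using x mx \<eta> elim(1) c by (intro mult_mono) (auto simp: algebra_simps)
    also have "\<dots> = (c + (2 + \<eta>) * (c * \<eta>)) * (x * w x)" by (simp add: algebra_simps)
    also have "\<dots> \<le> (c + \<epsilon>) * (x * w x)"
    proof (intro mult_right_mono r)
      have "(2 + \<eta>) * (c * \<eta>) \<le> 3 * (c * \<eta>)" using \<eta> c by (intro mult_right_mono) auto
      then show "c + (2 + \<eta>) * (c * \<eta>) \<le> c + \<epsilon>" using \<eta>(3) by simp
    qed
    finally have up: "g x \<le> (c + \<epsilon>) * (x * w x)" using elim(2) by simp
    have "(c - \<epsilon>) * (x * w x) \<le> (c - c * \<eta>) * (x * w x)"
    proof (intro mult_right_mono r)
      have "0 < c * \<eta>" using c \<eta> by simp
      then show "c - \<epsilon> \<le> c - c * \<eta>" using \<eta>(3) by linarith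
    qed
    also have "\<dots> = x * ((1 - \<eta>) * (c * w x))" by (simp add: algebra_simps)
    also have "\<dots> \<le> x * m x" using x mx by (intro mult_left_mono) auto
    finally show ?case using up elim(2) by simp
  qed
qed

lemma windows_of_size_bias_asymp:
  assumes g: "size_bias_asymp w g c" and c: "0 < c" "0 \<le> b" and w: "eventually (\<lambda>x. 0 < w x) at_top"
    and m: "\<And>x. 0 \<le> m x" "eventually (\<lambda>x. x * m x \<le> g x \<and> g x \<le> (x + b) * m x) at_top"
  shows "tail_equiv m (\<lambda>x. c * w x)"
proof (rule tail_equivI_ratio)
  show "eventually (\<lambda>x. 0 < c * w x) at_top" using w by eventually_elim (use c in simp)
  fix \<epsilon> :: real assume \<epsilon>: "0 < \<epsilon>"
  define e where "e = \<epsilon> / 2"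
  have e: "0 < e" "0 < c * e" using \<epsilon> c by (auto simp: e_def)
  show "eventually (\<lambda>x. \<bar>m x - c * w x\<bar> \<le> \<epsilon> * (c * w x)) at_top"
    using size_bias_asympD[OF g e(2)] m(2) w eventually_ge_at_top[of "max 1 (b / e)"]
  proof eventually_elim
    case (elim x)
    have x: "1 \<le> x" "b \<le> e * x" using elim(4) e by (auto simp: divide_le_eq mult.commute)
    define k where "k = c * w x"
    have k: "0 < k" using elim(3) c by (simp add: k_def)
    have "x * m x \<le> x * ((1 + e) * k)" using elim(1,2) by (simp add: k_def algebra_simps)
    then have up: "m x \<le> (1 + e) * k" using x by simp
    have "x * ((1 - e) * k) \<le> (x + b) * m x" using elim(1,2) by (simp add: k_def algebra_simps)
    also have "\<dots> \<le> (x + e * x) * m x" using x m(1) by (intro mult_right_mono) auto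
    also have "\<dots> = x * (m x + e * m x)" by (simp add: algebra_simps)
    finally have low: "(1 - e) * k \<le> m x + e * m x" using x by simp
    have ek: "0 \<le> \<epsilon> * k" using \<epsilon> k by simp
    have "k - m x \<le> \<epsilon> * k"
    proof (cases "m x \<le> k")
      case True
      then have "e * m x \<le> e * k" using e by (intro mult_left_mono) auto
      then show ?thesis using low by (simp add: e_def algebra_simps)
    qed (use ek in simp)
    moreover have "m x - k \<le> \<epsilon> * k" using up ek by (simp add: e_def algebra_simps)
    ultimately show ?case by (simp add: k_def abs_le_iff)
  qed
qed

lemma size_bias_asymp_average:
  assumes p: "p \<in> subexp_densities" "\<forall>x<0. p x = 0"
    and \<sigma>: "real_distribution \<sigma>" "emeasure \<sigma> {..<0} = 0" "locally_dominated \<sigma> p"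
    and g: "window_function g" and c: "0 < c" "size_bias_asymp p g c"
  shows "size_bias_asymp p (average \<sigma> g) c"
proof (rule size_bias_asympI)
  fix \<epsilon> :: real assume \<epsilon>: "0 < \<epsilon>"
  note SE = subexp_densitiesD[OF p(1)]
  interpret \<sigma>: real_distribution \<sigma> by fact
  define e where "e = min (\<epsilon> / 2) c"
  have e: "0 < e" "0 \<le> c + e" "0 \<le> c - e" "e \<le> \<epsilon> / 2" using \<epsilon> c by (auto simp: e_def)
  note bounds = size_bias_asympD[OF c(2) e(1)]
  have up: "eventually (\<lambda>y. g y \<le> (c + e) * (y * p y)) at_top"
    and low: "eventually (\<lambda>y. (c - e) * (y * p y) \<le> g y) at_top"
    using bounds by (auto elim: eventually_mono)
  have S: "UNIV \<in> sets (borel :: real measure)" by simp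
  have P1: "\<sigma>.prob UNIV = 1" using \<sigma>.prob_space by simp
  show "eventually (\<lambda>x. (c - \<epsilon>) * (x * p x) \<le> average \<sigma> g x \<and> average \<sigma> g x \<le> (c + \<epsilon>) * (x * p x)) at_top"
    using average_upper[OF p \<sigma> g e(2) up S e(1)] average_lower[OF SE(1) \<sigma>(1,2) e(3) low S e(1)] eventually_ge_at_top[of 0]
  proof eventually_elim
    case (elim x)
    have r: "0 \<le> x * p x" using elim(3) long_tailedD(2)[OF SE(1)] by simp
    have a: "(\<integral>\<^sup>+v. ennreal (g (x - v)) * indicator UNIV v \<partial>\<sigma>) = ennreal (average \<sigma> g x)"
      using ennreal_average[OF g \<sigma>(1,2)] by simp
    have "average \<sigma> g x \<le> (c + e + e) * (x * p x)"
      using elim(1) r e unfolding a P1 by (subst (asm) ennreal_le_iff) auto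
    also have "\<dots> \<le> (c + \<epsilon>) * (x * p x)" using e r by (intro mult_right_mono) auto
    finally have "average \<sigma> g x \<le> (c + \<epsilon>) * (x * p x)" .
    moreover have "(c - \<epsilon>) * (x * p x) \<le> (c - e - e) * (x * p x)" using e r by (intro mult_right_mono) auto
    moreover have "(c - e - e) * (x * p x) \<le> average \<sigma> g x"
      using elim(2) average_nonneg[OF g] unfolding a P1 by (simp add: ennreal_le_iff)
    ultimately show ?case by linarith
  qed
qed

lemma locally_dominated_of_windows:
  assumes p: "p \<in> long_tailed" and k: "0 < k"
    and win: "\<And>c. 0 < c \<Longrightarrow> tail_equiv (\<lambda>x. measure \<sigma> {x<..x + c}) (\<lambda>x. c * k * p x)"
  shows "locally_dominated \<sigma> p"
  unfolding locally_dominated_def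
proof
  fix T :: real
  show "\<exists>K\<ge>0. eventually (\<lambda>x. measure \<sigma> {x - T<..x + T} \<le> K * p x) at_top"
  proof (cases "0 < T")
    case True
    then have T: "0 < 2 * T" by simp
    have "eventually (\<lambda>x. measure \<sigma> {x - T<..x + T} \<le> (8 * T * k) * p x) at_top"
      using eventually_shift[OF tail_equivD[OF win[OF T] zero_less_one], of "- T"]
        long_tailed_uniform[OF p zero_less_one, of T]
    proof eventually_elim
      case (elim x)
      have "{x - T<..x + T} = {x + - T<..x + - T + 2 * T}" by (simp add: add.commute)
      then have "measure \<sigma> {x - T<..x + T} = measure \<sigma> {x + - T<..x + - T + 2 * T}" by (simp only:)
      also have "\<dots> \<le> 2 * (2 * T * k * p (x + - T))" using elim(1) by linarith
      also have "\<dots> \<le> 2 * (2 * T * k * (2 * p x))"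
        using elim(2)[rule_format, of "- T"] T k by (intro mult_left_mono) (auto simp: abs_le_iff)
      finally show ?case by simp
    qed
    then show ?thesis using True k by (intro exI[of _ "8 * T * k"]) auto
  next
    case False
    then have "measure \<sigma> {x - T<..x + T} = 0" for x by simp
    then show ?thesis by (intro exI[of _ 0]) auto
  qed
qed

section \<open>Deconvolution\<close>

lemma contraction_to_zero:
  fixes Q :: "real \<Rightarrow> bool"
  assumes Q0: "Q D" "0 \<le> D" and mono: "\<And>D D'. Q D \<Longrightarrow> D \<le> D' \<Longrightarrow> Q D'"
    and step: "\<And>D \<epsilon>. Q D \<Longrightarrow> 0 \<le> D \<Longrightarrow> 0 < \<epsilon> \<Longrightarrow> Q (\<theta> * D + \<epsilon>)"
    and \<theta>: "0 \<le> \<theta>" "\<theta> < 1" and \<epsilon>: "0 < \<epsilon>"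
  shows "Q \<epsilon>"
proof -
  define \<eta> where "\<eta> = \<epsilon> * (1 - \<theta>) / 2"
  have \<eta>: "0 < \<eta>" using \<epsilon> \<theta> by (simp add: \<eta>_def)
  have "Q (\<theta> ^ n * D + \<epsilon> / 2)" for n
  proof (induction n)
    case 0
    show ?case using Q0 \<epsilon> by (intro mono[OF Q0(1)]) auto
  next
    case (Suc n)
    have "Q (\<theta> * (\<theta> ^ n * D + \<epsilon> / 2) + \<eta>)"
      using Q0 \<theta> \<epsilon> by (intro step[OF Suc] \<eta>) auto
    moreover have "\<theta> * (\<theta> ^ n * D + \<epsilon> / 2) + \<eta> = \<theta> ^ Suc n * D + \<epsilon> / 2"
      by (simp add: \<eta>_def field_simps)
    ultimately show ?case by simp
  qed
  note Qn = this
  have "(\<lambda>n. \<theta> ^ n * D) \<longlonglongrightarrow> 0"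
    using LIMSEQ_power_zero[of \<theta>] \<theta> by (intro tendsto_mult_left_zero) auto
  then have "eventually (\<lambda>n. \<theta> ^ n * D < \<epsilon> / 2) sequentially"
    by (rule order_tendstoD(2)) (use \<epsilon> in simp)
  then obtain n where "\<theta> ^ n * D < \<epsilon> / 2" unfolding eventually_sequentially by blast
  then show ?thesis by (intro mono[OF Qn[of n]]) simp
qed

text \<open>
  If \<open>\<sigma>\<close> has an atom of mass \<open>\<alpha> > 1/2\<close> at \<open>0\<close>, then \<open>\<alpha> g\<close> is the average of \<open>g\<close> minus the
  contribution of the remaining mass \<open>1 - \<alpha>\<close>. An asymptotic relative error \<open>D\<close> of \<open>g\<close> thereby
  improves to \<open>D (1 - \<alpha>) / \<alpha>\<close>.
\<close>

lemma deconvolve_heavy_atom: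
  assumes p: "p \<in> subexp_densities" "\<forall>x<0. p x = 0"
    and \<sigma>: "real_distribution \<sigma>" "emeasure \<sigma> {..<0} = 0" "locally_dominated \<sigma> p" "1 / 2 < measure \<sigma> {0}"
    and g: "window_function g" and c: "0 \<le> c" and avg: "size_bias_asymp p (average \<sigma> g) c"
  shows "size_bias_asymp p g c"
proof -
  interpret \<sigma>: real_distribution \<sigma> by fact
  note [measurable] = window_functionD(1)[OF g] and [measurable_cong] = real_distributionD(4)[OF \<sigma>(1)]
  note SE = subexp_densitiesD[OF p(1)]
  define \<alpha> where "\<alpha> = measure \<sigma> {0}"
  define R where "R x = enn2real (\<integral>\<^sup>+v. ennreal (g (x - v)) * indicator {0<..} v \<partial>\<sigma>)" for x
  have \<alpha>: "1 / 2 < \<alpha>" "\<alpha> \<le> 1" using \<sigma>(4) by (auto simp: \<alpha>_def)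
  have rest: "measure \<sigma> {0<..} = 1 - \<alpha>"
  proof -
    have "{0<..} = UNIV - ({0} \<union> {..<0::real})" by auto
    then have "measure \<sigma> {0<..} = 1 - measure \<sigma> ({0} \<union> {..<0})" using \<sigma>.prob_compl[of "{0} \<union> {..<0}"] by simp
    also have "measure \<sigma> ({0} \<union> {..<0}) = \<alpha>"
      using \<sigma>(2) by (subst \<sigma>.finite_measure_Union) (auto simp: \<alpha>_def measure_def)
    finally show ?thesis .
  qed
  have split: "ennreal (average \<sigma> g x) = ennreal (\<alpha> * g x) + (\<integral>\<^sup>+v. ennreal (g (x - v)) * indicator {0<..} v \<partial>\<sigma>)" for x
  proof -
    have "ennreal (average \<sigma> g x) = (\<integral>\<^sup>+v. ennreal (g x) * indicator {0} v + ennreal (g (x - v)) * indicator {0<..} v \<partial>\<sigma>)"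
      unfolding ennreal_average[OF g \<sigma>(1,2)]
      by (rule nn_integral_cong_AE)
         (use AE_nonneg[OF real_distributionD(4)[OF \<sigma>(1)] \<sigma>(2)] in \<open>auto elim!: eventually_mono simp: indicator_def\<close>)
    also have "\<dots> = ennreal (g x) * emeasure \<sigma> {0} + (\<integral>\<^sup>+v. ennreal (g (x - v)) * indicator {0<..} v \<partial>\<sigma>)"
      by (subst nn_integral_add) (auto simp: nn_integral_cmult_indicator)
    finally show ?thesis
      by (simp add: \<sigma>.emeasure_eq_measure \<alpha>_def ennreal_mult[symmetric] window_functionD(2)[OF g] mult.commute)
  qed
  have R: "(\<integral>\<^sup>+v. ennreal (g (x - v)) * indicator {0<..} v \<partial>\<sigma>) = ennreal (R x)" for x
  proof -
    have "(\<integral>\<^sup>+v. ennreal (g (x - v)) * indicator {0<..} v \<partial>\<sigma>) \<le> ennreal (average \<sigma> g x)"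
      unfolding split by simp
    then have "(\<integral>\<^sup>+v. ennreal (g (x - v)) * indicator {0<..} v \<partial>\<sigma>) < top"
      by (rule le_less_trans) simp
    then show ?thesis unfolding R_def by simp
  qed
  have R0: "0 \<le> R x" for x by (simp add: R_def)
  have avg_eq: "average \<sigma> g x = \<alpha> * g x + R x" for x
    using split[of x] \<alpha> R0[of x] window_functionD(2)[OF g, of x] unfolding R
    by (simp add: ennreal_plus[symmetric] average_nonneg[OF g] del: ennreal_plus)
  define Q where "Q D \<longleftrightarrow> eventually (\<lambda>x. (c - D) * (x * p x) \<le> g x \<and> g x \<le> (c + D) * (x * p x)) at_top" for D
  have pos: "eventually (\<lambda>x. 0 < x * p x) at_top"
    using long_tailedD(3)[OF SE(1)] eventually_gt_at_top[of 0] by eventually_elim simp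
  have mono: "Q D'" if "Q D" "D \<le> D'" for D D'
    using that(1) pos unfolding Q_def
  proof eventually_elim
    case (elim x)
    have "(c - D') * (x * p x) \<le> (c - D) * (x * p x)" "(c + D) * (x * p x) \<le> (c + D') * (x * p x)"
      using that(2) elim by (auto intro!: mult_right_mono)
    then show ?case using elim by linarith
  qed
  have start: "Q (2 * (c + 1))"
    using size_bias_asympD[OF avg zero_less_one] pos unfolding Q_def
  proof eventually_elim
    case (elim x)
    have "1/2 * g x \<le> \<alpha> * g x" using \<alpha> window_functionD(2)[OF g, of x] by (intro mult_right_mono) auto
    also have "\<dots> \<le> (c + 1) * (x * p x)" using elim R0[of x] by (simp add: avg_eq)
    finally have "g x \<le> (2 * (c + 1)) * (x * p x)" by (simp add: algebra_simps)
    moreover have "(2 * (c + 1)) * (x * p x) \<le> (c + 2 * (c + 1)) * (x * p x)" using elim c by (intro mult_right_mono) auto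
    moreover have "(c - 2 * (c + 1)) * (x * p x) \<le> 0" using elim c by (intro mult_nonpos_nonneg) auto
    ultimately show ?case using window_functionD(2)[OF g, of x] by linarith
  qed
  have step: "Q ((1 - \<alpha>) / \<alpha> * D + \<epsilon>)" if D: "Q D" "0 \<le> D" and \<epsilon>: "0 < \<epsilon>" for D \<epsilon>
  proof -
    have e4: "0 < \<epsilon> / 4" using \<epsilon> by simp
    have up: "eventually (\<lambda>y. g y \<le> (c + D) * (y * p y)) at_top"
      using D(1) unfolding Q_def by eventually_elim simp
    have low: "eventually (\<lambda>y. max 0 (c - D) * (y * p y) \<le> g y) at_top"
      using D(1) unfolding Q_def by eventually_elim (auto simp: max_def window_functionD(2)[OF g])
    have cD: "0 \<le> c + D" using c D by simp
    have S0: "{0<..} \<in> sets (borel :: real measure)" by simp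
    show ?thesis
      using average_upper[OF p \<sigma>(1-3) g cD up S0 e4, unfolded R rest]
        average_lower[OF SE(1) \<sigma>(1,2) max.cobounded1 low S0 e4, unfolded R rest]
        size_bias_asympD[OF avg e4] pos
      unfolding Q_def
    proof eventually_elim
      case (elim x)
      define w where "w = x * p x"
      have w: "0 < w" using elim by (simp add: w_def)
      have Rw: "R x \<le> ((c + D) * (1 - \<alpha>) + \<epsilon> / 4) * w"
        using elim(1) cD \<alpha> e4 w by (subst (asm) ennreal_le_iff) (auto simp: w_def)
      have "((c - D) * (1 - \<alpha>) - \<epsilon> / 4) * w \<le> (max 0 (c - D) * (1 - \<alpha>) - \<epsilon> / 4) * w"
        using \<alpha> w by (intro mult_right_mono diff_right_mono) auto
      also have "\<dots> \<le> R x" using elim(2) R0[of x] by (simp add: w_def ennreal_le_iff)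
      finally have wR: "((c - D) * (1 - \<alpha>) - \<epsilon> / 4) * w \<le> R x" .
      have \<alpha>w: "\<alpha> * (((1 - \<alpha>) / \<alpha> * D + \<epsilon>) * w) = ((1 - \<alpha>) * D + \<alpha> * \<epsilon>) * w" using \<alpha> by (simp add: field_simps)
      have \<epsilon>w: "\<epsilon> / 2 * w \<le> \<alpha> * \<epsilon> * w" using \<alpha> \<epsilon> w by (intro mult_right_mono) auto
      have "\<alpha> * g x \<le> (c + \<epsilon> / 4) * w - R x" "(c - \<epsilon> / 4) * w - R x \<le> \<alpha> * g x"
        using elim(3) by (auto simp: avg_eq w_def)
      then have "\<alpha> * g x \<le> \<alpha> * (c * w) + \<alpha> * (((1 - \<alpha>) / \<alpha> * D + \<epsilon>) * w)"
          "\<alpha> * (c * w) - \<alpha> * (((1 - \<alpha>) / \<alpha> * D + \<epsilon>) * w) \<le> \<alpha> * g x"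
        using Rw wR \<epsilon>w unfolding \<alpha>w by (auto simp: algebra_simps)
      then have "\<alpha> * g x \<le> \<alpha> * ((c + ((1 - \<alpha>) / \<alpha> * D + \<epsilon>)) * w)"
          "\<alpha> * ((c - ((1 - \<alpha>) / \<alpha> * D + \<epsilon>)) * w) \<le> \<alpha> * g x"
        by (simp_all only: distrib_left[symmetric] distrib_right[symmetric] right_diff_distrib[symmetric] left_diff_distrib[symmetric])
      then show ?case using \<alpha> unfolding w_def[symmetric] by (simp only: mult_le_cancel_left_pos)
    qed
  qed
  show ?thesis
  proof (rule size_bias_asympI)
    fix \<epsilon> :: real assume "0 < \<epsilon>"
    have "Q \<epsilon>"
    proof (rule contraction_to_zero[of Q "2 * (c + 1)" "(1 - \<alpha>) / \<alpha>"])
      show "0 \<le> 2 * (c + 1)" "0 \<le> (1 - \<alpha>) / \<alpha>" "(1 - \<alpha>) / \<alpha> < 1" using c \<alpha> by auto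
      show "Q D'" if "Q D" "D \<le> D'" for D D' using that by (rule mono)
      show "Q ((1 - \<alpha>) / \<alpha> * D + e)" if "Q D" "0 \<le> D" "0 < e" for D e using that by (rule step)
    qed fact+
    then show "eventually (\<lambda>x. (c - \<epsilon>) * (x * p x) \<le> g x \<and> g x \<le> (c + \<epsilon>) * (x * p x)) at_top" by (simp add: Q_def)
  qed
qed

lemma deconvolve_conv_power:
  assumes p: "p \<in> subexp_densities" "\<forall>x<0. p x = 0"
    and \<sigma>: "real_distribution \<sigma>" "emeasure \<sigma> {..<0} = 0" "locally_dominated \<sigma> p" "1 / 2 < measure \<sigma> {0}"
    and g: "window_function g" and c: "0 \<le> c" and avg: "size_bias_asymp p (average (conv_power \<sigma> n) g) c"
  shows "size_bias_asymp p g c"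
  using avg
proof (induction n)
  case 0
  then show ?case by (simp add: average_return[OF g])
next
  case (Suc n)
  note P = real_distribution_conv_power[OF \<sigma>(1)] conv_power_nonneg[OF \<sigma>(1,2)]
  have "average (conv_power \<sigma> (Suc n)) g = average \<sigma> (average (conv_power \<sigma> n) g)"
    unfolding conv_power.simps by (rule average_convolution[OF g \<sigma>(1,2) P])
  with Suc.prems have "size_bias_asymp p (average \<sigma> (average (conv_power \<sigma> n) g)) c" by (simp only:)
  from deconvolve_heavy_atom[OF p \<sigma> window_function_average[OF g P] c this]
  show ?case by (rule Suc.IH)
qed

section \<open>A long-tailed density of an infinitely divisible distribution\<close>

lemma window_function_levy_window:
  assumes "levy_measure \<nu>" "0 < c"
  shows "window_function (levy_window \<nu> c)"
  unfolding window_function_def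
proof (intro conjI allI)
  show "\<exists>d. \<forall>x<d. levy_window \<nu> c x = 0" using levy_window_zero[OF assms(1)] by blast
  fix A
  \<comment> \<open>a window that starts in \<open>[-c, A]\<close> is contained in \<open>(-c, A + c]\<close>\<close>
  have "levy_window \<nu> c x \<le> levy_window \<nu> (A + c + c) (- c)" if "x \<le> A" for x
  proof (cases "x < - c")
    case True then show ?thesis using levy_window_zero[OF assms(1)] levy_window_nonneg by simp
  next
    case False then show ?thesis using that by (intro levy_window_mono assms) auto
  qed
  then show "\<exists>B. \<forall>x\<le>A. levy_window \<nu> c x \<le> B" by blast
qed (use assms borel_measurable_levy_window levy_window_nonneg in auto)

locale levy_density =
  fixes \<mu> \<nu> :: "real measure" and p :: "real \<Rightarrow> real"
  assumes \<mu>: "levy_khintchine_on_nonneg \<mu> 0 \<nu>"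
    and dens: "nonneg_density_of p \<mu>"
    and pos: "0 < emeasure \<nu> {1<..}"
begin

lemmas L = levy_khintchineD[OF \<mu>]

lemma p_facts:
  shows pm [measurable]: "p \<in> borel_measurable borel" and pn: "0 \<le> p x" and p0: "\<forall>x<0. p x = 0"
    and \<mu>p: "\<mu> = density lborel (\<lambda>x. ennreal (p x))"
  using dens by (auto simp: nonneg_density_of_def)

lemma pd: "prob_density p"
proof -
  interpret real_distribution \<mu> by (rule L)
  have "(\<integral>\<^sup>+x. ennreal (p x) \<partial>lborel) = emeasure \<mu> UNIV" unfolding \<mu>p by (simp add: emeasure_density)
  also have "\<dots> = 1" using emeasure_space_1 by simp
  finally show ?thesis using pm pn by (simp add: prob_density_def)
qed

lemma nn_integral_\<mu>:
  "f \<in> borel_measurable borel \<Longrightarrow> (\<integral>\<^sup>+x. f x \<partial>\<mu>) = (\<integral>\<^sup>+x. ennreal (p x) * f x \<partial>lborel)"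
  unfolding \<mu>p by (rule nn_integral_density) auto

lemma density_windows:
  assumes p: "p \<in> long_tailed" and c: "0 < c"
  shows "tail_equiv (\<lambda>x. measure \<mu> {x<..x + c}) (\<lambda>x. c * p x)"
proof (rule tail_equivI_ratio)
  interpret real_distribution \<mu> by (rule L)
  show "eventually (\<lambda>x. 0 < c * p x) at_top" using long_tailedD(3)[OF p] by eventually_elim (use c in simp)
  fix \<epsilon> :: real assume \<epsilon>: "0 < \<epsilon>"
  define e where "e = min 1 \<epsilon>"
  have e: "0 < e" "e \<le> 1" "e \<le> \<epsilon>" using \<epsilon> by (auto simp: e_def)
  show "eventually (\<lambda>x. \<bar>prob {x<..x + c} - c * p x\<bar> \<le> \<epsilon> * (c * p x)) at_top"
    using long_tailed_uniform[OF p e(1), of c]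
  proof eventually_elim
    case (elim x)
    have px: "0 < p x" using elim[rule_format, of 0] c by simp
    have near: "(1 - e) * p x \<le> p t" "p t \<le> (1 + e) * p x" if "t \<in> {x<..x + c}" for t
      using elim[rule_format, of "t - x"] that by (auto simp: abs_le_iff algebra_simps)
    have const: "(\<integral>\<^sup>+t. ennreal (C * p x) * indicator {x<..x + c} t \<partial>lborel) = ennreal (C * (c * p x))"
      if "0 \<le> C" for C
      using that c px by (subst nn_integral_cmult_indicator) (auto simp: ennreal_mult[symmetric] mult_ac)
    have em: "ennreal (prob {x<..x + c}) = (\<integral>\<^sup>+t. ennreal (p t) * indicator {x<..x + c} t \<partial>lborel)"
    proof -
      have "ennreal (prob {x<..x + c}) = emeasure \<mu> {x<..x + c}" by (simp add: emeasure_eq_measure)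
      also have "\<dots> = (\<integral>\<^sup>+t. ennreal (p t) * indicator {x<..x + c} t \<partial>lborel)"
        unfolding \<mu>p by (subst emeasure_density) auto
      finally show ?thesis .
    qed
    have "ennreal ((1 - e) * (c * p x)) \<le> ennreal (prob {x<..x + c})"
      unfolding em using e by (subst const[symmetric]) (auto intro!: nn_integral_mono ennreal_leI near simp: indicator_def)
    moreover have "ennreal (prob {x<..x + c}) \<le> ennreal ((1 + e) * (c * p x))"
      unfolding em using e by (subst const[symmetric]) (auto intro!: nn_integral_mono ennreal_leI near simp: indicator_def)
    ultimately have "(1 - e) * (c * p x) \<le> prob {x<..x + c}" "prob {x<..x + c} \<le> (1 + e) * (c * p x)"
      using e c px by (auto simp: ennreal_le_iff)
    then have "\<bar>prob {x<..x + c} - c * p x\<bar> \<le> e * (c * p x)" by (simp add: abs_le_iff algebra_simps)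
    also have "\<dots> \<le> \<epsilon> * (c * p x)" using e c px by (intro mult_right_mono) auto
    finally show ?case .
  qed
qed

lemma density_locally_dominated: "p \<in> long_tailed \<Longrightarrow> locally_dominated \<mu> p"
  by (rule locally_dominated_of_windows[where k=1]) (use density_windows in auto)

text \<open>A convolution factor inherits the bound, because the other factor has half its mass near \<open>0\<close>.\<close>

lemma factor_locally_dominated:
  assumes p: "p \<in> long_tailed"
    and M: "real_distribution M" "emeasure M {..<0} = 0" and N: "real_distribution N"
    and eq: "\<mu> = (M \<star> N)"
  shows "locally_dominated N p"
  unfolding locally_dominated_def
proof
  fix T :: real
  interpret M: real_distribution M by fact
  interpret N: real_distribution N by fact
  interpret \<mu>: real_distribution \<mu> by (rule L)
  obtain B where B: "0 \<le> B" "1/2 \<le> measure M {0..B}" by (rule mass_Icc_half[OF M])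
  obtain K where K: "0 \<le> K" "eventually (\<lambda>x. measure \<mu> {x - (T + B)<..x + (T + B)} \<le> K * p x) at_top"
    using density_locally_dominated[OF p] unfolding locally_dominated_def by blast
  have "eventually (\<lambda>x. measure N {x - T<..x + T} \<le> (2 * K) * p x) at_top"
    using K(2)
  proof eventually_elim
    case (elim x)
    let ?W = "{x - (T + B)<..x + (T + B)}"
    have "ennreal (measure N {x - T<..x + T} * (1/2)) \<le> ennreal (measure N {x - T<..x + T} * measure M {0..B})"
      using B(2) by (intro ennreal_leI mult_left_mono) auto
    also have "\<dots> = (\<integral>\<^sup>+u. emeasure N {x - T<..x + T} * indicator {0..B} u \<partial>M)"
      by (subst nn_integral_cmult_indicator) (auto simp: M.emeasure_eq_measure N.emeasure_eq_measure ennreal_mult)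
    also have "\<dots> \<le> (\<integral>\<^sup>+u. emeasure N {a. a + u \<in> ?W} \<partial>M)"
      by (intro nn_integral_mono) (auto simp: indicator_def intro!: emeasure_mono)
    also have "\<dots> = emeasure \<mu> ?W"
      unfolding eq by (rule convolution_emeasure[symmetric]) (auto intro: M.finite_measure_axioms N.finite_measure_axioms)
    also have "\<dots> = ennreal (measure \<mu> ?W)" by (rule \<mu>.emeasure_eq_measure)
    finally show ?case using elim by (simp add: ennreal_le_iff)
  qed
  then show "\<exists>K\<ge>0. eventually (\<lambda>x. measure N {x - T<..x + T} \<le> K * p x) at_top"
    using K(1) by (intro exI[of _ "2 * K"]) auto
qed

lemma size_biased_density_window:
  assumes p: "p \<in> long_tailed" and c: "0 < c"
  shows "size_bias_asymp p (average \<mu> (levy_window \<nu> c)) c"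
proof (rule size_bias_asymp_of_windows[OF density_windows[OF p c] c less_imp_le[OF c]])
  interpret \<mu>: real_distribution \<mu> by (rule L)
  have w: "window_function (levy_window \<nu> c)" by (rule window_function_levy_window[OF L(3) c])
  have avg: "(\<integral>\<^sup>+y. ennreal y * indicator {x<..x + c} y \<partial>\<mu>) = ennreal (average \<mu> (levy_window \<nu> c) x)" for x
    by (subst ennreal_average[OF w L(1,2)]) (rule size_bias_windows[OF \<mu>, symmetric])
  show "eventually (\<lambda>x. x * measure \<mu> {x<..x + c} \<le> average \<mu> (levy_window \<nu> c) x \<and>
      average \<mu> (levy_window \<nu> c) x \<le> (x + c) * measure \<mu> {x<..x + c}) at_top"
    using eventually_ge_at_top[of 0]
  proof eventually_elim
    case (elim x)
    have fin: "emeasure \<mu> {x<..x + c} < \<infinity>" by (simp add: \<mu>.emeasure_eq_measure)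
    show ?case
      using window_size_bias_bounds[OF real_distributionD(4)[OF L(1)] fin elim less_imp_le[OF c]] elim c
      unfolding avg by (simp add: ennreal_le_iff average_nonneg[OF w])
  qed
qed

end

section \<open>Levy measure of a subexponential density\<close>

text \<open>
  For \<open>0 \<le> v \<le> B\<close> the window \<open>(x - v, x - v + c + B]\<close> contains \<open>(x, x + c]\<close>, and in the next lemma the
  window \<open>(x + B - v, x + c - v]\<close> is contained in it.
\<close>

lemma levy_window_le_average:
  assumes \<nu>: "levy_measure \<nu>" and \<tau>: "real_distribution \<tau>" "emeasure \<tau> {..<0} = 0" and c: "0 < c" "0 \<le> B"
  shows "levy_window \<nu> c x * measure \<tau> {0..B} \<le> average \<tau> (levy_window \<nu> (c + B)) x"
proof -
  interpret \<tau>: real_distribution \<tau> by fact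
  have w: "window_function (levy_window \<nu> (c + B))" by (rule window_function_levy_window) (use \<nu> c in auto)
  have "ennreal (levy_window \<nu> c x * measure \<tau> {0..B}) = (\<integral>\<^sup>+v. ennreal (levy_window \<nu> c x) * indicator {0..B} v \<partial>\<tau>)"
    by (subst nn_integral_cmult_indicator) (auto simp: \<tau>.emeasure_eq_measure ennreal_mult levy_window_nonneg)
  also have "\<dots> \<le> ennreal (average \<tau> (levy_window \<nu> (c + B)) x)"
    unfolding ennreal_average[OF w \<tau>]
    by (rule nn_integral_mono)
       (auto simp: indicator_def intro!: ennreal_leI levy_window_mono \<nu>)
  finally show ?thesis by (simp add: average_nonneg w)
qed

lemma average_le_levy_window:
  assumes \<nu>: "levy_measure \<nu>" and \<tau>: "real_distribution \<tau>" "emeasure \<tau> {..<0} = 0" and B: "0 < B" "B < c"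
  shows "ennreal (average \<tau> (levy_window \<nu> (c - B)) (x + B)) \<le> ennreal (levy_window \<nu> c x) +
    (\<integral>\<^sup>+v. ennreal (levy_window \<nu> (c - B) (x + B - v)) * indicator {B<..} v \<partial>\<tau>)"
proof -
  interpret \<tau>: real_distribution \<tau> by fact
  have w: "window_function (levy_window \<nu> (c - B))" by (rule window_function_levy_window) (use \<nu> B in auto)
  note [measurable] = window_functionD(1)[OF w] and [measurable_cong] = real_distributionD(4)[OF \<tau>(1)]
  have "ennreal (average \<tau> (levy_window \<nu> (c - B)) (x + B)) \<le>
      (\<integral>\<^sup>+v. ennreal (levy_window \<nu> c x) + ennreal (levy_window \<nu> (c - B) (x + B - v)) * indicator {B<..} v \<partial>\<tau>)"
    unfolding ennreal_average[OF w \<tau>]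
  proof (rule nn_integral_mono_AE, use AE_nonneg[OF real_distributionD(4)[OF \<tau>(1)] \<tau>(2)] in eventually_elim)
    fix v :: real assume v: "0 \<le> v"
    have "levy_window \<nu> (c - B) (x + B - v) \<le> levy_window \<nu> c x" if "v \<le> B"
      by (rule levy_window_mono[OF \<nu>]) (use v that in auto)
    then show "ennreal (levy_window \<nu> (c - B) (x + B - v)) \<le>
        ennreal (levy_window \<nu> c x) + ennreal (levy_window \<nu> (c - B) (x + B - v)) * indicator {B<..} v"
      by (cases "v \<le> B") (auto intro: ennreal_leI)
  qed
  also have "\<dots> = ennreal (levy_window \<nu> c x) +
      (\<integral>\<^sup>+v. ennreal (levy_window \<nu> (c - B) (x + B - v)) * indicator {B<..} v \<partial>\<tau>)"
    by (subst nn_integral_add) (auto simp: \<tau>.emeasure_space_1[simplified])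
  finally show ?thesis .
qed

lemma small_jump_tail:
  assumes \<tau>: "real_distribution \<tau>" and m: "(\<integral>\<^sup>+x. ennreal (min 1 x) \<partial>\<tau>) \<le> ennreal (\<eta> * min 1 B)" and B: "0 < B" "0 < \<eta>"
  shows "measure \<tau> {B<..} \<le> \<eta>"
proof -
  interpret \<tau>: real_distribution \<tau> by fact
  have "ennreal (min 1 B * measure \<tau> {B<..}) = (\<integral>\<^sup>+x. ennreal (min 1 B) * indicator {B<..} x \<partial>\<tau>)"
    using B by (subst nn_integral_cmult_indicator) (auto simp: \<tau>.emeasure_eq_measure ennreal_mult)
  also have "\<dots> \<le> (\<integral>\<^sup>+x. ennreal (min 1 x) \<partial>\<tau>)"
    by (rule nn_integral_mono) (auto simp: indicator_def intro!: ennreal_leI)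
  also note m
  finally have "min 1 B * measure \<tau> {B<..} \<le> min 1 B * \<eta>"
    using B by (subst (asm) ennreal_le_iff) (auto simp: mult.commute)
  then show ?thesis using B by (subst (asm) mult_le_cancel_left_pos) auto
qed

text \<open>
  Deconvolving the large jumps from the size-bias identity leaves the Levy windows averaged over the
  distribution of the small jumps. That distribution concentrates near \<open>0\<close> as its jumps are cut off
  further, so slightly enlarged and slightly reduced windows enclose the original one.
\<close>

lemma (in levy_density) subexp_levy_window:
  assumes p: "p \<in> subexp_densities" and c: "0 < c"
  shows "size_bias_asymp p (levy_window \<nu> c) c"
proof -
  note SE = subexp_densitiesD[OF p]
  have pos: "eventually (\<lambda>x. 0 < x * p x) at_top"
    using long_tailedD(3)[OF SE(1)] eventually_gt_at_top[of 0] by eventually_elim simp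
  obtain K where K: "0 \<le> K" "eventually (\<lambda>y. levy_window \<nu> c y \<le> K * (y * p y)) at_top"
  proof -
    obtain B where B: "0 \<le> B" "1/2 \<le> measure \<mu> {0..B}" by (rule mass_Icc_half[OF L(1,2)])
    have cB: "0 < c + B" using c B by simp
    have "eventually (\<lambda>y. levy_window \<nu> c y \<le> (2 * (c + B + 1)) * (y * p y)) at_top"
      using size_bias_asympD[OF size_biased_density_window[OF SE(1) cB] zero_less_one]
    proof eventually_elim
      case (elim y)
      have "levy_window \<nu> c y * (1/2) \<le> levy_window \<nu> c y * measure \<mu> {0..B}"
        using B by (intro mult_left_mono levy_window_nonneg) auto
      also have "\<dots> \<le> average \<mu> (levy_window \<nu> (c + B)) y"
        by (rule levy_window_le_average[OF L(3,1,2) c B(1)])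
      also have "\<dots> \<le> (c + B + 1) * (y * p y)" using elim by simp
      finally show ?case by (simp add: algebra_simps)
    qed
    then show ?thesis using c B by (intro that[of "2 * (c + B + 1)"]) auto
  qed
  show ?thesis
  proof (rule size_bias_asympI)
    fix \<epsilon> :: real assume \<epsilon>: "0 < \<epsilon>"
    define e where "e = min (\<epsilon> / 8) (c / 8)"
    have e: "0 < e" "8 * e \<le> \<epsilon>" "8 * e \<le> c" using \<epsilon> c by (auto simp: e_def)
    define \<eta> where "\<eta> = e / (K + 1)"
    have \<eta>: "0 < \<eta>" "K * \<eta> \<le> e" using e K by (auto simp: \<eta>_def field_simps)
    have "0 < ennreal (\<eta> * min 1 e)" using \<eta> e by simp
    then have "eventually (\<lambda>k. small_jump_mean \<nu> (1 / real (Suc k)) < ennreal (\<eta> * min 1 e)) sequentially"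
      by (rule order_tendstoD(2)[OF small_jump_mean_tendsto_0[OF L(3)]])
    then obtain k where k: "small_jump_mean \<nu> (1 / real (Suc k)) < ennreal (\<eta> * min 1 e)"
      unfolding eventually_sequentially by blast
    obtain \<tau> \<kappa> n where \<tau>: "real_distribution \<tau>" "emeasure \<tau> {..<0} = 0"
      "(\<integral>\<^sup>+x. ennreal (min 1 x) \<partial>\<tau>) \<le> small_jump_mean \<nu> (1 / real (Suc k))"
      and \<kappa>: "real_distribution \<kappa>" "emeasure \<kappa> {..<0} = 0" "1 / 2 < measure \<kappa> {0}"
      and n: "0 < n" "\<mu> = (conv_power \<kappa> n \<star> \<tau>)"
      by (rule factor_with_heavy_atom[OF \<mu>, of "1 / real (Suc k)"]) simp
    note P = real_distribution_conv_power[OF \<kappa>(1)] conv_power_nonneg[OF \<kappa>(1,2)]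
    obtain j where j: "n = Suc j" using n(1) gr0_implies_Suc by blast
    have \<tau>B: "measure \<tau> {e<..} \<le> \<eta>"
      by (rule small_jump_tail[OF \<tau>(1) _ e(1) \<eta>(1)]) (use \<tau>(3) k in auto)
    note fin = real_distributionD(2,4)[OF \<kappa>(1)] real_distributionD(2,4)[OF \<tau>(1)] real_distributionD(2,4)[OF P(1)]
    have "\<mu> = (\<kappa> \<star> (conv_power \<kappa> j \<star> \<tau>))"
      unfolding n(2) j conv_power.simps by (rule convolution_associative[symmetric]) (simp_all add: fin)
    also have "\<dots> = ((conv_power \<kappa> j \<star> \<tau>) \<star> \<kappa>)"
      by (rule convolution_commutative) (simp_all add: fin convolution_finite)
    finally have \<mu>\<kappa>: "\<mu> = ((conv_power \<kappa> j \<star> \<tau>) \<star> \<kappa>)" .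
    have \<kappa>d: "locally_dominated \<kappa> p"
      by (rule factor_locally_dominated[OF SE(1) real_distribution_convolution[OF P(1) \<tau>(1)]
            convolution_nonneg[OF P \<tau>(1,2)] \<kappa>(1) \<mu>\<kappa>])
    have \<tau>d: "locally_dominated \<tau> p"
      by (rule factor_locally_dominated[OF SE(1) P \<tau>(1) n(2)])
    have asymp: "size_bias_asymp p (average \<tau> (levy_window \<nu> d)) d" if d: "0 < d" for d
    proof -
      have w: "window_function (levy_window \<nu> d)" by (rule window_function_levy_window[OF L(3) d])
      have "average \<mu> (levy_window \<nu> d) = average (conv_power \<kappa> n) (average \<tau> (levy_window \<nu> d))"
        unfolding n(2) by (rule average_convolution[OF w P \<tau>(1,2)])
      then have "size_bias_asymp p (average (conv_power \<kappa> n) (average \<tau> (levy_window \<nu> d))) d"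
        using size_biased_density_window[OF SE(1) d] by simp
      then show ?thesis
        by (rule deconvolve_conv_power[OF p p0 \<kappa>(1,2) \<kappa>d \<kappa>(3) window_function_average[OF w \<tau>(1,2)] less_imp_le[OF d]])
    qed
    have ce: "0 < c + e" "0 < c - e" "0 \<le> e" "e < c" using c e by auto
    have wce: "window_function (levy_window \<nu> (c - e))" by (rule window_function_levy_window[OF L(3) ce(2)])
    have Kce: "eventually (\<lambda>y. levy_window \<nu> (c - e) y \<le> K * (y * p y)) at_top"
      using K(2)
    proof eventually_elim
      case (elim y)
      have "levy_window \<nu> (c - e) y \<le> levy_window \<nu> c y" by (rule levy_window_mono[OF L(3)]) (use e in auto)
      then show ?case using elim by simp
    qed
    have Se: "{e<..} \<in> sets (borel :: real measure)" by simp
    have ec: "0 < e / c" using e c by simp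
    show "eventually (\<lambda>x. (c - \<epsilon>) * (x * p x) \<le> levy_window \<nu> c x \<and> levy_window \<nu> c x \<le> (c + \<epsilon>) * (x * p x)) at_top"
      using size_bias_asympD[OF asymp[OF ce(1)] e(1)]
        eventually_shift[OF size_bias_asympD[OF asymp[OF ce(2)] e(1)], of e]
        eventually_shift[OF average_upper[OF p p0 \<tau>(1,2) \<tau>d wce K(1) Kce Se e(1)], of e]
        K(2) pos eventually_shift[OF pos, of e] long_tailed_uniform[OF SE(1) ec, of e] eventually_ge_at_top[of 0]
    proof eventually_elim
      case (elim x)
      define r where "r = x * p x"
      define r' where "r' = (x + e) * p (x + e)"
      define h where "h = levy_window \<nu> c x"
      have r: "0 < r" "0 < r'" using elim(5,6) by (auto simp: r_def r'_def)
      have h: "0 \<le> h" "h \<le> K * r" using elim(4) by (auto simp: h_def r_def levy_window_nonneg)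
      have Kr: "K * \<eta> * r \<le> e * r" using r \<eta> by (intro mult_right_mono) auto
      have Kr': "K * measure \<tau> {e<..} \<le> e" using \<tau>B \<eta>(2) K(1) by (meson mult_left_mono order_trans)
      \<comment> \<open>upper bound: enlarged windows, with small jumps of total size at most \<open>e\<close>\<close>
      have "h * (1 - \<eta>) \<le> h * measure \<tau> {0..e}"
        using \<tau>B mass_Icc[OF \<tau>(1,2) ce(3)] h by (intro mult_left_mono) auto
      also have "\<dots> \<le> average \<tau> (levy_window \<nu> (c + e)) x"
        unfolding h_def by (rule levy_window_le_average[OF L(3) \<tau>(1,2) c ce(3)])
      also have "\<dots> \<le> (c + e + e) * r" using elim(1) by (simp add: r_def)
      finally have "h \<le> (c + e + e) * r + h * \<eta>" by (simp add: algebra_simps)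
      also have "h * \<eta> \<le> K * r * \<eta>" using h \<eta> by (intro mult_right_mono) auto
      finally have up: "h \<le> (c + 3 * e) * r" using Kr by (simp add: algebra_simps)
      \<comment> \<open>lower bound: reduced windows at \<open>x + e\<close>; small jumps of total size above \<open>e\<close> contribute little\<close>
      have "ennreal ((c - e - e) * r') \<le> ennreal (average \<tau> (levy_window \<nu> (c - e)) (x + e))"
        using elim(2) by (intro ennreal_leI) (simp add: r'_def)
      also have "\<dots> \<le> ennreal h + (\<integral>\<^sup>+v. ennreal (levy_window \<nu> (c - e) (x + e - v)) * indicator {e<..} v \<partial>\<tau>)"
        unfolding h_def by (rule average_le_levy_window[OF L(3) \<tau>(1,2) e(1) ce(4)])
      also have "\<dots> \<le> ennreal h + ennreal ((K * measure \<tau> {e<..} + e) * r')"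
        using elim(3) unfolding r'_def by (intro add_left_mono)
      also have "\<dots> = ennreal (h + (K * measure \<tau> {e<..} + e) * r')"
        using h K e r by (simp add: ennreal_plus)
      finally have "(c - e - e) * r' \<le> h + (K * measure \<tau> {e<..} + e) * r'"
        using h K e r by (subst (asm) ennreal_le_iff) auto
      also have "(K * measure \<tau> {e<..} + e) * r' \<le> (e + e) * r'"
        using Kr' r by (intro mult_right_mono) auto
      finally have low: "(c - 4 * e) * r' \<le> h" by (simp add: algebra_simps)
      have "(1 - e / c) * r \<le> r'"
      proof -
        have "(1 - e / c) * p x \<le> p (x + e)"
          using elim(7)[rule_format, of e] e by (simp add: abs_le_iff algebra_simps)
        then have "x * ((1 - e / c) * p x) \<le> (x + e) * p (x + e)"
          using elim(8) e r ce elim(6) by (intro mult_mono) (auto simp: zero_less_mult_iff r_def)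
        then show ?thesis by (simp add: r_def r'_def mult_ac)
      qed
      then have "(c - 4 * e) * ((1 - e / c) * r) \<le> (c - 4 * e) * r'" using e c by (intro mult_left_mono) auto
      with low have "(c - 4 * e) * (1 - e / c) * r \<le> h" by simp
      moreover have "(c - 4 * e) * (1 - e / c) = c - 5 * e + 4 * e * e / c" using c by (simp add: field_simps)
      moreover have "0 \<le> 4 * e * e / c" using e c by simp
      ultimately have "(c - 5 * e) * r \<le> h"
        using r by (smt (verit, best) mult_right_mono)
      moreover have "5 * e * r \<le> \<epsilon> * r" "3 * e * r \<le> \<epsilon> * r" using r e by (auto intro!: mult_right_mono)
      ultimately show ?case
        using up unfolding h_def[symmetric] r_def[symmetric] by (simp add: algebra_simps)
    qed
  qed
qed

lemma (in levy_density) subexp_levy_density: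
  assumes p: "p \<in> subexp_densities" and c: "0 < c"
  shows "tail_equiv (\<lambda>x. measure \<nu> {x<..x + c}) (\<lambda>x. c * p x)"
proof (rule windows_of_size_bias_asymp[OF subexp_levy_window[OF p c] c less_imp_le[OF c]])
  show "eventually (\<lambda>x. 0 < p x) at_top" by (rule long_tailedD(3)[OF subexp_densitiesD(1)[OF p]])
  show "eventually (\<lambda>x. x * measure \<nu> {x<..x + c} \<le> levy_window \<nu> c x \<and>
      levy_window \<nu> c x \<le> (x + c) * measure \<nu> {x<..x + c}) at_top"
    using eventually_gt_at_top[of 0] by eventually_elim (use levy_window_bounds[OF L(3)] c in auto)
qed simp

section \<open>The normalized Levy measure\<close>

lemma enn2real_divide_ennreal: "0 < l \<Longrightarrow> enn2real (a / ennreal l) = enn2real a / l"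
  by (simp add: divide_ennreal_def inverse_ennreal enn2real_mult field_simps)

lemma normalized_levy_facts:
  assumes \<nu>: "levy_measure \<nu>" and pos: "0 < emeasure \<nu> {1<..}"
  shows "real_distribution (normalized_levy \<nu>)" "levy_measure (normalized_levy \<nu>)"
    "0 < measure \<nu> {1<..}"
    "1 \<le> x \<Longrightarrow> measure (normalized_levy \<nu>) {x<..x + c} = measure \<nu> {x<..x + c} / measure \<nu> {1<..}"
    "1 \<le> x \<Longrightarrow> levy_window (normalized_levy \<nu>) c x = levy_window \<nu> c x / measure \<nu> {1<..}"
proof -
  note [measurable_cong] = levy_measureD(1)[OF \<nu>]
  let ?\<rho> = "normalized_levy \<nu>"
  have fin: "emeasure \<nu> {1<..} \<noteq> \<infinity>" using levy_tail_finite[OF \<nu> zero_less_one] by simp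
  define l where "l = measure \<nu> {1<..}"
  have em: "emeasure \<nu> {1<..} = ennreal l" using fin by (simp add: l_def emeasure_eq_ennreal_measure)
  show l: "0 < measure \<nu> {1<..}" using pos em by (simp add: l_def)
  then have l': "0 < l" by (simp add: l_def)
  have s: "sets ?\<rho> = sets borel" by (simp add: normalized_levy_def levy_measureD[OF \<nu>])
  have "prob_space ?\<rho>"
    unfolding normalized_levy_def by (rule prob_space_uniform_measure) (use pos fin in auto)
  then show R: "real_distribution ?\<rho>" by (intro real_distributionI s)
  interpret \<rho>: real_distribution ?\<rho> by fact
  have A: "{1<..} \<in> sets \<nu>" by (simp add: levy_measureD[OF \<nu>])
  have ems: "emeasure ?\<rho> B = emeasure \<nu> ({1<..} \<inter> B) / ennreal l" if "B \<in> sets borel" for B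
    unfolding normalized_levy_def using that
    by (subst emeasure_uniform_measure) (auto simp: A levy_measureD[OF \<nu>] em)
  have nn: "(\<integral>\<^sup>+x. f x \<partial>?\<rho>) = (\<integral>\<^sup>+x. f x * indicator {1<..} x \<partial>\<nu>) / ennreal l"
    if "f \<in> borel_measurable borel" for f
    unfolding normalized_levy_def em[symmetric] using that
    by (intro nn_integral_uniform_measure) (auto simp: measurable_cong_sets[OF levy_measureD(1)[OF \<nu>] refl] A)
  have neg: "emeasure ?\<rho> {..<0} = 0" "emeasure ?\<rho> {0} = 0"
  proof -
    have "{1<..} \<inter> {..<0} = ({} :: real set)" "{1<..} \<inter> {0} = ({} :: real set)" by auto
    then show "emeasure ?\<rho> {..<0} = 0" "emeasure ?\<rho> {0} = 0" by (simp_all add: ems)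
  qed
  have "(\<integral>\<^sup>+x. ennreal (min 1 x) \<partial>?\<rho>) \<le> (\<integral>\<^sup>+x. 1 \<partial>?\<rho>)"
    by (rule nn_integral_mono) (metis ennreal_1 ennreal_leI min.cobounded1)
  also have "\<dots> = 1" using \<rho>.emeasure_space_1 by simp
  finally show "levy_measure ?\<rho>"
    using neg by (auto simp: levy_measure_def s le_less_trans)
  show "measure ?\<rho> {x<..x + c} = measure \<nu> {x<..x + c} / measure \<nu> {1<..}" if x: "1 \<le> x"
  proof -
    have "{1<..} \<inter> {x<..x + c} = {x<..x + c}" using x by auto
    then show ?thesis
      using l' unfolding l_def[symmetric]
      by (simp add: measure_def[of ?\<rho>] measure_def[of \<nu> "{x<..x + c}"] ems enn2real_divide_ennreal)
  qed
  show "levy_window ?\<rho> c x = levy_window \<nu> c x / measure \<nu> {1<..}" if x: "1 \<le> x"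
  proof -
    have "(\<integral>\<^sup>+u. ennreal u * indicator {x<..x + c} u \<partial>?\<rho>) = (\<integral>\<^sup>+u. ennreal u * indicator {x<..x + c} u \<partial>\<nu>) / ennreal l"
      using x by (subst nn) (auto intro!: arg_cong2[where f="(/)"] nn_integral_cong simp: indicator_def)
    then show ?thesis using l' by (simp add: levy_window_def l_def[symmetric] enn2real_divide_ennreal)
  qed
qed

lemma borel_measurable_window_mass:
  assumes "real_distribution \<rho>" "0 < (c::real)"
  shows "(\<lambda>x. measure \<rho> {x<..x + c}) \<in> borel_measurable borel"
proof -
  interpret real_distribution \<rho> by fact
  have "(\<lambda>x. measure \<rho> {x<..x + c}) = (\<lambda>x. cdf \<rho> (x + c) - cdf \<rho> x)"
    using assms(2) by (simp add: cdf_diff_eq fun_eq_iff)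
  moreover have [measurable]: "cdf \<rho> \<in> borel_measurable borel"
    by (rule borel_measurable_mono) (simp add: mono_def cdf_nondecreasing)
  ultimately show ?thesis by simp
qed

lemma conv_power_1:
  assumes "real_distribution \<rho>" shows "conv_power \<rho> 1 = \<rho>"
proof (rule Levy_uniqueness)
  show "real_distribution (conv_power \<rho> 1)" by (rule real_distribution_conv_power[OF assms])
  show "char (conv_power \<rho> 1) = char \<rho>" using char_conv_power[OF assms, of 1] by (simp add: fun_eq_iff)
qed (rule assms)

text \<open>
  For the convolution square exchangeability of the two factors says that \<open>x (\<rho> \<star> \<rho>)(dx)\<close> is twice
  the convolution of \<open>x \<rho>(dx)\<close> with \<open>\<rho>\<close>.
\<close>

lemma average_levy_window_self:
  assumes \<rho>: "real_distribution \<rho>" "levy_measure \<rho>" and c: "0 < c"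
  shows "(\<integral>\<^sup>+y. ennreal y * indicator {x<..x + c} y \<partial>(\<rho> \<star> \<rho>)) = ennreal (2 * average \<rho> (levy_window \<rho> c) x)"
proof -
  note [measurable_cong] = real_distributionD(4)[OF \<rho>(1)]
  have neg: "emeasure \<rho> {..<0} = 0" using \<rho>(2) by (simp add: levy_measure_def)
  interpret \<rho>: sigma_finite_measure \<rho> by (rule real_distributionD[OF \<rho>(1)])
  interpret pair_sigma_finite \<rho> \<rho> ..
  have w: "window_function (levy_window \<rho> c)" by (rule window_function_levy_window[OF \<rho>(2) c])
  let ?W = "indicator {x<..x + c} :: real \<Rightarrow> ennreal"
  have 2: "conv_power \<rho> (Suc 1) = (\<rho> \<star> \<rho>)" using conv_power_1[OF \<rho>(1)] by simp
  have "(\<integral>\<^sup>+y. ennreal y * ?W y \<partial>(\<rho> \<star> \<rho>)) = of_nat (Suc 1) * (\<integral>\<^sup>+u. \<integral>\<^sup>+v. ennreal u * ?W (u + v) \<partial>\<rho> \<partial>\<rho>)"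
    using size_bias_conv_power[OF \<rho>(1) neg, of ?W 1] unfolding 2 conv_power_1[OF \<rho>(1)] by simp
  also have "(\<integral>\<^sup>+u. \<integral>\<^sup>+v. ennreal u * ?W (u + v) \<partial>\<rho> \<partial>\<rho>) = (\<integral>\<^sup>+v. \<integral>\<^sup>+u. ennreal u * ?W (u + v) \<partial>\<rho> \<partial>\<rho>)"
    by (rule Fubini'[symmetric]) measurable
  also have "\<dots> = (\<integral>\<^sup>+v. ennreal (levy_window \<rho> c (x - v)) \<partial>\<rho>)"
    unfolding ennreal_levy_window[OF \<rho>(2)]
    by (intro nn_integral_cong) (auto simp: indicator_def algebra_simps)
  also have "\<dots> = ennreal (average \<rho> (levy_window \<rho> c) x)" by (rule ennreal_average[OF w \<rho>(1) neg, symmetric])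
  finally show ?thesis by (simp add: ennreal_mult' average_nonneg[OF w] numeral_2_eq_2 distrib_right ennreal_plus)
qed

lemma self_convolution_windows:
  assumes \<rho>: "real_distribution \<rho>" "levy_measure \<rho>" and c: "0 < c" and x: "0 \<le> x"
  shows "x * measure (\<rho> \<star> \<rho>) {x<..x + c} \<le> 2 * average \<rho> (levy_window \<rho> c) x \<and>
    2 * average \<rho> (levy_window \<rho> c) x \<le> (x + c) * measure (\<rho> \<star> \<rho>) {x<..x + c}"
proof -
  interpret C: real_distribution "\<rho> \<star> \<rho>" by (rule real_distribution_convolution[OF \<rho>(1) \<rho>(1)])
  have fin: "emeasure (\<rho> \<star> \<rho>) {x<..x + c} < \<infinity>" by (simp add: C.emeasure_eq_measure)
  show ?thesis
    using window_size_bias_bounds[OF _ fin x less_imp_le[OF c]] x c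
      average_nonneg[OF window_function_levy_window[OF \<rho>(2) c]]
    unfolding average_levy_window_self[OF \<rho> c] by (simp add: ennreal_le_iff)
qed

context levy_density
begin

abbreviation \<rho> where "\<rho> \<equiv> normalized_levy \<nu>"

definition rate where "rate = measure \<nu> {1<..}"

lemmas NL = normalized_levy_facts[OF L(3) pos, folded rate_def]

lemma NL_neg: "emeasure \<rho> {..<0} = 0"
  using NL(2) by (simp add: levy_measure_def)

lemma subexp_normalized_levy_windows:
  assumes p: "p \<in> subexp_densities" and c: "0 < c"
  shows "tail_equiv (\<lambda>x. measure \<rho> {x<..x + c}) (\<lambda>x. c * (1 / rate) * p x)"
proof (rule tail_equiv_cong)
  show "tail_equiv (\<lambda>x. 1 / rate * measure \<nu> {x<..x + c}) (\<lambda>x. c * (1 / rate) * p x)"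
    using tail_equiv_cmult[OF subexp_levy_density[OF p c], of "1 / rate"] NL(3) by (simp add: mult_ac)
  show "eventually (\<lambda>x. measure \<rho> {x<..x + c} = 1 / rate * measure \<nu> {x<..x + c}) at_top"
    using eventually_ge_at_top[of 1] by eventually_elim (simp add: NL(4))
qed

lemma subexp_imp_normalized_levy_loc_long_tailed:
  assumes p: "p \<in> subexp_densities"
  shows "\<rho> \<in> loc_long_tailed"
proof -
  have "(\<lambda>x. measure \<rho> {x<..x + c}) \<in> long_tailed" if c: "0 < c" for c
  proof (rule long_tailed_tail_equiv[OF _ subexp_normalized_levy_windows[OF p c]])
    show "(\<lambda>x. c * (1 / rate) * p x) \<in> long_tailed"
      by (rule long_tailed_cmult[OF subexp_densitiesD(1)[OF p]]) (use c NL(3) in simp)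
  qed (auto intro: borel_measurable_window_mass NL(1) c)
  then show ?thesis using NL(1) by (auto simp: loc_long_tailed_def)
qed

text \<open>
  The windows of \<open>\<rho>\<close> are asymptotic to a multiple of \<open>p\<close>. Weighting by \<open>x\<close> turns the convolution square into
  an average over \<open>\<rho>\<close> on the scale \<open>x p x\<close>, which keeps asymptotics unchanged.
\<close>

lemma subexp_imp_normalized_levy_loc_subexp:
  assumes p: "p \<in> subexp_densities"
  shows "\<rho> \<in> loc_subexp"
proof -
  note SE = subexp_densitiesD[OF p]
  have dom: "locally_dominated \<rho> p"
    by (rule locally_dominated_of_windows[OF SE(1) _ subexp_normalized_levy_windows[OF p]]) (use NL(3) in simp_all)
  have "tail_equiv (\<lambda>x. measure (\<rho> \<star> \<rho>) {x<..x + c}) (\<lambda>x. 2 * measure \<rho> {x<..x + c})" if c: "0 < c" for c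
  proof -
    define k where "k = c * (1 / rate)"
    have k: "0 < k" using c NL(3) by (simp add: k_def)
    have w: "window_function (levy_window \<rho> c)" by (rule window_function_levy_window[OF NL(2) c])
    have "eventually (\<lambda>x. x * measure \<rho> {x<..x + c} \<le> levy_window \<rho> c x \<and>
        levy_window \<rho> c x \<le> (x + c) * measure \<rho> {x<..x + c}) at_top"
      using eventually_gt_at_top[of 0] by eventually_elim (use levy_window_bounds[OF NL(2)] c in auto)
    then have "size_bias_asymp p (levy_window \<rho> c) k"
      using subexp_normalized_levy_windows[OF p c] unfolding k_def[symmetric]
      by (intro size_bias_asymp_of_windows[OF _ k less_imp_le[OF c]])
    from size_bias_asymp_average[OF p p0 NL(1) NL_neg dom w k this]
    have avg: "size_bias_asymp p (\<lambda>x. 2 * average \<rho> (levy_window \<rho> c) x) (2 * k)"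
    proof (intro size_bias_asympI)
      fix \<epsilon> :: real assume a: "size_bias_asymp p (average \<rho> (levy_window \<rho> c)) k" and "0 < \<epsilon>"
      then have "0 < \<epsilon> / 2" by simp
      from size_bias_asympD[OF a this]
      show "eventually (\<lambda>x. (2 * k - \<epsilon>) * (x * p x) \<le> 2 * average \<rho> (levy_window \<rho> c) x \<and>
          2 * average \<rho> (levy_window \<rho> c) x \<le> (2 * k + \<epsilon>) * (x * p x)) at_top"
        by eventually_elim (simp add: algebra_simps)
    qed
    have "tail_equiv (\<lambda>x. measure (\<rho> \<star> \<rho>) {x<..x + c}) (\<lambda>x. 2 * k * p x)"
    proof (rule windows_of_size_bias_asymp[OF avg])
      show "eventually (\<lambda>x. x * measure (\<rho> \<star> \<rho>) {x<..x + c} \<le> 2 * average \<rho> (levy_window \<rho> c) x \<and>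
          2 * average \<rho> (levy_window \<rho> c) x \<le> (x + c) * measure (\<rho> \<star> \<rho>) {x<..x + c}) at_top"
        using eventually_ge_at_top[of 0] by eventually_elim (rule self_convolution_windows[OF NL(1,2) c])
    qed (use k c long_tailedD(3)[OF SE(1)] in auto)
    moreover have "tail_equiv (\<lambda>x. 2 * measure \<rho> {x<..x + c}) (\<lambda>x. 2 * k * p x)"
      using tail_equiv_cmult[OF subexp_normalized_levy_windows[OF p c], of 2] by (simp add: k_def mult.assoc)
    ultimately show ?thesis using tail_equiv_trans tail_equiv_sym by blast
  qed
  then show ?thesis
    using subexp_imp_normalized_levy_loc_long_tailed[OF p] by (auto simp: loc_subexp_def loc_long_tailed_def)
qed

end

section \<open>The constant in the convolution asymptotics\<close>

text \<open>
  Far out, \<open>exp (s x) p x\<close> does not decrease over unit steps, because \<open>p\<close> loses at most a factor \<open>exp (- s)\<close>.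
\<close>

lemma exp_moment_infinite:
  assumes p: "p \<in> long_tailed" and s: "0 < s"
  shows "(\<integral>\<^sup>+x. ennreal (exp (s * x) * p x) \<partial>lborel) = top"
proof -
  note [measurable] = long_tailedD(1)[OF p]
  have s2: "0 < 1 - exp (- s)" using s by simp
  have "eventually (\<lambda>x. 0 \<le> x \<and> (\<forall>a. \<bar>a\<bar> \<le> 1 \<longrightarrow> 0 < p (x + a) \<and> \<bar>p (x + a) - p x\<bar> \<le> (1 - exp (- s)) * p x)) at_top"
    by (intro eventually_conj eventually_ge_at_top long_tailed_uniform p s2)
  then obtain X where X: "0 \<le> X"
    "\<And>x a. X \<le> x \<Longrightarrow> \<bar>a\<bar> \<le> 1 \<Longrightarrow> 0 < p (x + a) \<and> \<bar>p (x + a) - p x\<bar> \<le> (1 - exp (- s)) * p x"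
    unfolding eventually_at_top_linorder by (metis order_refl)
  define b where "b = exp (- s) * p X"
  have b: "0 < b" using X(2)[of X 0] by (simp add: b_def)
  have low: "exp (- s) * p x \<le> p (x + a)" if "X \<le> x" "\<bar>a\<bar> \<le> 1" for x a
  proof -
    have "\<bar>p (x + a) - p x\<bar> \<le> p x - exp (- s) * p x" using X(2)[OF that] by (simp add: algebra_simps)
    then show ?thesis by linarith
  qed
  have h: "b \<le> exp (s * x) * p x" if "X \<le> x" "x \<le> X + 1 + real n" for x n
    using that
  proof (induction n arbitrary: x)
    case 0
    have "b \<le> p x" using low[of X "x - X"] 0 by (simp add: b_def)
    also have "\<dots> \<le> exp (s * x) * p x"
      using s X(1) 0 long_tailedD(2)[OF p, of x] mult_right_mono[of 1 "exp (s * x)" "p x"] by simp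
    finally show ?case .
  next
    case (Suc n)
    show ?case
    proof (cases "x \<le> X + 1 + real n")
      case True then show ?thesis using Suc by auto
    next
      case False
      then have x: "X \<le> x - 1" "x - 1 \<le> X + 1 + real n" using Suc.prems by auto
      have "b \<le> exp (s * (x - 1)) * p (x - 1)" by (rule Suc.IH[OF x])
      also have "\<dots> = exp (s * x) * (exp (- s) * p (x - 1))"
        by (simp add: mult.assoc[symmetric] exp_add[symmetric] algebra_simps)
      also have "\<dots> \<le> exp (s * x) * p x" using low[of "x - 1" 1] x by (intro mult_left_mono) auto
      finally show ?thesis .
    qed
  qed
  have hb: "b \<le> exp (s * x) * p x" if "X \<le> x" for x
  proof (rule h[OF that, of "nat \<lceil>x\<rceil>"])
    show "x \<le> X + 1 + real (nat \<lceil>x\<rceil>)" using X(1) that by linarith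
  qed
  have "ennreal b * emeasure lborel {X..} = (\<integral>\<^sup>+x. ennreal b * indicator {X..} x \<partial>lborel)"
    by (rule nn_integral_cmult_indicator[symmetric]) simp
  also have "\<dots> \<le> (\<integral>\<^sup>+x. ennreal (exp (s * x) * p x) \<partial>lborel)"
    by (rule nn_integral_mono) (auto simp: indicator_def intro!: ennreal_leI hb)
  also have "emeasure lborel {X..} = top"
  proof -
    have "ennreal (real n) \<le> emeasure lborel {X..}" for n
    proof -
      have "ennreal (real n) = emeasure lborel {X..X + real n}" by simp
      also have "\<dots> \<le> emeasure lborel {X..}" by (rule emeasure_mono) auto
      finally show ?thesis .
    qed
    note le = this
    show ?thesis
    proof (cases "emeasure lborel {X..}")
      case (real r)
      define N where "N = Suc (nat \<lceil>r\<rceil>)"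
      have "real N \<le> r" using le[of N] real by (simp add: ennreal_le_iff)
      then show ?thesis unfolding N_def by linarith
    qed
  qed
  finally show ?thesis using b by (simp add: ennreal_mult_eq_top_iff top_unique ennreal_mult_top)
qed

text \<open>
  The bounded weights \<open>exp (min (s x) T)\<close> are submultiplicative on the half line. Since \<open>p\<close> has no
  exponential moment, the total weight increases continuously from \<open>1\<close> to infinity with the cut-off
  \<open>T\<close>, so it takes the value \<open>1 + \<eta>\<close>.
\<close>

lemma tuned_exponential_weight:
  assumes p: "p \<in> long_tailed" "prob_density p" "\<forall>x<0. p x = 0" and s: "0 < s" and \<eta>: "0 < \<eta>"
  obtains T where "0 \<le> T"
    "(\<integral>\<^sup>+x. ennreal (exp (min (s * x) T)) \<partial>density lborel (\<lambda>x. ennreal (p x))) = ennreal (1 + \<eta>)"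
proof -
  let ?\<mu> = "density lborel (\<lambda>x. ennreal (p x))"
  have [measurable]: "p \<in> borel_measurable borel" and p0: "\<And>x. 0 \<le> p x"
    using p(2) by (auto simp: prob_density_def)
  interpret \<mu>: real_distribution ?\<mu> by (rule real_distribution_density[OF p(2)])
  have ae: "AE x in ?\<mu>. 0 \<le> x"
    by (rule AE_density_nonneg) (use p(3) in auto)
  define F where "F T = (\<integral>x. exp (min (s * x) T) \<partial>?\<mu>)" for T
  have int: "integrable ?\<mu> (\<lambda>x. exp (min (s * x) T))" for T
    by (rule \<mu>.integrable_const_bound[where B="exp T"]) auto
  have nn: "(\<integral>\<^sup>+x. ennreal (exp (min (s * x) T)) \<partial>?\<mu>) = ennreal (F T)" for T
    unfolding F_def by (rule nn_integral_eq_integral[OF int]) simp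
  have mono: "F T \<le> F T'" if "T \<le> T'" for T T'
    unfolding F_def by (rule integral_mono[OF int int]) (use that in \<open>auto simp: min_def\<close>)
  have lip: "F T' - F T \<le> exp T' - exp T" if "T \<le> T'" for T T'
  proof -
    have "F T' - F T = (\<integral>x. exp (min (s * x) T') - exp (min (s * x) T) \<partial>?\<mu>)"
      unfolding F_def by (rule Bochner_Integration.integral_diff[OF int int, symmetric])
    also have "\<dots> \<le> (\<integral>x. exp T' - exp T \<partial>?\<mu>)"
    proof (rule integral_mono)
      fix x show "exp (min (s * x) T') - exp (min (s * x) T) \<le> exp T' - exp T"
        using that by (auto simp: min_def)
    qed (use int in auto)
    finally show ?thesis using \<mu>.prob_space by simp
  qed
  have F0: "F 0 = 1"
  proof -
    have "F 0 = (\<integral>x. 1 \<partial>?\<mu>)" unfolding F_def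
    proof (rule integral_cong_AE)
      show "AE x in ?\<mu>. exp (min (s * x) 0) = 1"
        using ae by eventually_elim (use s in \<open>simp add: min_absorb2\<close>)
    qed auto
    then show ?thesis using \<mu>.prob_space by simp
  qed
  have cont: "continuous_on UNIV F"
    unfolding continuous_on_eq_continuous_at[OF open_UNIV]
  proof
    fix T
    have "((\<lambda>T'. F T' - F T) \<longlongrightarrow> 0) (at T)"
    proof (rule Lim_null_comparison)
      show "eventually (\<lambda>T'. norm (F T' - F T) \<le> \<bar>exp T' - exp T\<bar>) (at T)"
      proof (rule always_eventually, rule allI)
        fix T' show "norm (F T' - F T) \<le> \<bar>exp T' - exp T\<bar>"
          using lip[of T T'] lip[of T' T] mono[of T T'] mono[of T' T] by (cases "T \<le> T'") (auto simp: abs_if)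
      qed
      have "((\<lambda>T'. \<bar>exp T' - exp T\<bar>) \<longlongrightarrow> \<bar>exp T - exp T\<bar>) (at T)" by (intro tendsto_intros)
      then show "((\<lambda>T'. \<bar>exp T' - exp T\<bar>) \<longlongrightarrow> 0) (at T)" by simp
    qed
    then show "isCont F T" by (simp add: isCont_def LIM_zero_iff)
  qed
  have "\<exists>n. 1 + \<eta> \<le> F (real n)"
  proof (rule ccontr)
    assume "\<not> ?thesis"
    then have less: "F (real n) \<le> 1 + \<eta>" for n by (meson linear)
    have "(\<lambda>n. \<integral>\<^sup>+x. ennreal (exp (min (s * x) (real n))) \<partial>?\<mu>) \<longlonglongrightarrow> (\<integral>\<^sup>+x. ennreal (exp (s * x)) \<partial>?\<mu>)"
    proof (rule nn_integral_LIMSEQ)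
      show "incseq (\<lambda>n x. ennreal (exp (min (s * x) (real n))))"
        by (auto simp: incseq_def le_fun_def min_def intro!: ennreal_leI)
      fix x
      have "eventually (\<lambda>n. ennreal (exp (min (s * x) (real n))) = ennreal (exp (s * x))) sequentially"
        using eventually_ge_at_top[of "nat \<lceil>s * x\<rceil>"]
      proof eventually_elim
        case (elim n)
        then have "s * x \<le> real n" by linarith
        then show ?case by (simp add: min_def)
      qed
      then show "(\<lambda>n. ennreal (exp (min (s * x) (real n)))) \<longlonglongrightarrow> ennreal (exp (s * x))"
        by (rule tendsto_eventually)
    qed measurable
    moreover have "(\<integral>\<^sup>+x. ennreal (exp (s * x)) \<partial>?\<mu>) = top"
      using exp_moment_infinite[OF p(1) s]
      by (subst nn_integral_density) (auto simp: ennreal_mult[symmetric] p0 mult.commute)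
    moreover have "(\<integral>\<^sup>+x. ennreal (exp (min (s * x) (real n))) \<partial>?\<mu>) \<le> ennreal (1 + \<eta>)" for n
      unfolding nn by (rule ennreal_leI[OF less])
    ultimately have "top \<le> ennreal (1 + \<eta>)" by (auto intro: LIMSEQ_le_const2)
    then show False by (simp add: top_unique)
  qed
  then obtain n where n: "1 + \<eta> \<le> F (real n)" by blast
  have "\<exists>T\<ge>0. T \<le> real n \<and> F T = 1 + \<eta>"
    by (rule IVT') (use n F0 \<eta> cont in \<open>auto intro: continuous_on_subset\<close>)
  then show ?thesis using nn that by auto
qed

text \<open>
  Weigh by \<open>exp (min (s x) T)\<close>, tuned so that \<open>p\<close> has weight \<open>1 + \<eta>\<close>, with \<open>s\<close> so small that the excess
  \<open>\<eta>\<close> over \<open>1\<close> comes from far out. There the convolution square is at least \<open>2 (1 + \<eta>) p\<close>, so that its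
  weight would be at least about \<open>1 + 2 (1 + \<eta>) \<eta>\<close>. Submultiplicativity bounds that weight by
  \<open>(1 + \<eta>)\<^sup>2\<close>, which is smaller.
\<close>

lemma conv_constant_le_one:
  assumes p: "p \<in> long_tailed" "prob_density p" "\<forall>x<0. p x = 0" and \<eta>: "0 < \<eta>"
    and ge: "eventually (\<lambda>x. ennreal (2 * (1 + \<eta>) * p x) \<le> (\<integral>\<^sup>+t. ennreal (p (x - t) * p t) \<partial>lborel)) at_top"
  shows False
proof -
  define \<mu> where "\<mu> = density lborel (\<lambda>x. ennreal (p x))"
  have [measurable]: "p \<in> borel_measurable borel" and p0: "\<And>x. 0 \<le> p x"
    using p(2) by (auto simp: prob_density_def)
  have \<mu>D: "real_distribution \<mu>" unfolding \<mu>_def by (rule real_distribution_density[OF p(2)])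
  interpret \<mu>: real_distribution \<mu> by fact
  have ae: "AE x in \<mu>. 0 \<le> x"
    unfolding \<mu>_def by (rule AE_density_nonneg) (use p(3) in auto)
  have \<mu>neg: "emeasure \<mu> {..<0} = 0"
    unfolding \<mu>_def by (rule emeasure_density_neg) (use p(3) in auto)
  define c where "c x = (\<integral>\<^sup>+t. ennreal (p (x - t) * p t) \<partial>lborel)" for x
  have [measurable]: "c \<in> borel_measurable borel" unfolding c_def by measurable
  have conv: "(\<mu> \<star> \<mu>) = density lborel c"
    unfolding \<mu>_def
    by (subst convolution_density)
       (use real_distributionD[OF \<mu>D] in \<open>auto simp: \<mu>_def c_def[abs_def] ennreal_mult p0\<close>)
  define \<kappa> where "\<kappa> = \<eta>\<^sup>2 / (8 * (1 + \<eta>))"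
  have \<kappa>: "0 < \<kappa>" using \<eta> by (simp add: \<kappa>_def)
  have RD: "real_distribution (\<mu> \<star> \<mu>)" by (rule real_distribution_convolution[OF \<mu>D \<mu>D])
  interpret C: real_distribution "\<mu> \<star> \<mu>" by (rule RD)
  obtain X where X: "\<And>x. X \<le> x \<Longrightarrow> ennreal (2 * (1 + \<eta>) * p x) \<le> c x"
    using ge unfolding eventually_at_top_linorder c_def by blast
  have "0 < \<eta>\<^sup>2 / 4" using \<eta> by simp
  from tail_le[OF RD this] obtain A0 where A0: "\<And>A. A0 \<le> A \<Longrightarrow> measure (\<mu> \<star> \<mu>) {A<..} \<le> \<eta>\<^sup>2 / 4"
    unfolding eventually_at_top_linorder by blast
  \<comment> \<open>beyond \<open>A\<close> the assumed inequality holds, and \<open>\<mu> \<star> \<mu>\<close> has little mass\<close>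
  define A where "A = max 1 (max X (A0 + 1))"
  have A: "1 \<le> A" "X \<le> A" "A0 \<le> A - 1" by (auto simp: A_def)
  have head: "1 - \<eta>\<^sup>2 / 4 \<le> C.prob {..<A}"
  proof -
    have "C.prob {A - 1<..} = 1 - C.prob {..A - 1}"
      using C.prob_compl[of "{..A - 1}"] by (simp add: Compl_eq_Diff_UNIV[symmetric] flip: Compl_atMost)
    moreover have "C.prob {..A - 1} \<le> C.prob {..<A}" by (rule C.finite_measure_mono) auto
    ultimately show ?thesis using A0[OF A(3)] by simp
  qed
  \<comment> \<open>the weight is at most \<open>1 + \<kappa>\<close> up to \<open>A\<close>\<close>
  define s where "s = ln (1 + \<kappa>) / A"
  have s: "0 < s" "s * A = ln (1 + \<kappa>)" using A(1) \<kappa> by (auto simp: s_def)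
  obtain T where T: "0 \<le> T" "(\<integral>\<^sup>+x. ennreal (exp (min (s * x) T)) \<partial>\<mu>) = ennreal (1 + \<eta>)"
    unfolding \<mu>_def by (rule tuned_exponential_weight[OF p s(1) \<eta>])
  define W where "W x = exp (min (s * x) T)" for x
  have [measurable]: "W \<in> borel_measurable borel" unfolding W_def by measurable
  have W0: "0 \<le> W x" for x by (simp add: W_def)
  have W1: "1 \<le> W x" if "0 \<le> x" for x using that s(1) T(1) by (simp add: W_def)
  have Wsub: "W (x + y) \<le> W x * W y" if "0 \<le> x" "0 \<le> y" for x y
  proof -
    have "0 \<le> s * x" "0 \<le> s * y" using that s by auto
    then have "min (s * (x + y)) T \<le> min (s * x) T + min (s * y) T"
      using T(1) by (auto simp: min_def distrib_left)
    then show ?thesis by (simp add: W_def exp_add[symmetric])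
  qed
  have Whead: "W x \<le> 1 + \<kappa>" if "x \<le> A" for x
  proof -
    have "min (s * x) T \<le> s * A" using that s(1) by (auto intro: min.coboundedI1)
    then have "W x \<le> exp (ln (1 + \<kappa>))" unfolding W_def s(2)[symmetric] by simp
    then show ?thesis using \<kappa> by simp
  qed
  define J where "J = (\<integral>\<^sup>+x. ennreal (W x) * indicator {A..} x \<partial>\<mu>)"
  have total: "(\<integral>\<^sup>+x. ennreal (W x) \<partial>\<mu>) = ennreal (1 + \<eta>)" using T(2) by (simp add: W_def)
  have "J \<le> (\<integral>\<^sup>+x. ennreal (W x) \<partial>\<mu>)" unfolding J_def by (rule nn_integral_mono) (auto simp: indicator_def)
  then obtain j where j: "J = ennreal j" "0 \<le> j" unfolding total by (cases J) (auto simp: top_unique)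
  have "ennreal (1 + \<eta>) = (\<integral>\<^sup>+x. ennreal (W x) * indicator {A..} x + ennreal (W x) * indicator {..<A} x \<partial>\<mu>)"
    unfolding total[symmetric] by (rule nn_integral_cong) (auto simp: indicator_def)
  also have "\<dots> = J + (\<integral>\<^sup>+x. ennreal (W x) * indicator {..<A} x \<partial>\<mu>)"
    unfolding J_def by (rule nn_integral_add) (auto simp: \<mu>_def)
  also have "(\<integral>\<^sup>+x. ennreal (W x) * indicator {..<A} x \<partial>\<mu>) \<le> (\<integral>\<^sup>+x. ennreal (1 + \<kappa>) \<partial>\<mu>)"
    by (rule nn_integral_mono) (auto simp: indicator_def intro!: ennreal_leI Whead)
  also have "\<dots> = ennreal (1 + \<kappa>)" using \<mu>.emeasure_space_1 by simp
  finally have "ennreal (1 + \<eta>) \<le> ennreal (j + (1 + \<kappa>))"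
    using j \<kappa> by (simp add: add_left_mono ennreal_plus)
  then have jl: "\<eta> - \<kappa> \<le> j" using j \<kappa> by (subst (asm) ennreal_le_iff) auto
  have aeC: "AE x in \<mu> \<star> \<mu>. 0 \<le> x"
    by (rule AE_nonneg[OF _ convolution_nonneg[OF \<mu>D \<mu>neg \<mu>D \<mu>neg]]) simp
  have "ennreal (C.prob {..<A}) = (\<integral>\<^sup>+x. indicator {..<A} x \<partial>(\<mu> \<star> \<mu>))"
    by (simp add: C.emeasure_eq_measure)
  also have "\<dots> \<le> (\<integral>\<^sup>+x. ennreal (W x) * indicator {..<A} x \<partial>(\<mu> \<star> \<mu>))"
  proof (rule nn_integral_mono_AE, use aeC in eventually_elim)
    fix x :: real assume "0 \<le> x"
    then have "ennreal 1 \<le> ennreal (W x)" by (intro ennreal_leI W1)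
    then show "indicator {..<A} x \<le> ennreal (W x) * indicator {..<A} x" by (auto simp: indicator_def)
  qed
  also have "\<dots> = (\<integral>\<^sup>+x. c x * (ennreal (W x) * indicator {..<A} x) \<partial>lborel)"
    unfolding conv by (subst nn_integral_density) auto
  finally have body: "ennreal (C.prob {..<A}) \<le> (\<integral>\<^sup>+x. c x * (ennreal (W x) * indicator {..<A} x) \<partial>lborel)" .
  have "ennreal (2 * (1 + \<eta>)) * J = (\<integral>\<^sup>+x. ennreal (2 * (1 + \<eta>)) * (ennreal (p x) * (ennreal (W x) * indicator {A..} x)) \<partial>lborel)"
    unfolding J_def \<mu>_def by (subst nn_integral_density) (auto simp: nn_integral_cmult)
  also have "\<dots> \<le> (\<integral>\<^sup>+x. c x * (ennreal (W x) * indicator {A..} x) \<partial>lborel)"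
  proof (rule nn_integral_mono)
    fix x
    have "ennreal (2 * (1 + \<eta>)) * ennreal (p x) \<le> c x" if "A \<le> x"
    proof -
      have "ennreal (2 * (1 + \<eta>)) * ennreal (p x) = ennreal (2 * (1 + \<eta>) * p x)"
        by (rule ennreal_mult[symmetric]) (use \<eta> p0 in auto)
      also have "\<dots> \<le> c x" using that A(2) by (intro X) simp
      finally show ?thesis .
    qed
    then show "ennreal (2 * (1 + \<eta>)) * (ennreal (p x) * (ennreal (W x) * indicator {A..} x)) \<le> c x * (ennreal (W x) * indicator {A..} x)"
      by (auto simp: indicator_def mult.assoc[symmetric] intro!: mult_right_mono)
  qed
  finally have tail: "ennreal (2 * (1 + \<eta>)) * J \<le> (\<integral>\<^sup>+x. c x * (ennreal (W x) * indicator {A..} x) \<partial>lborel)" .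
  note add_mono[OF body tail]
  also have "(\<integral>\<^sup>+x. c x * (ennreal (W x) * indicator {..<A} x) \<partial>lborel) + (\<integral>\<^sup>+x. c x * (ennreal (W x) * indicator {A..} x) \<partial>lborel)
      = (\<integral>\<^sup>+x. c x * ennreal (W x) \<partial>lborel)"
    by (subst nn_integral_add[symmetric]) (auto intro!: nn_integral_cong simp: indicator_def)
  also have "\<dots> = (\<integral>\<^sup>+x. ennreal (W x) \<partial>(\<mu> \<star> \<mu>))"
    unfolding conv by (subst nn_integral_density) auto
  also have "\<dots> = (\<integral>\<^sup>+x. \<integral>\<^sup>+y. ennreal (W (x + y)) \<partial>\<mu> \<partial>\<mu>)"
    by (rule nn_integral_conv[OF \<mu>D \<mu>D]) measurable
  also have "\<dots> \<le> (\<integral>\<^sup>+x. \<integral>\<^sup>+y. ennreal (W x) * ennreal (W y) \<partial>\<mu> \<partial>\<mu>)"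
  proof (rule nn_integral_mono_AE, use ae in eventually_elim)
    fix x :: real assume x: "0 \<le> x"
    show "(\<integral>\<^sup>+y. ennreal (W (x + y)) \<partial>\<mu>) \<le> (\<integral>\<^sup>+y. ennreal (W x) * ennreal (W y) \<partial>\<mu>)"
      by (rule nn_integral_mono_AE, use ae in eventually_elim)
         (use x Wsub W0 in \<open>auto simp: ennreal_mult[symmetric] intro!: ennreal_leI\<close>)
  qed
  also have "\<dots> = ennreal (1 + \<eta>) * ennreal (1 + \<eta>)"
    by (simp add: nn_integral_cmult nn_integral_multc total \<mu>_def flip: \<mu>_def)
  finally have "ennreal (C.prob {..<A}) + ennreal (2 * (1 + \<eta>)) * J \<le> ennreal (1 + \<eta>) * ennreal (1 + \<eta>)" .
  then have "ennreal (C.prob {..<A} + 2 * (1 + \<eta>) * j) \<le> ennreal ((1 + \<eta>) * (1 + \<eta>))"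
    using \<eta> j by (simp add: ennreal_mult ennreal_plus)
  then have "C.prob {..<A} + 2 * (1 + \<eta>) * j \<le> (1 + \<eta>) * (1 + \<eta>)"
    using \<eta> by (subst (asm) ennreal_le_iff) auto
  moreover have "2 * (1 + \<eta>) * (\<eta> - \<kappa>) \<le> 2 * (1 + \<eta>) * j" using jl \<eta> by (intro mult_left_mono) auto
  moreover have "2 * (1 + \<eta>) * \<kappa> = \<eta>\<^sup>2 / 4" using \<eta> by (simp add: \<kappa>_def field_simps)
  ultimately have "\<eta>\<^sup>2 \<le> \<eta>\<^sup>2 / 2" using head by (simp add: power2_eq_square algebra_simps)
  then show False using \<eta> by simp
qed

section \<open>Densities comparable to the Levy measure\<close>

text \<open>
  The integrand \<open>p (x - t) p t\<close> is symmetric under \<open>t \<mapsto> x - t\<close>, so weighting one factor by its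
  argument amounts to multiplying the convolution by \<open>x / 2\<close>.
\<close>

lemma size_bias_self_convolution:
  fixes p :: "real \<Rightarrow> real"
  assumes [measurable]: "p \<in> borel_measurable borel" and p0: "\<forall>x<0. p x = 0"
  shows "2 * (\<integral>\<^sup>+v. ennreal (x - v) * ennreal (p (x - v) * p v) \<partial>lborel) =
    ennreal x * (\<integral>\<^sup>+v. ennreal (p (x - v) * p v) \<partial>lborel)"
proof -
  let ?f = "\<lambda>v. ennreal (p (x - v) * p v)"
  have "(\<integral>\<^sup>+v. ennreal (x - v) * ?f v \<partial>lborel) = (\<integral>\<^sup>+v. ennreal v * ?f v \<partial>lborel)"
    by (subst nn_integral_reflect[symmetric, of _ x], measurable)
       (auto intro!: nn_integral_cong simp: mult.commute)
  then have "2 * (\<integral>\<^sup>+v. ennreal (x - v) * ?f v \<partial>lborel) =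
      (\<integral>\<^sup>+v. ennreal (x - v) * ?f v \<partial>lborel) + (\<integral>\<^sup>+v. ennreal v * ?f v \<partial>lborel)"
    by (simp add: mult_2)
  also have "\<dots> = (\<integral>\<^sup>+v. ennreal (x - v) * ?f v + ennreal v * ?f v \<partial>lborel)"
    by (rule nn_integral_add[symmetric]) measurable
  also have "\<dots> = (\<integral>\<^sup>+v. ennreal x * ?f v \<partial>lborel)"
  proof (rule nn_integral_cong)
    fix v
    show "ennreal (x - v) * ?f v + ennreal v * ?f v = ennreal x * ?f v"
    proof (cases "0 \<le> v \<and> v \<le> x")
      case True
      then show ?thesis by (simp add: distrib_right[symmetric] ennreal_plus[symmetric] del: ennreal_plus)
    next
      case False
      then have "v < 0 \<or> x - v < 0" by auto
      then show ?thesis using p0 by auto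
    qed
  qed
  also have "\<dots> = ennreal x * (\<integral>\<^sup>+v. ?f v \<partial>lborel)" by (rule nn_integral_cmult) measurable
  finally show ?thesis .
qed

context levy_density
begin

lemma nn_integral_average_levy_window:
  assumes "0 < c"
  shows "(\<integral>\<^sup>+v. ennreal (levy_window \<nu> c (x - v)) * ennreal (p v) \<partial>lborel) = ennreal (average \<mu> (levy_window \<nu> c) x)"
proof -
  have w: "window_function (levy_window \<nu> c)" by (rule window_function_levy_window[OF L(3) assms])
  note [measurable] = window_functionD(1)[OF w]
  show ?thesis unfolding ennreal_average[OF w L(1,2)] by (subst nn_integral_\<mu>) (auto simp: mult.commute)
qed

text \<open>
  If \<open>p\<close> is asymptotic to \<open>C\<close> times the Levy windows, then in the size-bias identity the weighted Levy
  windows may be replaced by \<open>x p x / C\<close>, which turns it into \<open>x p x \<approx> (x / 2 C) (p \<otimes> p) x\<close>.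
\<close>

lemma levy_density_conv_limit:
  assumes p: "p \<in> long_tailed" and C: "0 < C"
    and eq: "tail_equiv p (\<lambda>x. C * measure \<nu> {x<..x + 1})" and \<epsilon>: "0 < \<epsilon>"
  shows "eventually (\<lambda>x. \<exists>r. (\<integral>\<^sup>+t. ennreal (p (x - t) * p t) \<partial>lborel) = ennreal r \<and>
    \<bar>r - 2 * C * p x\<bar> \<le> \<epsilon> * p x) at_top"
proof -
  define n where "n = levy_window \<nu> 1"
  have w: "window_function n" unfolding n_def by (rule window_function_levy_window[OF L(3)]) simp
  note [measurable] = window_functionD(1)[OF w] and [measurable_cong] = real_distributionD(4)[OF L(1)]
  have n0: "0 \<le> n x" for x by (rule window_functionD(2)[OF w])
  have n_asymp: "size_bias_asymp p n (1 / C)"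
  proof (rule size_bias_asymp_of_windows)
    show "tail_equiv (\<lambda>x. measure \<nu> {x<..x + 1}) (\<lambda>x. 1 / C * p x)"
      using tail_equiv_cmult[OF tail_equiv_sym[OF eq], of "1 / C"] C by simp
    show "eventually (\<lambda>x. x * measure \<nu> {x<..x + 1} \<le> n x \<and> n x \<le> (x + 1) * measure \<nu> {x<..x + 1}) at_top"
      using eventually_gt_at_top[of 0] unfolding n_def by eventually_elim (use levy_window_bounds[OF L(3)] in auto)
  qed (use C in auto)
  define e where "e = min (1/2) (\<epsilon> / (16 * C))"
  have e: "0 < e" "e \<le> 1/2" "16 * (C * e) \<le> \<epsilon>" "0 < C * e" "0 < e / C"
  proof -
    show e1: "0 < e" using \<epsilon> C by (simp add: e_def)
    show "e \<le> 1/2" unfolding e_def by (rule min.cobounded1)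
    have "C * e \<le> C * (\<epsilon> / (16 * C))" using C by (intro mult_left_mono) (auto simp: e_def)
    then show "16 * (C * e) \<le> \<epsilon>" using C by simp
    show "0 < C * e" "0 < e / C" using e1 C by auto
  qed
  obtain A0 where A0: "\<And>y. A0 \<le> y \<Longrightarrow> (1 / C - e / C) * (y * p y) \<le> n y \<and> n y \<le> (1 / C + e / C) * (y * p y)"
    using size_bias_asympD[OF n_asymp e(5)] unfolding eventually_at_top_linorder by blast
  define A where "A = max A0 1"
  have A: "A0 \<le> A" "1 \<le> A" by (auto simp: A_def)
  define k where "k = (1 + e) / C"
  have k: "0 < k" using e C by (simp add: k_def)
  have lower: "n y \<le> k * (y * p y)" if "A \<le> y" for y
    using A0[of y] A that by (simp add: k_def add_divide_distrib)
  have upper: "y * p y \<le> (1 + 2 * e) * C * n y" if y: "A \<le> y" for y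
  proof -
    have "1 \<le> (1 + 2 * e) * (1 - e)" using e mult_left_mono[OF e(2), of e] by (simp add: algebra_simps)
    then have "1 * (y * p y) \<le> (1 + 2 * e) * (1 - e) * (y * p y)" using y A pn by (intro mult_right_mono) auto
    also have "\<dots> = (1 + 2 * e) * C * ((1 / C - e / C) * (y * p y))" using C by (simp add: field_simps)
    also have "\<dots> \<le> (1 + 2 * e) * C * n y" using A0[of y] y A e C by (intro mult_left_mono) auto
    finally show ?thesis by simp
  qed
  show ?thesis
    using size_bias_asympD[OF size_biased_density_window[OF p zero_less_one, folded n_def] e(1)]
      average_far_part[OF p L(1) density_locally_dominated[OF p] w e(1), of A]
      long_tailed_uniform[OF p zero_less_one, of A] eventually_ge_at_top[of "max (2 * A) (8 * A / \<epsilon>)"]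
  proof eventually_elim
    case (elim x)
    have x: "2 * A \<le> x" "0 < x" "8 * A \<le> \<epsilon> * x" using elim(4) A \<epsilon> by (auto simp: divide_le_eq mult.commute)
    have px: "0 < p x" using elim(3)[rule_format, of 0] A by simp
    define a where "a = average \<mu> n x"
    have a: "0 \<le> a" "(1 - e) * (x * p x) \<le> a" "a \<le> (1 + e) * (x * p x)"
      using elim(1) average_nonneg[OF w] by (auto simp: a_def)
    have an: "(\<integral>\<^sup>+v. ennreal (n (x - v)) * ennreal (p v) \<partial>lborel) = ennreal a"
      unfolding a_def n_def by (rule nn_integral_average_levy_window) simp
    let ?f = "\<lambda>v. ennreal (p (x - v) * p v)"
    define I where "I = (\<integral>\<^sup>+v. ennreal (x - v) * ?f v \<partial>lborel)"
    define c where "c = (\<integral>\<^sup>+v. ?f v \<partial>lborel)"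
    have Ic: "2 * I = ennreal x * c" unfolding I_def c_def by (rule size_bias_self_convolution[OF pm p0])
    have one: "(\<integral>\<^sup>+v. ennreal (p (x - v)) \<partial>lborel) = 1"
      using pd by (subst nn_integral_reflect) (auto simp: prob_density_def)
    have "I \<le> (\<integral>\<^sup>+v. ennreal ((1 + 2 * e) * C) * (ennreal (n (x - v)) * ennreal (p v))
        + ennreal (A * (2 * p x)) * ennreal (p (x - v)) \<partial>lborel)"
      unfolding I_def
    proof (rule nn_integral_mono)
      fix v
      consider "v \<le> x - A" | "x - A < v" "v \<le> x" | "x < v" by linarith
      then show "ennreal (x - v) * ?f v \<le> ennreal ((1 + 2 * e) * C) * (ennreal (n (x - v)) * ennreal (p v))
        + ennreal (A * (2 * p x)) * ennreal (p (x - v))"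
      proof cases
        case 1
        have "(x - v) * p (x - v) * p v \<le> (1 + 2 * e) * C * n (x - v) * p v"
          using upper[of "x - v"] 1 by (intro mult_right_mono pn) auto
        then have "ennreal (x - v) * ?f v \<le> ennreal ((1 + 2 * e) * C) * (ennreal (n (x - v)) * ennreal (p v))"
          using 1 A e C n0 pn by (simp add: ennreal_mult[symmetric] mult.assoc ennreal_leI)
        then show ?thesis by (rule order_trans) simp
      next
        case 2
        have "p v \<le> 2 * p x" using elim(3)[rule_format, of "v - x"] 2 by (simp add: abs_le_iff)
        then have "(x - v) * (p (x - v) * p v) \<le> A * (p (x - v) * (2 * p x))"
          using 2 A pn by (intro mult_mono) auto
        then have "ennreal (x - v) * ?f v \<le> ennreal (A * (2 * p x)) * ennreal (p (x - v))"
          using 2 A pn by (simp add: ennreal_mult[symmetric] mult_ac ennreal_leI)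
        then show ?thesis by (rule order_trans) simp
      next
        case 3
        then show ?thesis by (simp add: ennreal_neg)
      qed
    qed
    also have "\<dots> = ennreal ((1 + 2 * e) * C) * ennreal a + ennreal (A * (2 * p x)) * 1"
      by (subst nn_integral_add) (auto simp: nn_integral_cmult an one)
    also have "\<dots> = ennreal ((1 + 2 * e) * C * a + A * (2 * p x))"
      using e C a A px by (simp add: ennreal_mult ennreal_plus)
    also have "\<dots> \<le> ennreal ((1 + 2 * e) * C * ((1 + e) * (x * p x)) + A * (2 * p x))"
      using e C a by (intro ennreal_leI add_right_mono mult_left_mono) auto
    finally have I_le: "I \<le> ennreal ((1 + 2 * e) * C * ((1 + e) * (x * p x)) + A * (2 * p x))" .
    then obtain i where i: "I = ennreal i" "0 \<le> i" by (cases I) (auto simp: top_unique)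
    have i_le: "i \<le> (1 + 2 * e) * C * ((1 + e) * (x * p x)) + A * (2 * p x)"
      using I_le e C x A px unfolding i by (subst (asm) ennreal_le_iff) auto
    define r where "r = 2 * i / x"
    have c: "c = ennreal r"
    proof -
      have "ennreal x * c = ennreal x * ennreal r"
        unfolding Ic[symmetric] i using x i(2) by (simp add: r_def ennreal_mult[symmetric] ennreal_mult' numeral_2_eq_2 ennreal_plus)
      then show ?thesis using x by (simp add: ennreal_mult_cancel_left)
    qed
    have ir: "i = x * r / 2" using x by (simp add: r_def)
    have "x * r \<le> x * ((2 * C * ((1 + 2 * e) * (1 + e))) * p x) + 4 * A * p x" using i_le by (simp add: ir algebra_simps)
    also have "4 * A * p x \<le> (\<epsilon> * x / 2) * p x" using x px by (intro mult_right_mono) auto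
    finally have "x * r \<le> x * ((2 * C * ((1 + 2 * e) * (1 + e)) + \<epsilon> / 2) * p x)" by (simp add: algebra_simps)
    then have "r \<le> (2 * C * ((1 + 2 * e) * (1 + e)) + \<epsilon> / 2) * p x" using x by simp
    also have "\<dots> \<le> (2 * C + \<epsilon>) * p x"
    proof (intro mult_right_mono)
      have "(1 + 2 * e) * (1 + e) \<le> 1 + 4 * e" using e mult_left_mono[OF e(2), of e] by (simp add: algebra_simps)
      then have "2 * C * ((1 + 2 * e) * (1 + e)) \<le> 2 * C * (1 + 4 * e)" using C by (intro mult_left_mono) auto
      also have "\<dots> = 2 * C + 16 * (C * e) / 2" by (simp add: algebra_simps)
      finally show "2 * C * ((1 + 2 * e) * (1 + e)) + \<epsilon> / 2 \<le> 2 * C + \<epsilon>" using e(3) by simp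
    qed (use px in simp)
    finally have up: "r - 2 * C * p x \<le> \<epsilon> * p x" by (simp add: algebra_simps)
    have "ennreal a = (\<integral>\<^sup>+v. ennreal (n (x - v)) * ennreal (p v) \<partial>lborel)" by (rule an[symmetric])
    also have "\<dots> \<le> (\<integral>\<^sup>+v. ennreal k * (ennreal (x - v) * ?f v)
        + ennreal (p v) * (ennreal (n (x - v)) * indicator {x - A<..} v) \<partial>lborel)"
    proof (rule nn_integral_mono)
      fix v
      show "ennreal (n (x - v)) * ennreal (p v) \<le>
          ennreal k * (ennreal (x - v) * ?f v) + ennreal (p v) * (ennreal (n (x - v)) * indicator {x - A<..} v)"
      proof (cases "v \<le> x - A")
        case True
        have "n (x - v) * p v \<le> k * ((x - v) * p (x - v)) * p v"
          using lower[of "x - v"] True by (intro mult_right_mono pn) auto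
        then have "ennreal (n (x - v)) * ennreal (p v) \<le> ennreal k * (ennreal (x - v) * ?f v)"
          using True A k n0 pn by (simp add: ennreal_mult[symmetric] mult.assoc ennreal_leI)
        then show ?thesis by (rule order_trans) simp
      next
        case False
        then show ?thesis by (simp add: mult.commute add_increasing)
      qed
    qed
    also have "\<dots> = ennreal k * I + (\<integral>\<^sup>+v. ennreal (n (x - v)) * indicator {x - A<..} v \<partial>\<mu>)"
      unfolding I_def by (subst nn_integral_add, measurable, subst nn_integral_\<mu>) (auto simp: nn_integral_cmult)
    also have "\<dots> \<le> ennreal k * ennreal i + ennreal (e * (x * p x))"
      unfolding i(1) by (rule add_left_mono[OF elim(2)])
    also have "\<dots> = ennreal (k * i + e * (x * p x))" using k i e x px by (simp add: ennreal_mult ennreal_plus)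
    finally have "a \<le> k * i + e * (x * p x)" using k i e x px by (subst (asm) ennreal_le_iff) auto
    with a(2) have "x * ((1 - 2 * e) * p x) \<le> x * (k * r / 2)" by (simp add: ir algebra_simps)
    then have "(1 - 2 * e) * p x \<le> k * r / 2" using x by simp
    then have "2 * C * ((1 - 2 * e) * p x) \<le> 2 * C * (k * r / 2)" using C by (intro mult_left_mono) auto
    also have "\<dots> = r + e * r" using C by (simp add: k_def field_simps)
    finally have l1: "2 * C * p x - 4 * (C * e) * p x \<le> r + e * r" by (simp add: algebra_simps)
    have \<epsilon>p: "0 \<le> \<epsilon> * p x" using \<epsilon> px by simp
    have "2 * C * p x - r \<le> \<epsilon> * p x"
    proof (cases "r \<le> 2 * C * p x")
      case True
      then have "e * r \<le> e * (2 * C * p x)" using e by (intro mult_left_mono) auto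
      then have "2 * C * p x - r \<le> (6 * (C * e)) * p x" using l1 by (simp add: algebra_simps)
      also have "\<dots> \<le> \<epsilon> * p x"
      proof (intro mult_right_mono)
        show "6 * (C * e) \<le> \<epsilon>" using e(3,4) by linarith
      qed (use px in simp)
      finally show ?thesis .
    qed (use \<epsilon>p in simp)
    then show ?case using c up unfolding c_def by (intro exI[of _ r]) (auto simp: abs_le_iff)
  qed
qed

text \<open>
  The limit \<open>2 C\<close> of \<open>(p \<otimes> p) / p\<close> is at least \<open>2\<close> because of the two ends of the convolution integral, and
  at most \<open>2\<close> by the argument with exponential weights.
\<close>

lemma levy_density_equiv_imp_subexp:
  assumes p: "p \<in> long_tailed" and C: "0 < C"
    and eq: "tail_equiv p (\<lambda>x. C * measure \<nu> {x<..x + 1})"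
  shows "p \<in> subexp_densities" "C = 1"
proof -
  note lim = levy_density_conv_limit[OF p C eq]
  note pos = long_tailedD(3)[OF p]
  have "\<not> 1 < C"
  proof
    assume C1: "1 < C"
    have "eventually (\<lambda>x. ennreal (2 * (1 + (C - 1) / 2) * p x) \<le> (\<integral>\<^sup>+t. ennreal (p (x - t) * p t) \<partial>lborel)) at_top"
    proof -
      have "0 < C - 1" using C1 by simp
      from lim[OF this] show ?thesis
      proof eventually_elim
        case (elim x)
        then obtain r where r: "(\<integral>\<^sup>+t. ennreal (p (x - t) * p t) \<partial>lborel) = ennreal r" "\<bar>r - 2 * C * p x\<bar> \<le> (C - 1) * p x"
          by blast
        have "2 * (1 + (C - 1) / 2) * p x = 2 * C * p x - (C - 1) * p x" by (simp add: field_simps)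
        also have "\<dots> \<le> r" using r(2) by linarith
        finally show ?case unfolding r(1) by (rule ennreal_leI)
      qed
    qed
    then show False using conv_constant_le_one[OF p pd p0, of "(C - 1) / 2"] C1 by simp
  qed
  moreover have "\<not> C < 1"
  proof
    assume C1: "C < 1"
    define \<delta> where "\<delta> = min (1/2) ((1 - C) / 4)"
    have "\<delta> \<le> (1 - C) / 4" unfolding \<delta>_def by (rule min.cobounded2)
    then have \<delta>: "0 < \<delta>" "\<delta> \<le> 1/2" "4 * \<delta> \<le> 1 - C" using C1 by (auto simp: \<delta>_def)
    obtain A where A: "eventually (\<lambda>x. ennreal (2 * (1 - \<delta>)\<^sup>2 * p x) +
      (\<integral>\<^sup>+t. ennreal (p (x - t) * p t) * indicator {A..x - A} t \<partial>lborel)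
        \<le> (\<integral>\<^sup>+t. ennreal (p (x - t) * p t) \<partial>lborel)) at_top"
      using long_tailed_conv_ends[OF p pd p0 \<delta>(1,2)] by blast
    have "0 < (1 - C) / 2" using C1 by simp
    from lim[OF this] have "eventually (\<lambda>x. False) (at_top :: real filter)"
      using A pos
    proof eventually_elim
      case (elim x)
      then obtain r where r: "(\<integral>\<^sup>+t. ennreal (p (x - t) * p t) \<partial>lborel) = ennreal r" "\<bar>r - 2 * C * p x\<bar> \<le> (1 - C) / 2 * p x"
        by blast
      have "ennreal (2 * (1 - \<delta>)\<^sup>2 * p x) \<le> ennreal r"
        using elim(2) unfolding r(1) by (rule order_trans[rotated]) simp
      moreover have "0 < 2 * (1 - \<delta>)\<^sup>2 * p x" using \<delta> elim(3) by simp
      ultimately have "2 * (1 - \<delta>)\<^sup>2 * p x \<le> r" by (meson ennreal_le_iff2 leD)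
      also have "r \<le> 2 * C * p x + (1 - C) / 2 * p x" using r(2) by linarith
      also have "\<dots> = (2 * C + (1 - C) / 2) * p x" by (simp only: distrib_right)
      finally have "2 * (1 - \<delta>)\<^sup>2 \<le> 2 * C + (1 - C) / 2" using elim(3) by (subst (asm) mult_le_cancel_right_pos) auto
      moreover have "2 - 4 * \<delta> \<le> 2 * (1 - \<delta>)\<^sup>2" by (simp add: power2_eq_square algebra_simps)
      ultimately have "2 - 4 * \<delta> \<le> 2 * C + (1 - C) / 2" by (rule order_trans[rotated])
      then show False using \<delta>(3) C1 by (simp add: field_simps)
    qed
    then show False by (simp add: trivial_limit_at_top_linorder)
  qed
  ultimately show C1: "C = 1" by simp
  have close: "eventually (\<lambda>x. 0 < p x \<and> \<bar>density_conv p p x - 2 * p x\<bar> \<le> \<epsilon> * (2 * p x)) at_top" if \<epsilon>: "0 < \<epsilon>" for \<epsilon>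
  proof -
    have "0 < min 1 (2 * \<epsilon>)" using \<epsilon> by simp
    from lim[OF this] pos show ?thesis
    proof eventually_elim
      case (elim x)
      then obtain r where r: "(\<integral>\<^sup>+t. ennreal (p (x - t) * p t) \<partial>lborel) = ennreal r" "\<bar>r - 2 * p x\<bar> \<le> min 1 (2 * \<epsilon>) * p x"
        unfolding C1 by auto
      have "min 1 (2 * \<epsilon>) * p x \<le> 1 * p x" using elim by (intro mult_right_mono) auto
      with r(2) elim(2) have r0: "0 \<le> r" by linarith
      have "density_conv p p x = r"
        unfolding density_conv_def
        by (subst integral_eq_nn_integral) (use long_tailedD(1)[OF p] r(1) r0 pn in auto)
      moreover have "min 1 (2 * \<epsilon>) * p x \<le> 2 * \<epsilon> * p x" using elim by (intro mult_right_mono) auto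
      with r(2) have "\<bar>r - 2 * p x\<bar> \<le> \<epsilon> * (2 * p x)" by linarith
      ultimately show ?case using elim(2) by simp
    qed
  qed
  have "tail_equiv (density_conv p p) (\<lambda>x. 2 * p x)"
  proof (rule tail_equivI_ratio)
    show "eventually (\<lambda>x. 0 < 2 * p x) at_top" using pos by eventually_elim simp
    show "eventually (\<lambda>x. \<bar>density_conv p p x - 2 * p x\<bar> \<le> \<epsilon> * (2 * p x)) at_top" if "0 < \<epsilon>" for \<epsilon>
      using close[OF that] by eventually_elim simp
  qed
  then show "p \<in> subexp_densities"
    using p pd by (simp add: subexp_densities_def long_tailed_densities_def)
qed

end

section \<open>Long-tailed densities with locally subexponential Levy measure\<close>

text \<open>
  The converse of the replacement of a measure by its window masses.
\<close>

lemma window_density_le_nn_integral: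
  fixes f F :: "real \<Rightarrow> ennreal"
  assumes \<sigma>: "sigma_finite_measure \<sigma>" "sets \<sigma> = sets borel"
    and [measurable]: "f \<in> borel_measurable borel" "F \<in> borel_measurable borel"
    and le: "\<And>v t. a < t \<Longrightarrow> t \<le> b \<Longrightarrow> t < v \<Longrightarrow> v \<le> t + 1 \<Longrightarrow> f t \<le> F v"
  shows "(\<integral>\<^sup>+t. f t * emeasure \<sigma> {t<..t + 1} * indicator {a<..b} t \<partial>lborel)
    \<le> (\<integral>\<^sup>+v. F v * indicator {a<..} v \<partial>\<sigma>)"
proof -
  note [measurable_cong] = \<sigma>(2)
  interpret \<sigma>: sigma_finite_measure \<sigma> by fact
  interpret P: pair_sigma_finite \<sigma> lborel ..
  have "(\<integral>\<^sup>+t. f t * emeasure \<sigma> {t<..t + 1} * indicator {a<..b} t \<partial>lborel) =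
      (\<integral>\<^sup>+t. \<integral>\<^sup>+v. f t * indicator {a<..b} t * (if t < v \<and> v \<le> t + 1 then 1 else 0) \<partial>\<sigma> \<partial>lborel)"
  proof (intro nn_integral_cong)
    fix t
    have "(\<integral>\<^sup>+v. f t * indicator {a<..b} t * (if t < v \<and> v \<le> t + 1 then 1 else 0) \<partial>\<sigma>) =
        (\<integral>\<^sup>+v. f t * indicator {a<..b} t * indicator {t<..t + 1} v \<partial>\<sigma>)"
      by (intro nn_integral_cong) (auto simp: indicator_def)
    also have "\<dots> = f t * indicator {a<..b} t * emeasure \<sigma> {t<..t + 1}"
      by (subst nn_integral_cmult_indicator) (auto simp: \<sigma>(2))
    finally show "f t * emeasure \<sigma> {t<..t + 1} * indicator {a<..b} t =
        (\<integral>\<^sup>+v. f t * indicator {a<..b} t * (if t < v \<and> v \<le> t + 1 then 1 else 0) \<partial>\<sigma>)" by (simp add: mult_ac)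
  qed
  also have "\<dots> = (\<integral>\<^sup>+v. \<integral>\<^sup>+t. f t * indicator {a<..b} t * (if t < v \<and> v \<le> t + 1 then 1 else 0) \<partial>lborel \<partial>\<sigma>)"
    by (rule P.Fubini') measurable
  also have "\<dots> \<le> (\<integral>\<^sup>+v. \<integral>\<^sup>+t. F v * indicator {a<..} v * indicator {v - 1..<v} t \<partial>lborel \<partial>\<sigma>)"
    by (intro nn_integral_mono) (auto simp: indicator_def intro: le)
  also have "\<dots> = (\<integral>\<^sup>+v. F v * indicator {a<..} v \<partial>\<sigma>)"
    by (intro nn_integral_cong) (simp add: nn_integral_cmult)
  finally show ?thesis .
qed

text \<open>
  Half of \<open>x (\<rho> \<star> \<rho>)(dx)\<close> is the convolution of \<open>x \<rho>(dx)\<close> with \<open>\<rho>\<close>, so its windows are asymptotic to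
  \<open>x \<rho>(x, x + 1]\<close>. Small values of the unweighted summand account for all of this.
\<close>

lemma loc_subexp_far_part_negligible:
  assumes \<rho>: "\<rho> \<in> loc_subexp" "levy_measure \<rho>" and \<epsilon>: "0 < \<epsilon>"
  shows "\<exists>A0. \<forall>A\<ge>A0. eventually (\<lambda>x. (\<integral>\<^sup>+v. ennreal (levy_window \<rho> 1 (x - v)) * indicator {A<..} v \<partial>\<rho>)
    \<le> ennreal (\<epsilon> * (x * measure \<rho> {x<..x + 1}))) at_top"
proof -
  have R: "real_distribution \<rho>" using \<rho>(1) by (simp add: loc_subexp_def)
  define q where "q x = measure \<rho> {x<..x + 1}" for x
  have q: "q \<in> long_tailed" and sub: "tail_equiv (\<lambda>x. measure (\<rho> \<star> \<rho>) {x<..x + 1}) (\<lambda>x. 2 * q x)"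
    using \<rho>(1) by (auto simp: loc_subexp_def q_def[abs_def])
  interpret \<rho>: real_distribution \<rho> by fact
  have neg: "emeasure \<rho> {..<0} = 0" using \<rho>(2) by (simp add: levy_measure_def)
  define N where "N = levy_window \<rho> 1"
  have w: "window_function N" unfolding N_def by (rule window_function_levy_window[OF \<rho>(2)]) simp
  note [measurable] = window_functionD(1)[OF w]
  define \<delta> where "\<delta> = \<epsilon> / 4"
  have \<delta>: "0 < \<delta>" "0 < 2 * \<delta>" using \<epsilon> by (auto simp: \<delta>_def)
  have self: "size_bias_asymp q (\<lambda>x. 2 * average \<rho> N x) 2"
  proof (rule size_bias_asymp_of_windows[OF sub])
    show "eventually (\<lambda>x. x * measure (\<rho> \<star> \<rho>) {x<..x + 1} \<le> 2 * average \<rho> N x \<and>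
        2 * average \<rho> N x \<le> (x + 1) * measure (\<rho> \<star> \<rho>) {x<..x + 1}) at_top"
      using eventually_ge_at_top[of 0] unfolding N_def
      by eventually_elim (rule self_convolution_windows[OF R \<rho>(2) zero_less_one])
  qed auto
  have low: "eventually (\<lambda>y. 1 * (y * q y) \<le> N y) at_top"
    using eventually_gt_at_top[of 0] by eventually_elim (use levy_window_bounds[OF \<rho>(2), of _ 1] in \<open>simp add: N_def q_def\<close>)
  obtain A0 where A0: "\<And>A. A0 \<le> A \<Longrightarrow> measure \<rho> {A<..} \<le> \<delta>"
    using tail_le[OF R \<delta>(1)] unfolding eventually_at_top_linorder by blast
  have "eventually (\<lambda>x. (\<integral>\<^sup>+v. ennreal (N (x - v)) * indicator {A<..} v \<partial>\<rho>) \<le> ennreal (\<epsilon> * (x * q x))) at_top"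
    if A: "A0 \<le> A" for A
  proof -
    have S: "{..A} \<in> sets (borel :: real measure)" by simp
    have mA: "1 - \<delta> \<le> \<rho>.prob {..A}"
      using A0[OF A] \<rho>.prob_compl[of "{A<..}"] by (simp add: Compl_eq_Diff_UNIV[symmetric])
    show ?thesis
      using size_bias_asympD[OF self \<delta>(2)] average_lower[OF q R neg zero_le_one low S \<delta>(1)] eventually_ge_at_top[of 0]
    proof eventually_elim
      case (elim x)
      let ?N = "\<lambda>v. ennreal (N (x - v))"
      define h where "h = x * q x"
      have h: "0 \<le> h" using elim(3) by (simp add: h_def q_def)
      define a where "a = average \<rho> N x"
      have a: "0 \<le> a" "a \<le> (1 + \<delta>) * h" using elim(1) average_nonneg[OF w] by (auto simp: a_def h_def algebra_simps)
      have "ennreal a = (\<integral>\<^sup>+v. ?N v * indicator {..A} v + ?N v * indicator {A<..} v \<partial>\<rho>)"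
        unfolding a_def ennreal_average[OF w R neg] by (rule nn_integral_cong) (auto simp: indicator_def)
      also have "\<dots> = (\<integral>\<^sup>+v. ?N v * indicator {..A} v \<partial>\<rho>) + (\<integral>\<^sup>+v. ?N v * indicator {A<..} v \<partial>\<rho>)"
        by (rule nn_integral_add) measurable
      finally have split: "ennreal a = (\<integral>\<^sup>+v. ?N v * indicator {..A} v \<partial>\<rho>) + (\<integral>\<^sup>+v. ?N v * indicator {A<..} v \<partial>\<rho>)" .
      have "(\<integral>\<^sup>+v. ?N v * indicator {A<..} v \<partial>\<rho>) \<le> ennreal a" unfolding split by simp
      then obtain b where b: "(\<integral>\<^sup>+v. ?N v * indicator {A<..} v \<partial>\<rho>) = ennreal b" "0 \<le> b"
        by (cases "\<integral>\<^sup>+v. ?N v * indicator {A<..} v \<partial>\<rho>") (auto simp: top_unique)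
      have "(1 - 2 * \<delta>) * h \<le> (1 * \<rho>.prob {..A} - \<delta>) * h" using mA h by (intro mult_right_mono) auto
      then have "ennreal ((1 - 2 * \<delta>) * h) \<le> (\<integral>\<^sup>+v. ?N v * indicator {..A} v \<partial>\<rho>)"
        using elim(2) unfolding h_def by (meson ennreal_leI order_trans)
      then have sum: "ennreal ((1 - 2 * \<delta>) * h) + ennreal b \<le> ennreal a"
        unfolding split b(1) by (rule add_right_mono)
      have "(1 - 2 * \<delta>) * h + b \<le> a"
      proof (cases "0 \<le> (1 - 2 * \<delta>) * h")
        case True
        then show ?thesis using sum b(2) a(1) by (simp add: ennreal_plus[symmetric] del: ennreal_plus)
      next
        case False
        then show ?thesis using sum b(2) a(1) by (simp add: ennreal_neg)
      qed
      then have "b \<le> (3 * \<delta>) * h" using a by (simp add: algebra_simps)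
      also have "\<dots> \<le> \<epsilon> * h" using \<epsilon> h by (intro mult_right_mono) (auto simp: \<delta>_def)
      finally show ?case unfolding b(1) h_def by (rule ennreal_leI)
    qed
  qed
  then show ?thesis unfolding N_def q_def by blast
qed

context levy_density
begin

definition q where "q x = measure \<rho> {x<..x + 1}"

lemma q_nonneg: "0 \<le> q x"
  by (simp add: q_def)

lemma levy_window_mass: "1 \<le> x \<Longrightarrow> measure \<nu> {x<..x + 1} = rate * q x"
  using NL(3,4) by (simp add: q_def)

lemma q_long_tailed: "\<rho> \<in> loc_long_tailed \<Longrightarrow> q \<in> long_tailed"
  by (auto simp: loc_long_tailed_def q_def[abs_def])

lemma loc_subexp_imp_loc_long_tailed: "\<rho> \<in> loc_subexp \<Longrightarrow> \<rho> \<in> loc_long_tailed"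
  by (auto simp: loc_subexp_def loc_long_tailed_def)

lemma levy_window_asymp:
  assumes "\<rho> \<in> loc_long_tailed"
  shows "size_bias_asymp q (levy_window \<nu> 1) rate"
proof (rule size_bias_asymp_of_windows[OF _ NL(3) zero_le_one])
  show "tail_equiv (\<lambda>x. measure \<nu> {x<..x + 1}) (\<lambda>x. rate * q x)"
  proof (rule tail_equivI_ratio)
    show pos: "eventually (\<lambda>x. 0 < rate * q x) at_top"
      using long_tailedD(3)[OF q_long_tailed[OF assms]] by eventually_elim (use NL(3) in simp)
    show "eventually (\<lambda>x. \<bar>measure \<nu> {x<..x + 1} - rate * q x\<bar> \<le> \<epsilon> * (rate * q x)) at_top" if "0 < \<epsilon>" for \<epsilon>
      using eventually_ge_at_top[of 1] pos by eventually_elim (use that in \<open>simp add: levy_window_mass\<close>)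
  qed
  show "eventually (\<lambda>x. x * measure \<nu> {x<..x + 1} \<le> levy_window \<nu> 1 x \<and>
      levy_window \<nu> 1 x \<le> (x + 1) * measure \<nu> {x<..x + 1}) at_top"
    using eventually_gt_at_top[of 0] by eventually_elim (use levy_window_bounds[OF L(3)] in auto)
qed

text \<open>
  A bound \<open>R\<close> for \<open>p / q\<close> on \<open>[A, x]\<close> enters the size-bias identity at \<open>x\<close> only through the middle part of
  the convolution, hence with a small factor.
\<close>

lemma density_ratio_bootstrap:
  assumes p: "p \<in> long_tailed" and sub: "\<rho> \<in> loc_subexp" and \<delta>: "0 < \<delta>"
  shows "\<exists>A\<ge>A1. eventually (\<lambda>x. \<forall>R\<ge>0. (\<forall>y\<in>{A..x}. p y \<le> R * q y) \<longrightarrow>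
    (1 - 2 * \<delta>) * p x \<le> rate * (1 + \<delta> + 4 * \<delta> * R) * q x) at_top"
proof -
  note rate = NL(3)
  note lt = loc_subexp_imp_loc_long_tailed[OF sub]
  note q = q_long_tailed[OF lt]
  note [measurable] = long_tailedD(1)[OF q]
    and [measurable_cong] = real_distributionD(4)[OF NL(1)] real_distributionD(4)[OF L(1)]
  interpret \<rho>: real_distribution \<rho> by (rule NL)
  interpret \<mu>: real_distribution \<mu> by (rule L)
  define n where "n = levy_window \<nu> 1"
  define N where "N = levy_window \<rho> 1"
  have w: "window_function n" unfolding n_def by (rule window_function_levy_window[OF L(3)]) simp
  have wN: "window_function N" unfolding N_def by (rule window_function_levy_window[OF NL(2)]) simp
  note [measurable] = window_functionD(1)[OF w] window_functionD(1)[OF wN]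
  have n0: "0 \<le> n x" "0 \<le> N x" for x using window_functionD(2)[OF w] window_functionD(2)[OF wN] by auto
  have nN: "n y = rate * N y" if "1 \<le> y" for y using NL(5)[OF that, of 1] rate by (simp add: n_def N_def)
  have Nq: "y * q y \<le> N y" "N y \<le> (y + 1) * q y" if "0 < y" for y
    using levy_window_bounds[OF NL(2) that, of 1] by (auto simp: N_def q_def)
  obtain A0 where A0: "\<And>A. A0 \<le> A \<Longrightarrow> eventually (\<lambda>x. (\<integral>\<^sup>+v. ennreal (N (x - v)) * indicator {A<..} v \<partial>\<rho>)
      \<le> ennreal (\<delta> * (x * q x))) at_top"
    using loc_subexp_far_part_negligible[OF sub NL(2) \<delta>] unfolding N_def q_def by blast
  have half: "(0::real) < 1/2" by simp
  obtain A2 where A2: "\<And>y a. A2 \<le> y \<Longrightarrow> \<bar>a\<bar> \<le> 1 \<Longrightarrow> 0 < q (y + a) \<and> \<bar>q (y + a) - q y\<bar> \<le> 1/2 * q y"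
    using long_tailed_uniform[OF q half, of 1] unfolding eventually_at_top_linorder by blast
  define A where "A = max A1 (max A0 (max A2 3))"
  have A: "A1 \<le> A" "A0 \<le> A" "A2 \<le> A" "3 \<le> A" by (auto simp: A_def)
  have shift: "n y \<le> 4 * rate * N y'" if y: "A \<le> y" "y - 1 \<le> y'" "y' < y" for y y'
  proof -
    have "\<bar>q y' - q y\<bar> \<le> 1/2 * q y" using A2[of y "y' - y"] y A by simp
    then have qy: "q y \<le> 2 * q y'" by linarith
    have "N y \<le> (y + 1) * q y" using Nq(2)[of y] y A by simp
    also have "\<dots> \<le> (2 * y') * (2 * q y')" using qy y A q_nonneg by (intro mult_mono) auto
    also have "\<dots> = 4 * (y' * q y')" by simp
    also have "y' * q y' \<le> N y'" using Nq(1)[of y'] y A by simp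
    finally have "rate * N y \<le> rate * (4 * N y')" using rate by (intro mult_left_mono) auto
    then show ?thesis using nN[of y] y A by simp
  qed
  obtain Y where Y: "\<And>y. Y \<le> y \<Longrightarrow> n y \<le> (rate + rate * (\<delta> / 2)) * (y * q y)"
    using size_bias_asympD[OF levy_window_asymp[OF lt], of "rate * (\<delta> / 2)"] rate \<delta>
    unfolding eventually_at_top_linorder n_def by auto
  have near: "eventually (\<lambda>x. \<forall>v\<in>{0..A}. n (x - v) \<le> (rate + rate * (\<delta> / 2) + rate * (\<delta> / 2)) * (x * q x)) at_top"
    by (rule average_near_part[OF q]) (use rate \<delta> Y in \<open>auto simp: eventually_at_top_linorder\<close>)
  have "eventually (\<lambda>x. \<forall>R\<ge>0. (\<forall>y\<in>{A..x}. p y \<le> R * q y) \<longrightarrow>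
    (1 - 2 * \<delta>) * p x \<le> rate * (1 + \<delta> + 4 * \<delta> * R) * q x) at_top"
    using size_bias_asympD[OF size_biased_density_window[OF p zero_less_one, folded n_def] \<delta>] near A0[OF A(2)]
      average_far_part[OF p L(1) density_locally_dominated[OF p] w \<delta>, of A] eventually_gt_at_top[of 0]
  proof (eventually_elim, intro allI impI)
    fix x R
    assume s: "(1 - \<delta>) * (x * p x) \<le> average \<mu> n x \<and> average \<mu> n x \<le> (1 + \<delta>) * (x * p x)"
      and near: "\<forall>v\<in>{0..A}. n (x - v) \<le> (rate + rate * (\<delta> / 2) + rate * (\<delta> / 2)) * (x * q x)"
      and mid: "(\<integral>\<^sup>+v. ennreal (N (x - v)) * indicator {A<..} v \<partial>\<rho>) \<le> ennreal (\<delta> * (x * q x))"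
      and far: "(\<integral>\<^sup>+v. ennreal (n (x - v)) * indicator {x - A<..} v \<partial>\<mu>) \<le> ennreal (\<delta> * (x * p x))"
      and x: "0 < x" and R: "0 \<le> R" and pR: "\<forall>y\<in>{A..x}. p y \<le> R * q y"
    define k where "k = rate * (1 + \<delta>) * (x * q x)"
    have k: "0 \<le> k" using rate \<delta> x q_nonneg by (simp add: k_def)
    let ?n = "\<lambda>v. ennreal (n (x - v))"
    have "ennreal (average \<mu> n x) \<le> (\<integral>\<^sup>+v. ennreal k + ?n v * indicator {A<..x - A} v + ?n v * indicator {x - A<..} v \<partial>\<mu>)"
      unfolding ennreal_average[OF w L(1,2)]
    proof (rule nn_integral_mono_AE, use AE_nonneg[OF real_distributionD(4)[OF L(1)] L(2)] in eventually_elim)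
      fix v :: real assume "0 \<le> v"
      then consider "v \<in> {0..A}" | "v \<in> {A<..x - A}" | "v \<in> {x - A<..}" by force
      then show "?n v \<le> ennreal k + ?n v * indicator {A<..x - A} v + ?n v * indicator {x - A<..} v"
      proof cases
        case 1
        then have "?n v \<le> ennreal k" using near by (intro ennreal_leI) (auto simp: k_def algebra_simps)
        then show ?thesis by (simp add: add_increasing2 add.assoc)
      qed (auto simp: indicator_def add_increasing add_increasing2)
    qed
    also have "\<dots> = ennreal k + (\<integral>\<^sup>+v. ?n v * indicator {A<..x - A} v \<partial>\<mu>) + (\<integral>\<^sup>+v. ?n v * indicator {x - A<..} v \<partial>\<mu>)"
      by (subst nn_integral_add, measurable, subst nn_integral_add, measurable) (simp add: \<mu>.emeasure_space_1[simplified])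
    also have "(\<integral>\<^sup>+v. ?n v * indicator {A<..x - A} v \<partial>\<mu>) = (\<integral>\<^sup>+v. ennreal (p v) * (?n v * indicator {A<..x - A} v) \<partial>lborel)"
      by (rule nn_integral_\<mu>) measurable
    also have "\<dots> \<le> (\<integral>\<^sup>+v. ennreal (R * n (x - v)) * emeasure \<rho> {v<..v + 1} * indicator {A<..x - A} v \<partial>lborel)"
    proof (rule nn_integral_mono)
      fix v
      have "ennreal (p v) * ?n v \<le> ennreal (R * n (x - v)) * emeasure \<rho> {v<..v + 1}" if v: "v \<in> {A<..x - A}"
      proof -
        have "p v * n (x - v) \<le> (R * q v) * n (x - v)" using pR v A n0 by (intro mult_right_mono) auto
        then show ?thesis
          using R n0 pn by (simp add: \<rho>.emeasure_eq_measure q_def[symmetric] ennreal_mult[symmetric] q_nonneg ennreal_leI mult_ac)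
      qed
      then show "ennreal (p v) * (?n v * indicator {A<..x - A} v)
          \<le> ennreal (R * n (x - v)) * emeasure \<rho> {v<..v + 1} * indicator {A<..x - A} v"
        by (auto simp: indicator_def)
    qed
    also have "\<dots> \<le> (\<integral>\<^sup>+v. ennreal (R * (4 * rate * N (x - v))) * indicator {A<..} v \<partial>\<rho>)"
    proof (rule window_density_le_nn_integral)
      fix v t assume "A < t" "t \<le> x - A" "t < v" "v \<le> t + 1"
      then show "ennreal (R * n (x - t)) \<le> ennreal (R * (4 * rate * N (x - v)))"
        using R by (intro ennreal_leI mult_left_mono shift) auto
    qed (auto intro: real_distributionD[OF NL(1)])
    also have "\<dots> = ennreal (R * (4 * rate)) * (\<integral>\<^sup>+v. ennreal (N (x - v)) * indicator {A<..} v \<partial>\<rho>)"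
      using rate n0 R by (subst nn_integral_cmult[symmetric]) (auto simp: ennreal_mult mult.assoc)
    also have "\<dots> \<le> ennreal (R * (4 * rate)) * ennreal (\<delta> * (x * q x))" by (intro mult_left_mono mid) auto
    also note far
    finally have "ennreal (average \<mu> n x) \<le> ennreal k + ennreal (R * (4 * rate)) * ennreal (\<delta> * (x * q x)) + ennreal (\<delta> * (x * p x))"
      by (simp add: add_mono add_left_mono)
    also have "\<dots> = ennreal (k + R * (4 * rate) * (\<delta> * (x * q x)) + \<delta> * (x * p x))"
      using k R rate \<delta> x q_nonneg pn by (simp add: ennreal_mult ennreal_plus)
    finally have "average \<mu> n x \<le> k + R * (4 * rate) * (\<delta> * (x * q x)) + \<delta> * (x * p x)"
      using k R rate \<delta> x q_nonneg pn by (subst (asm) ennreal_le_iff) auto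
    then have "x * ((1 - 2 * \<delta>) * p x) \<le> x * (rate * (1 + \<delta> + 4 * \<delta> * R) * q x)"
      using s by (simp add: k_def algebra_simps)
    then show "(1 - 2 * \<delta>) * p x \<le> rate * (1 + \<delta> + 4 * \<delta> * R) * q x" using x by simp
  qed
  then show ?thesis using A(1) by blast
qed

text \<open>
  On \<open>[A, x]\<close> some ratio bound exists since \<open>p\<close> and \<open>q\<close> are locally bounded. The bootstrap turns a bound \<open>R\<close>
  into \<open>2 rate + R / 2\<close>, and iterating it leaves a bound that does not depend on \<open>x\<close>.
\<close>

lemma density_ratio_bounded:
  assumes p: "p \<in> long_tailed" and sub: "\<rho> \<in> loc_subexp"
  shows "\<exists>R\<ge>0. \<exists>A. \<forall>x\<ge>A. p x \<le> R * q x"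
proof -
  note rate = NL(3) and q = q_long_tailed[OF loc_subexp_imp_loc_long_tailed[OF sub]]
  \<comment> \<open>so small that the ratio bound \<open>R\<close> reappears with a factor of at most \<open>1/2\<close>\<close>
  define \<delta> where "\<delta> = min (1/8) (1 / (16 * rate))"
  have \<delta>: "0 < \<delta>" "\<delta> \<le> 1/8" "16 * (rate * \<delta>) \<le> 1"
  proof -
    show "0 < \<delta>" using rate by (simp add: \<delta>_def)
    show "\<delta> \<le> 1/8" unfolding \<delta>_def by (rule min.cobounded1)
    have "rate * \<delta> \<le> rate * (1 / (16 * rate))" using rate by (intro mult_left_mono) (auto simp: \<delta>_def)
    then show "16 * (rate * \<delta>) \<le> 1" using rate by simp
  qed
  obtain Ap where Ap: "\<And>x. Ap \<le> x \<Longrightarrow> \<exists>b>0. \<exists>B. \<forall>y\<in>{Ap..x}. b \<le> p y \<and> p y \<le> B"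
    using long_tailed_locally_bounded[OF p] by blast
  obtain Aq where Aq: "\<And>x. Aq \<le> x \<Longrightarrow> \<exists>b>0. \<exists>B. \<forall>y\<in>{Aq..x}. b \<le> q y \<and> q y \<le> B"
    using long_tailed_locally_bounded[OF q] by blast
  obtain A where A: "max Ap Aq \<le> A"
    "eventually (\<lambda>x. \<forall>R\<ge>0. (\<forall>y\<in>{A..x}. p y \<le> R * q y) \<longrightarrow>
      (1 - 2 * \<delta>) * p x \<le> rate * (1 + \<delta> + 4 * \<delta> * R) * q x) at_top"
    using density_ratio_bootstrap[OF p sub \<delta>(1), of "max Ap Aq"] by blast
  obtain X0 where X0: "\<And>x R. X0 \<le> x \<Longrightarrow> 0 \<le> R \<Longrightarrow> \<forall>y\<in>{A..x}. p y \<le> R * q y \<Longrightarrow>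
      (1 - 2 * \<delta>) * p x \<le> rate * (1 + \<delta> + 4 * \<delta> * R) * q x"
    using A(2) unfolding eventually_at_top_linorder by blast
  have step: "p x \<le> (2 * rate + R / 2) * q x" if "X0 \<le> x" "0 \<le> R" "\<forall>y\<in>{A..x}. p y \<le> R * q y" for x R
  proof -
    have "3 / 4 * p x \<le> (1 - 2 * \<delta>) * p x"
      using \<delta> pn by (intro mult_right_mono) auto
    also have "\<dots> \<le> rate * (1 + \<delta> + 4 * \<delta> * R) * q x" by (rule X0[OF that])
    also have "\<dots> \<le> (3 / 2 * rate + R / 4) * q x"
    proof (intro mult_right_mono q_nonneg)
      have "rate * (1 + \<delta>) \<le> rate * (3 / 2)" using rate \<delta> by (intro mult_left_mono) auto
      moreover have "(16 * (rate * \<delta>)) * R \<le> 1 * R" using \<delta> that by (intro mult_right_mono) auto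
      ultimately show "rate * (1 + \<delta> + 4 * \<delta> * R) \<le> 3 / 2 * rate + R / 4" by (simp add: algebra_simps)
    qed
    finally have "p x \<le> 4 / 3 * ((3 / 2 * rate + R / 4) * q x)" by simp
    also have "\<dots> = (2 * rate + R / 3) * q x" by (simp add: algebra_simps)
    also have "\<dots> \<le> (2 * rate + R / 2) * q x" using that by (intro mult_right_mono q_nonneg) auto
    finally show ?thesis .
  qed
  have bounded: "\<exists>M\<ge>0. \<forall>y\<in>{A..x}. p y \<le> M * q y" for x
  proof (cases "A \<le> x")
    case True
    obtain b B where b: "0 < b" "\<forall>y\<in>{Aq..x}. b \<le> q y \<and> q y \<le> B" using Aq[of x] True A(1) by auto
    obtain b' B' where B': "0 < b'" "\<forall>y\<in>{Ap..x}. b' \<le> p y \<and> p y \<le> B'" using Ap[of x] True A(1) by auto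
    have "B' / b \<ge> 0" using b B'(1) B'(2)[rule_format, of x] True A(1) by (intro divide_nonneg_pos) auto
    moreover have "p y \<le> B' / b * q y" if "y \<in> {A..x}" for y
    proof -
      have "p y \<le> B' / b * b" using B'(2) that A(1) b(1) by auto
      also have "\<dots> \<le> B' / b * q y" using b(2) that A(1) \<open>B' / b \<ge> 0\<close> by (intro mult_left_mono) auto
      finally show ?thesis .
    qed
    ultimately show ?thesis by blast
  next
    case False
    then show ?thesis by (intro exI[of _ 0]) auto
  qed
  obtain R0 where R0: "0 \<le> R0" "\<forall>y\<in>{A..X0}. p y \<le> R0 * q y" using bounded by blast
  define R where "R = max R0 (4 * rate)"
  have R: "0 \<le> R" "4 * rate \<le> R" "R0 \<le> R" using R0(1) by (auto simp: R_def)
  have "p x \<le> (R + 1) * q x" if "A \<le> x" for x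
  proof -
    define Q where "Q D \<longleftrightarrow> (\<forall>y\<in>{A..x}. p y \<le> (R + D) * q y)" for D
    obtain M where M: "0 \<le> M" "\<forall>y\<in>{A..x}. p y \<le> M * q y" using bounded by blast
    have mono: "Q D'" if "Q D" "D \<le> D'" for D D'
      unfolding Q_def
    proof
      fix y assume "y \<in> {A..x}"
      then have "p y \<le> (R + D) * q y" using that(1) by (auto simp: Q_def)
      also have "\<dots> \<le> (R + D') * q y" using that(2) by (intro mult_right_mono q_nonneg) auto
      finally show "p y \<le> (R + D') * q y" .
    qed
    have QM: "Q M"
      unfolding Q_def
    proof
      fix y assume "y \<in> {A..x}"
      then have "p y \<le> M * q y" using M(2) by auto
      also have "\<dots> \<le> (R + M) * q y" using R by (intro mult_right_mono q_nonneg) auto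
      finally show "p y \<le> (R + M) * q y" .
    qed
    have Qstep: "Q (1/2 * D + e)" if D: "Q D" "0 \<le> D" and e: "0 < e" for D e
      unfolding Q_def
    proof
      fix y assume y: "y \<in> {A..x}"
      show "p y \<le> (R + (1/2 * D + e)) * q y"
      proof (cases "X0 \<le> y")
        case True
        have "p y \<le> (2 * rate + (R + D) / 2) * q y"
          by (rule step[OF True]) (use R D y in \<open>auto simp: Q_def\<close>)
        also have "\<dots> \<le> (R + (1/2 * D + e)) * q y"
        proof (intro mult_right_mono q_nonneg)
          show "2 * rate + (R + D) / 2 \<le> R + (1/2 * D + e)" using R e by (simp add: field_simps)
        qed
        finally show ?thesis .
      next
        case False
        then have "p y \<le> R0 * q y" using R0(2) y by auto
        also have "\<dots> \<le> (R + (1/2 * D + e)) * q y" using R D e by (intro mult_right_mono q_nonneg) auto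
        finally show ?thesis .
      qed
    qed
    have "Q 1"
    proof (rule contraction_to_zero[of Q M "1/2"])
      show "Q D'" if "Q D" "D \<le> D'" for D D' using that by (rule mono)
      show "Q (1/2 * D + e)" if "Q D" "0 \<le> D" "0 < e" for D e using that by (rule Qstep)
    qed (use QM M(1) in auto)
    then show ?thesis using that by (auto simp: Q_def)
  qed
  then show ?thesis using R(1) by (intro exI[of _ "R + 1"]) auto
qed

text \<open>
  With a bounded ratio the bootstrap gives the upper bound. The lower bound needs only small values of the
  variable that is distributed according to \<open>\<mu>\<close>.
\<close>

lemma loc_subexp_imp_density_equiv:
  assumes p: "p \<in> long_tailed" and sub: "\<rho> \<in> loc_subexp"
  shows "tail_equiv p (\<lambda>x. measure \<nu> {x<..x + 1})"
proof -
  note rate = NL(3) and q = q_long_tailed[OF loc_subexp_imp_loc_long_tailed[OF sub]]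
  have tpos: "eventually (\<lambda>x. 0 < rate * q x) at_top" using long_tailedD(3)[OF q] by eventually_elim (use rate in simp)
  obtain R A1 where R: "0 \<le> R" "\<And>x. A1 \<le> x \<Longrightarrow> p x \<le> R * q x" using density_ratio_bounded[OF p sub] by blast
  have "tail_equiv p (\<lambda>x. rate * q x)"
  proof (rule tail_equivI_ratio[OF tpos])
    fix \<epsilon> :: real assume \<epsilon>: "0 < \<epsilon>"
    define \<delta> where "\<delta> = min (1/8) (\<epsilon> / (10 + 8 * R))"
    have \<delta>: "0 < \<delta>" "\<delta> \<le> 1/8" "(10 + 8 * R) * \<delta> \<le> \<epsilon>"
    proof -
      show "0 < \<delta>" using \<epsilon> R by (simp add: \<delta>_def)
      show "\<delta> \<le> 1/8" unfolding \<delta>_def by (rule min.cobounded1)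
      have "(10 + 8 * R) * \<delta> \<le> (10 + 8 * R) * (\<epsilon> / (10 + 8 * R))"
        using R by (intro mult_left_mono) (auto simp: \<delta>_def)
      then show "(10 + 8 * R) * \<delta> \<le> \<epsilon>" using R by simp
    qed
    have ld: "0 < rate * \<delta>" using rate \<delta> by simp
    obtain A where A: "A1 \<le> A" "eventually (\<lambda>x. \<forall>R\<ge>0. (\<forall>y\<in>{A..x}. p y \<le> R * q y) \<longrightarrow>
      (1 - 2 * \<delta>) * p x \<le> rate * (1 + \<delta> + 4 * \<delta> * R) * q x) at_top"
      using density_ratio_bootstrap[OF p sub \<delta>(1), of A1] by blast
    have low: "eventually (\<lambda>y. rate * (y * q y) \<le> levy_window \<nu> 1 y) at_top"
      using eventually_ge_at_top[of 1]
    proof eventually_elim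
      case (elim y)
      have "rate * (y * q y) = y * measure \<nu> {y<..y + 1}" by (simp add: levy_window_mass[OF elim])
      also have "\<dots> \<le> levy_window \<nu> 1 y" using levy_window_bounds[OF L(3), of y 1] elim by simp
      finally show ?case .
    qed
    have S: "UNIV \<in> sets (borel :: real measure)" by simp
    have w: "window_function (levy_window \<nu> 1)" by (rule window_function_levy_window[OF L(3)]) simp
    interpret \<mu>: real_distribution \<mu> by (rule L)
    have P1: "\<mu>.prob UNIV = 1" using \<mu>.prob_space by simp
    show "eventually (\<lambda>x. \<bar>p x - rate * q x\<bar> \<le> \<epsilon> * (rate * q x)) at_top"
      using A(2) size_bias_asympD[OF size_biased_density_window[OF p zero_less_one] \<delta>(1)]
        average_lower[OF q L(1,2) less_imp_le[OF rate] low S ld] tpos eventually_gt_at_top[of 0]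
    proof eventually_elim
      case (elim x)
      define t where "t = rate * q x"
      have t: "0 < t" using elim(4) by (simp add: t_def)
      have 1: "(1 - 2 * \<delta>) * p x \<le> (1 + \<delta> + 4 * \<delta> * R) * t"
        using elim(1) R A(1) by (auto simp: t_def mult_ac)
      have dd: "\<delta> * \<delta> \<le> 1/8 * \<delta>" using \<delta> by (intro mult_right_mono) auto
      have "p x \<le> (1 + 3 * \<delta>) * ((1 - 2 * \<delta>) * p x)"
      proof -
        have "1 \<le> (1 + 3 * \<delta>) * (1 - 2 * \<delta>)" using dd \<delta> by (simp add: algebra_simps)
        from mult_right_mono[OF this pn[of x]] show ?thesis by (simp add: mult.assoc)
      qed
      also have "\<dots> \<le> (1 + 3 * \<delta>) * ((1 + \<delta> + 4 * \<delta> * R) * t)" using 1 \<delta> by (intro mult_left_mono) auto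
      also have "\<dots> = (1 + (4 + 4 * R) * \<delta> + (3 + 12 * R) * (\<delta> * \<delta>)) * t" by (simp add: algebra_simps)
      also have "\<dots> \<le> (1 + (4 + 4 * R) * \<delta> + (3 + 12 * R) * (1/8 * \<delta>)) * t"
        by (intro mult_right_mono add_left_mono mult_left_mono dd) (use R t in simp_all)
      also have "\<dots> \<le> (1 + (10 + 8 * R) * \<delta>) * t"
      proof (intro mult_right_mono)
        have "0 \<le> R * \<delta>" using R \<delta> by simp
        then show "1 + (4 + 4 * R) * \<delta> + (3 + 12 * R) * (1/8 * \<delta>) \<le> 1 + (10 + 8 * R) * \<delta>"
          using \<delta>(1) by (simp add: algebra_simps)
      qed (use t in simp)
      finally have up: "p x \<le> (1 + (10 + 8 * R) * \<delta>) * t" .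
      have up': "(10 + 8 * R) * \<delta> * t \<le> \<epsilon> * t" using \<delta>(3) t by (intro mult_right_mono) auto
      define a where "a = average \<mu> (levy_window \<nu> 1) x"
      have a: "0 \<le> a" "a \<le> (1 + \<delta>) * (x * p x)" using elim(2) average_nonneg[OF w] by (auto simp: a_def)
      have "ennreal ((rate * 1 - rate * \<delta>) * (x * q x)) \<le> ennreal a"
        using elim(3) unfolding a_def ennreal_average[OF w L(1,2)] P1 by simp
      then have "(rate * 1 - rate * \<delta>) * (x * q x) \<le> a" using a(1) by (simp add: ennreal_le_iff)
      also note a(2)
      finally have "x * ((1 - \<delta>) * t) \<le> x * ((1 + \<delta>) * p x)" by (simp add: t_def algebra_simps)
      then have low1: "(1 - \<delta>) * t \<le> (1 + \<delta>) * p x" using elim(5) by simp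
      have \<epsilon>t: "0 \<le> \<epsilon> * t" using \<epsilon> t by simp
      have low': "t - p x \<le> \<epsilon> * t"
      proof (cases "p x \<le> t")
        case True
        then have "\<delta> * p x \<le> \<delta> * t" using \<delta> by (intro mult_left_mono) auto
        then have "t - p x \<le> 2 * \<delta> * t" using low1 by (simp add: algebra_simps)
        also have "\<dots> \<le> (10 + 8 * R) * \<delta> * t" using R \<delta> t by (intro mult_right_mono) auto
        also note up'
        finally show ?thesis .
      qed (use \<epsilon>t in simp)
      show ?case using up up' low' unfolding t_def[symmetric] by (simp add: abs_le_iff algebra_simps)
    qed
  qed
  then have sym: "tail_equiv (\<lambda>x. rate * q x) p" by (rule tail_equiv_sym)
  have "eventually (\<lambda>x. measure \<nu> {x<..x + 1} = rate * q x) at_top"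
    using eventually_ge_at_top[of 1] by eventually_elim (rule levy_window_mass)
  from tail_equiv_sym[OF tail_equiv_cong[OF this sym]] show ?thesis .
qed

lemma loc_long_tailed_imp_long_tailed:
  assumes lt: "\<rho> \<in> loc_long_tailed" and C: "0 < C" and eq: "tail_equiv p (\<lambda>x. C * measure \<nu> {x<..x + 1})"
  shows "p \<in> long_tailed"
proof (rule long_tailed_tail_equiv)
  show "(\<lambda>x. C * rate * q x) \<in> long_tailed" by (rule long_tailed_cmult[OF q_long_tailed[OF lt]]) (use C NL(3) in simp)
  have "eventually (\<lambda>x. C * rate * q x = C * measure \<nu> {x<..x + 1}) at_top"
    using eventually_ge_at_top[of 1] by eventually_elim (simp add: levy_window_mass)
  from tail_equiv_sym[OF tail_equiv_cong[OF this tail_equiv_sym[OF eq]]]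
  show "tail_equiv p (\<lambda>x. C * rate * q x)" .
qed (rule pm pn)+

end

section \<open>Subexponential densities and locally subexponential Levy measures\<close>

theorem proposition1p1:
  fixes \<mu> \<nu> :: "real measure" and p :: "real \<Rightarrow> real"
  assumes "levy_khintchine_on_nonneg \<mu> 0 \<nu>"
    and "absolutely_continuous lborel \<mu>"
    and "\<And>c. 0 < c \<Longrightarrow> 0 < emeasure \<nu> {c<..}"
    and "nonneg_density_of p \<mu>"
  shows "(p \<in> long_tailed_densities \<longrightarrow>
            (p \<in> subexp_densities \<longleftrightarrow> normalized_levy \<nu> \<in> loc_subexp)) \<and>
         (p \<in> subexp_densities \<longleftrightarrow>
            normalized_levy \<nu> \<in> loc_long_tailed \<and>
              tail_equiv p (\<lambda>x. measure \<nu> {x<..x + 1})) \<and>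
         (normalized_levy \<nu> \<in> loc_long_tailed \<and>
              tail_equiv p (\<lambda>x. measure \<nu> {x<..x + 1}) \<longleftrightarrow>
            normalized_levy \<nu> \<in> loc_long_tailed \<and>
              (\<exists>C>0. tail_equiv p (\<lambda>x. C * measure \<nu> {x<..x + 1})))"
proof -
  interpret levy_density \<mu> \<nu> p
    by (rule levy_density.intro) (use assms in auto)
  have ab: "normalized_levy \<nu> \<in> loc_long_tailed \<and> tail_equiv p (\<lambda>x. measure \<nu> {x<..x + 1})"
    if "p \<in> subexp_densities"
    using subexp_imp_normalized_levy_loc_long_tailed[OF that] tail_equiv_sym[OF subexp_levy_density[OF that zero_less_one]]
    by simp
  have ca: "p \<in> subexp_densities \<and> C = 1"
    if "normalized_levy \<nu> \<in> loc_long_tailed" "0 < C" "tail_equiv p (\<lambda>x. C * measure \<nu> {x<..x + 1})" for C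
    using levy_density_equiv_imp_subexp[OF loc_long_tailed_imp_long_tailed[OF that] that(2,3)] by blast
  have ba: "p \<in> subexp_densities"
    if "normalized_levy \<nu> \<in> loc_long_tailed" "tail_equiv p (\<lambda>x. measure \<nu> {x<..x + 1})"
    using ca[of 1] that by simp
  have i: "p \<in> subexp_densities" if "p \<in> long_tailed_densities" "normalized_levy \<nu> \<in> loc_subexp"
    using ba[OF loc_subexp_imp_loc_long_tailed loc_subexp_imp_density_equiv] that
    by (simp add: long_tailed_densities_def)
  have c: "tail_equiv p (\<lambda>x. measure \<nu> {x<..x + 1})"
    if "normalized_levy \<nu> \<in> loc_long_tailed" "\<exists>C>0. tail_equiv p (\<lambda>x. C * measure \<nu> {x<..x + 1})"
    using ca that by force
  have b: "\<exists>C>0. tail_equiv p (\<lambda>x. C * measure \<nu> {x<..x + 1})" if "tail_equiv p (\<lambda>x. measure \<nu> {x<..x + 1})"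
    by (rule exI[of _ 1]) (use that in simp)
  show ?thesis using ab ba i subexp_imp_normalized_levy_loc_subexp b c by blast
qed

end
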